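(* Fix an integer $m\ge2$. For positive integers $n$ and $r$, let $p_n(r)$ be the probability that $m$ independent uniformly random $r$-edge-colourings of $K_n$ admit a rainbow stacking, and for $n\ge2$ put $$r_0(n)=\frac{m\binom n2}{2\log(n!)}+\frac{2m-1}{6}.$$ Then there is a set $\mathcal A\subseteq\mathbb N$ of natural density one such that, for every choice of positive integers $r=r(n)$ ($n\in\mathcal A$): if $r(n)<\lceil r_0(n)\rceil$ for all $n\in\mathcal A$, then $p_n(r(n))\to0$ as $n\to\infty$ along $\mathcal A$; and if $r(n)\ge\lceil r_0(n)\rceil$ for all $n\in\mathcal A$, then $p_n(r(n))\to1$ as $n\to\infty$ along $\mathcal A$.
   Context: $[n]=\{1,\dots,n\}$; $K_n$ is the complete graph with vertex set $[n]$ and edge set $\binom{[n]}2$; $\mathfrak S_n$ is the symmetric group on $[n]$, acting on two-element subsets by $\sigma(\{u,v\})=\{\sigma(u),\sigma(v)\}$. $C_r$ is a palette of $r$ colours; an $r$-edge-colouring of $K_n$ is a map $\binom{[n]}2\to C_r$, and a uniformly random one assigns independent uniform colours to the edges. A rainbow stacking of edge-colourings $\chi_1,\dots,\chi_m$ is a tuple $\sigma=(\sigma_1,\dots,\sigma_m)\in\mathfrak S_n^m$ such that for every $e\in\binom{[n]}2$ the colours $\chi_1(\sigma_1^{-1}(e)),\dots,\chi_m(\sigma_m^{-1}(e))$ are pairwise distinct. $\log$ is the natural logarithm. A set $\mathcal A\subseteq\mathbb N$ has natural density one if $|\mathcal A\cap[1,x]|/x\to1$ as $x\to\infty$. *)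

theory Defs
  imports "HOL-Probability.Probability" "HOL-Probability.Product_PMF"
    "HOL-Combinatorics.Permutations"
begin

definition edges :: "nat \<Rightarrow> nat set set" where
  "edges n = {e. e \<subseteq> {1..n} \<and> card e = 2}"

definition palette :: "nat \<Rightarrow> nat set" where
  "palette r = {1..r}"

text \<open>
  Permutations are functions on all of \<^typ>\<open>nat\<close> fixing everything outside \<open>{1..n}\<close>;
  they act on an edge by taking images.
\<close>

definition rainbow_stacking ::
    "nat \<Rightarrow> nat \<Rightarrow> (nat \<Rightarrow> nat set \<Rightarrow> nat) \<Rightarrow> (nat \<Rightarrow> nat \<Rightarrow> nat) \<Rightarrow> bool" where
  "rainbow_stacking m n f \<sigma> \<longleftrightarrow>
     \<sigma> \<in> {1..m} \<rightarrow>\<^sub>E {\<pi>. \<pi> permutes {1..n}} \<and>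
     (\<forall>e\<in>edges n. inj_on (\<lambda>i. f i (inv (\<sigma> i) ` e)) {1..m})"

text \<open>
  The colours of the edges are independent and uniform; the value \<^const>\<open>undefined\<close> is taken
  outside \<open>edges n\<close>. This is only meaningful for \<open>r > 0\<close>, since
  \<^const>\<open>pmf_of_set\<close> is unspecified on the empty set.
\<close>

definition random_colouring :: "nat \<Rightarrow> nat \<Rightarrow> (nat set \<Rightarrow> nat) pmf" where
  "random_colouring n r = Pi_pmf (edges n) undefined (\<lambda>_. pmf_of_set (palette r))"

definition stacking_prob :: "nat \<Rightarrow> nat \<Rightarrow> nat \<Rightarrow> real" where
  "stacking_prob m n r =
     measure_pmf.prob (Pi_pmf {1..m} undefined (\<lambda>_. random_colouring n r))
       {f. \<exists>\<sigma>. rainbow_stacking m n f \<sigma>}"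

text \<open>Only meaningful for \<open>n \<ge> 2\<close>; otherwise the denominator vanishes.\<close>

definition r0 :: "nat \<Rightarrow> nat \<Rightarrow> real" where
  "r0 m n = real m * real (n choose 2) / (2 * ln (fact n)) + (2 * real m - 1) / 6"

definition natural_density_one :: "nat set \<Rightarrow> bool" where
  "natural_density_one A \<longleftrightarrow>
     ((\<lambda>x::real. real (card {k \<in> A. 1 \<le> real k \<and> real k \<le> x}) / x) \<longlongrightarrow> 1) at_top"

definition along :: "nat set \<Rightarrow> nat filter" where
  "along A = inf sequentially (principal A)"

end

theory Submission
  imports Defs "HOL-Real_Asymp.Real_Asymp"
begin

text \<open>
  The proof is the first and second moment method for the number of rainbow stackings. Put
  \<open>N = n choose 2\<close> and \<open>L = ln (n!)\<close>. Up to a common relabelling there are \<open>(n!) ^ (m - 1)\<close> stackings, and each is rainbow with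
  probability \<open>(\<Prod>t<m. 1 - t / r) ^ N\<close>. Expanding the logarithm to second order in \<open>1 / r\<close>, the expected number of
  classes of rainbow stackings is the exponential of
  \<open>(m - 1) * (L - N * (m / 2) * (1 / r + (2 m - 1) / (6 r\<^sup>2)))\<close> up to a factor \<open>exp (o (1))\<close>, and the bracket vanishes at \<open>r0\<close> up to \<open>o (1)\<close>.
  Near \<open>r0\<close>, which is of order \<open>n / ln n\<close>, changing \<open>r\<close> by one changes the bracket by the order of \<open>(ln n)\<^sup>2\<close>. So if \<open>r0\<close> is at distance at
  least \<open>1 / ln n\<close> from all integers, the expectation is at most a negative power of \<open>n\<close> for all integers \<open>r\<close> below \<open>r0\<close>, and
  at least a positive power of \<open>n\<close> for those above. Such \<open>n\<close> have density one because \<open>r0\<close> increases with slope of order \<open>1 / ln n\<close>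
  (lemma \<open>natural_density_gap_orders\<close>). Markov's inequality settles the lower range (\<open>stacking_prob_le\<close>).

  For the upper range the mean square must be at most \<open>1 + o (1)\<close> times the squared mean. The colourings for which two given
  stackings are both rainbow are the proper edge colourings of an \<open>m\<close>-regular bipartite multigraph on
  \<open>2 N\<close> vertices. Colouring one vertex star after the other and applying a truncated inclusion-exclusion at each step bounds
  their number by the value expected under independence, times \<open>exp (O (N / r\<^sup>3)) = exp (o (1))\<close>, times a
  factor \<open>exp (1 / r + (2 m - 1) / (6 r\<^sup>2))\<close> for every pair of cells that both stackings put on a common edge
  (\<open>card_avoiding_injections_le\<close>, \<open>card_full_colourings_le\<close>). Summing over pairs of stackings leaves the exponential moment of
  the number of agreements among \<open>m\<close> random permutations of the edges. Averaging over the \<open>m\<close> stars of the complete graph on the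
  \<open>m\<close> colourings reduces it to the \<open>(m - 1)\<close>-st power of the mean of \<open>\<theta>\<close> to the number of edges fixed by one random permutation
  (\<open>sum_exp_agreements_le\<close>), where \<open>\<theta> ^ N\<close> is \<open>n!\<close> divided by the \<open>(m - 1)\<close>-st root of the expected number of classes, up to \<open>exp (o (1))\<close>. That mean tends to one
  (\<open>sum_power_fixed_pairs_le\<close>, \<open>fixed_excess_tendsto\<close>): permutations with few fixed points contribute one, the identity contributes
  \<open>\<theta> ^ N / n!\<close>, which vanishes, and everything in between is negligible. All bounds are monotone in \<open>r\<close> and therefore
  extend from \<open>r0 + 1 / ln n\<close> to every larger number of colours.
\<close>

section \<open>The threshold function and the set of good orders\<close>

lemma ln_fact_le: "ln (fact n :: real) \<le> real n * ln (real n)"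
proof (cases "n = 0")
  case False
  have "(fact n :: real) \<le> real n ^ n"
    using fact_le_power[of n] by simp
  then have "ln (fact n :: real) \<le> ln (real n ^ n)"
    by (intro ln_mono) auto
  then show ?thesis using False by (simp add: ln_realpow)
qed auto

lemma ln_fact_ge: "real n * ln (real n) - real n \<le> ln (fact n :: real)"
proof (cases "n = 0")
  case False
  have s: "summable (\<lambda>k. real n ^ k /\<^sub>R fact k)" by (rule summable_exp_generic)
  have "real n ^ n / fact n = (\<Sum>k\<in>{n}. real n ^ k /\<^sub>R fact k)" by (simp add: divide_inverse)
  also have "\<dots> \<le> exp (real n)"
    unfolding exp_def by (intro sum_le_suminf s) auto
  finally have "ln (real n ^ n / fact n) \<le> ln (exp (real n))"
    using False by (subst ln_le_cancel_iff) auto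
  then show ?thesis using False by (simp add: ln_div ln_realpow)
qed auto

lemma ln_fact_asymp: "(\<lambda>n. ln (fact n :: real) / (real n * ln (real n))) \<longlonglongrightarrow> 1"
proof (rule tendsto_sandwich)
  show "\<forall>\<^sub>F n in sequentially. (real n * ln (real n) - real n) / (real n * ln (real n))
          \<le> ln (fact n) / (real n * ln (real n))"
    using eventually_ge_at_top[of 2]
    by eventually_elim (intro divide_right_mono ln_fact_ge, auto)
  show "\<forall>\<^sub>F n in sequentially. ln (fact n) / (real n * ln (real n)) \<le> (1::real)"
    using eventually_ge_at_top[of 2]
    by eventually_elim (use ln_fact_le in \<open>auto simp: field_simps\<close>)
  show "(\<lambda>n. (real n * ln (real n) - real n) / (real n * ln (real n))) \<longlonglongrightarrow> 1"
    by real_asymp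
qed auto

lemma real_choose_two: "real (n choose 2) = real n * (real n - 1) / 2"
  by (cases n) (auto simp: choose_two real_of_nat_div algebra_simps)

lemma ln_fact_pos: "n \<ge> 2 \<Longrightarrow> ln (fact n :: real) > 0"
proof -
  assume "n \<ge> 2"
  then have "(2::nat) \<le> fact n" using fact_ge_self[of n] by linarith
  then have "real 2 \<le> real (fact n)" by (rule of_nat_mono)
  then show ?thesis by (intro ln_gt_zero) simp
qed

lemma r0_asymp: "(\<lambda>n. r0 m n * ln (real n) / real n) \<longlonglongrightarrow> real m / 4"
proof -
  define q where "q = (\<lambda>n. ln (fact n :: real) / (real n * ln (real n)))"
  have a: "(\<lambda>n. real m * (real n * (real n - 1) / 2) / (2 * (real n * ln (real n))) * ln (real n) / real n) \<longlonglongrightarrow> real m / 4"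
    by real_asymp
  have b: "q \<longlonglongrightarrow> 1" unfolding q_def by (rule ln_fact_asymp)
  have c: "(\<lambda>n. (2 * real m - 1) / 6 * ln (real n) / real n) \<longlonglongrightarrow> 0" by real_asymp
  note 1 = tendsto_add[OF tendsto_divide[OF a b] c]
  show ?thesis
  proof (rule Lim_transform_eventually)
    show "\<forall>\<^sub>F n in sequentially. real m * (real n * (real n - 1) / 2) / (2 * (real n * ln (real n))) * ln (real n) / real n / q n
     + (2 * real m - 1) / 6 * ln (real n) / real n = r0 m n * ln (real n) / real n"
      using eventually_ge_at_top[of 2]
    proof eventually_elim
      case (elim n)
      have "ln (fact n :: real) > 0" using elim by (intro ln_fact_pos)
      then show ?case unfolding r0_def q_def real_choose_two using elim by (simp add: field_simps)
    qed
  qed (use 1 in simp)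
qed

lemma frac_increment:
  fixes a b c :: real
  assumes "b' = b + c" "b \<noteq> 0" "b' \<noteq> 0"
  shows "(a + n) / b' - a / b = (n * b - a * c) / (b * b')"
  using assms(2,3) by (simp add: field_simps) (simp add: assms(1) algebra_simps)

text \<open>
  Writing \<open>N\<close> for the number of edges and \<open>L = ln (n!)\<close>, the increment of \<open>N / L\<close> has numerator
  \<open>n L - N ln (n + 1)\<close>. Here \<open>n L\<close> is about \<open>n\<^sup>2 ln n\<close> while \<open>N ln (n + 1)\<close> is only half of that, so
  \<open>r0\<close> climbs at the steady rate \<open>1 / ln n\<close>: slowly enough to visit every unit interval about
  \<open>ln n\<close> times, and fast enough not to linger at an integer.
\<close>

lemma r0_increment:
  assumes "m \<ge> 2"
  shows "\<forall>\<^sub>F n in sequentially. r0 m (Suc n) - r0 m n \<ge> 1 / (16 * ln (real n))"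
proof -
  have e1: "\<forall>\<^sub>F n in sequentially. real n * (real n * ln (real n) - real n) - real n * (real n - 1) / 2 * ln (real (Suc n)) \<ge> real n ^ 2 / 4 * ln (real n)"
    by real_asymp
  have e2: "\<forall>\<^sub>F n in sequentially. (real n * ln (real n)) * (real (Suc n) * ln (real (Suc n))) \<le> 4 * real n ^ 2 * ln (real n) ^ 2"
    by real_asymp
  show ?thesis using e1 e2 eventually_ge_at_top[of 3]
  proof eventually_elim
    case (elim n)
    let ?L = "ln (fact n :: real)" and ?L' = "ln (fact (Suc n) :: real)"
    have L: "?L > 0" using elim by (intro ln_fact_pos) simp
    have L': "?L' = ?L + ln (real (Suc n))" by (simp add: ln_mult)
    have lp: "ln (real n) > 0" using elim by simp
    have lp': "ln (real (Suc n)) > 0" using elim by simp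
    have L'0: "?L' > 0" using elim by (intro ln_fact_pos) simp
    have "?L * ?L' \<le> (real n * ln (real n)) * (real (Suc n) * ln (real (Suc n)))"
      by (intro mult_mono ln_fact_le) (use L'0 lp in auto)
    with elim have den: "?L * ?L' \<le> 4 * real n ^ 2 * ln (real n) ^ 2" by linarith
    have num: "real n * ?L - real n * (real n - 1) / 2 * ln (real (Suc n)) \<ge> real n ^ 2 / 4 * ln (real n)"
      using elim(1) mult_left_mono[OF ln_fact_ge[of n], of "real n"] by linarith
    have N: "real (Suc n choose 2) = real n * (real n - 1) / 2 + real n"
      by (simp add: real_choose_two field_simps)
    have "r0 m (Suc n) - r0 m n = real m / 2 * ((real n * (real n - 1) / 2 + real n) / ?L' - real n * (real n - 1) / 2 / ?L)"
      unfolding r0_def N real_choose_two[of n] using L L'0 by (simp add: field_simps)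
    also have "\<dots> = real m / 2 * ((real n * ?L - real n * (real n - 1) / 2 * ln (real (Suc n))) / (?L * ?L'))"
      by (subst frac_increment[OF L' less_imp_neq[OF L, symmetric] less_imp_neq[OF L'0, symmetric]]) simp
    also have "\<dots> \<ge> 1 * ((real n ^ 2 / 4 * ln (real n)) / (4 * real n ^ 2 * ln (real n) ^ 2))"
    proof (rule mult_mono)
      have n0: "0 \<le> real n ^ 2 / 4 * ln (real n)" using lp by simp
      show "(real n ^ 2 / 4 * ln (real n)) / (4 * real n ^ 2 * ln (real n) ^ 2) \<le>
        (real n * ?L - real n * (real n - 1) / 2 * ln (real (Suc n))) / (?L * ?L')"
        using n0 num by (intro frac_le den) (use L L'0 in \<open>auto intro!: mult_pos_pos\<close>)
      show "0 \<le> (real n ^ 2 / 4 * ln (real n)) / (4 * real n ^ 2 * ln (real n) ^ 2)"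
        using n0 by simp
    qed (use assms in auto)
    also have "1 * ((real n ^ 2 / 4 * ln (real n)) / (4 * real n ^ 2 * ln (real n) ^ 2)) = 1 / (16 * ln (real n))"
      using lp elim by (simp add: field_simps power2_eq_square)
    finally show ?case .
  qed
qed


text \<open>
  The logarithm of the expected number of stackings changes by the order of \<open>(ln n)\<^sup>2\<close> when the number of
  colours changes by one. A distance of \<open>1 / ln n\<close> from \<open>r0\<close> therefore still moves it by a multiple of
  \<open>ln n\<close>, which tends to infinity; on the other hand \<open>1 / ln n\<close> is small enough for the excluded orders
  to have density zero.
\<close>

definition gap_orders :: "nat \<Rightarrow> nat set" where
  "gap_orders m = {n. n \<ge> 2 \<and> (\<forall>k::int. \<bar>r0 m n - k\<bar> \<ge> 1 / ln (real n))}"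

text \<open>
  Between \<open>sqrt x\<close> and \<open>x\<close> the function \<open>r0\<close> takes values below \<open>2 m x / ln x\<close> and increases in steps of
  at least \<open>1 / (16 ln x)\<close>. Hence only boundedly many orders fall within \<open>2 / ln x\<close> of a given
  integer, and only \<open>O (x / ln x)\<close> integers are in reach.
\<close>

lemma card_not_gap_orders_le:
  assumes "m \<ge> 2"
  shows "\<forall>\<^sub>F x::real in at_top.
    real (card {n. n \<notin> gap_orders m \<and> 1 \<le> real n \<and> real n \<le> x})
      \<le> sqrt x + (2 * real m * x / ln x + 5) * 67"
proof -
  obtain n1 where n1: "\<And>n. n \<ge> n1 \<Longrightarrow> r0 m (Suc n) - r0 m n \<ge> 1 / (16 * ln (real n))"
    using r0_increment[OF assms] unfolding eventually_sequentially by blast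
  have "\<forall>\<^sub>F n in sequentially. r0 m n * ln (real n) / real n < real m"
    using assms by (intro order_tendstoD(2)[OF r0_asymp]) simp
  then obtain n2 where n2: "\<And>n. n \<ge> n2 \<Longrightarrow> r0 m n * ln (real n) / real n < real m"
    unfolding eventually_sequentially by blast
  have "\<forall>\<^sub>F x::real in at_top. sqrt x \<ge> real (n1 + n2 + 3)"
    by real_asymp
  then show ?thesis using eventually_ge_at_top[of 9]
  proof eventually_elim
    case (elim x)
    have lx: "ln x > 0" using elim by simp
    have lnsqrt: "ln (sqrt x) = ln x / 2" using elim by (simp add: ln_sqrt)
    define D where "D = {n. n \<notin> gap_orders m \<and> sqrt x \<le> real n \<and> real n \<le> x}"
    define K where "K = \<lceil>2 * real m * x / ln x\<rceil> + 1"
    \<comment> \<open>scaled by \<open>16 ln x\<close>, consecutive values of \<open>r0\<close> differ by at least one and the distance \<open>2 / ln x\<close> becomes 32; the 33 makes room for the floors\<close>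
    define h where "h = (\<lambda>n. \<lfloor>16 * ln x * r0 m n\<rfloor>)"
    define J where "J = (\<lambda>k::int. {\<lfloor>16 * ln x * k\<rfloor> - 33..\<lfloor>16 * ln x * k\<rfloor> + 33})"
    have finD: "finite D"
      by (rule finite_subset[of _ "{..nat \<lfloor>x\<rfloor>}"]) (auto simp: D_def le_nat_floor)
    have less: "h n < h n'" if "n \<in> D" "n' \<in> D" "n < n'" for n n'
    proof -
      have nn: "sqrt x \<le> real n" "real n' \<le> x" using that by (auto simp: D_def)
      have step: "r0 m i + 1 / (16 * ln x) \<le> r0 m (Suc i)" if "n \<le> i" "i < n'" for i
      proof -
        have "real n \<ge> n1 + n2 + 3" using nn elim by linarith
        then have i: "i \<ge> n1" "i \<ge> 2" using that by linarith+
        have "real i \<le> x" using that nn by linarith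
        then have "ln (real i) \<le> ln x" using i by (intro ln_mono) auto
        then have "1 / (16 * ln x) \<le> 1 / (16 * ln (real i))"
          using i by (intro divide_left_mono) (auto intro!: mult_pos_pos lx)
        then show ?thesis using n1[OF i(1)] by linarith
      qed
      have "r0 m n + 1 / (16 * ln x) \<le> r0 m j" if "Suc n \<le> j" "j \<le> n'" for j
        using that
      proof (induction j rule: dec_induct)
        case base
        then show ?case using step[of n] by simp
      next
        case (step i)
        then show ?case using \<open>\<And>i. n \<le> i \<Longrightarrow> i < n' \<Longrightarrow> r0 m i + 1 / (16 * ln x) \<le> r0 m (Suc i)\<close>[of i] lx
          by (smt (verit) Suc_le_eq Suc_leD divide_pos_pos zero_less_mult_iff)
      qed
      from this[of n'] have "r0 m n + 1 / (16 * ln x) \<le> r0 m n'" using that by auto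
      then have "16 * ln x * (r0 m n + 1 / (16 * ln x)) \<le> 16 * ln x * r0 m n'"
        using lx by (intro mult_left_mono) auto
      then have "16 * ln x * r0 m n + 1 \<le> 16 * ln x * r0 m n'"
        using lx by (simp add: algebra_simps)
      then show ?thesis unfolding h_def by linarith
    qed
    have inj: "inj_on h D"
      by (rule inj_onI) (metis less linorder_neqE_nat order_less_irrefl)
    have sub: "h ` D \<subseteq> (\<Union>k\<in>{-1..K}. J k)"
    proof
      fix y assume "y \<in> h ` D"
      then obtain n where n: "n \<in> D" "y = h n" by blast
      have nn: "sqrt x \<le> real n" "real n \<le> x" "real n \<ge> n1 + n2 + 3"
        using n elim by (auto simp: D_def)
      then have n3: "n \<ge> 3" "n \<ge> n2" by linarith+
      obtain k :: int where k: "\<bar>r0 m n - k\<bar> < 1 / ln (real n)"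
        using n n3 by (auto simp: D_def gap_orders_def not_le)
      have "exp 1 \<le> (3::real)" using exp_le by simp
      then have l1: "ln (real n) \<ge> 1" using n3 by (subst ln_ge_iff) auto
      have l2: "ln (real n) \<ge> ln x / 2"
        using nn elim unfolding lnsqrt[symmetric] by (intro ln_mono) auto
      have d1: "1 / ln (real n) \<le> 1" using l1 by simp
      have d2: "1 / ln (real n) \<le> 2 / ln x" using l1 l2 lx by (simp add: field_simps)
      have "r0 m n \<ge> 0" unfolding r0_def using ln_fact_pos[of n] n3 assms by simp
      moreover have "r0 m n \<le> 2 * real m * x / ln x"
      proof -
        have "r0 m n < real m * real n / ln (real n)"
          using n2[OF n3(2)] l1 n3 by (simp add: field_simps)
        also have "\<dots> \<le> real m * x / (ln x / 2)"
          using nn l2 lx elim by (intro frac_le mult_mono) auto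
        finally show ?thesis by (simp add: field_simps)
      qed
      ultimately have "k \<in> {-1..K}" using k d1 unfolding K_def by (auto; linarith)
      moreover have "\<bar>16 * ln x * r0 m n - 16 * ln x * k\<bar> \<le> 32"
      proof -
        have "\<bar>16 * ln x * r0 m n - 16 * ln x * k\<bar> = 16 * ln x * \<bar>r0 m n - k\<bar>"
          using lx by (simp add: abs_mult right_diff_distrib[symmetric])
        also have "\<dots> \<le> 16 * ln x * (2 / ln x)"
          using k d2 lx by (intro mult_left_mono) auto
        finally show ?thesis using lx by simp
      qed
      then have "y \<in> J k" unfolding J_def n(2) h_def by (auto; linarith)
      ultimately show "y \<in> (\<Union>k\<in>{-1..K}. J k)" by blast
    qed
    have K0: "real_of_int K \<ge> 0" "real_of_int K \<le> 2 * real m * x / ln x + 2"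
    proof -
      have "0 \<le> 2 * real m * x / ln x" using lx elim by simp
      then show "real_of_int K \<ge> 0" "real_of_int K \<le> 2 * real m * x / ln x + 2"
        unfolding K_def by linarith+
    qed
    have "card D = card (h ` D)" using inj by (simp add: card_image)
    also have "\<dots> \<le> card (\<Union>k\<in>{-1..K}. J k)"
      by (intro card_mono sub) (auto simp: J_def)
    also have "\<dots> \<le> (\<Sum>k\<in>{-1..K}. card (J k))" by (rule card_UN_le) auto
    also have "\<dots> = nat (K + 2) * 67" by (simp add: J_def)
    finally have "real (card D) \<le> real (nat (K + 2) * 67)" by (rule of_nat_mono)
    also have "\<dots> \<le> (2 * real m * x / ln x + 5) * 67" using K0 by simp
    finally have cD: "real (card D) \<le> (2 * real m * x / ln x + 5) * 67" .
    have "{n. n \<notin> gap_orders m \<and> 1 \<le> real n \<and> real n \<le> x} \<subseteq> {1..nat \<lfloor>sqrt x\<rfloor>} \<union> D"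
    proof
      fix k assume "k \<in> {n. n \<notin> gap_orders m \<and> 1 \<le> real n \<and> real n \<le> x}"
      then show "k \<in> {1..nat \<lfloor>sqrt x\<rfloor>} \<union> D"
        using le_nat_floor[of k "sqrt x"] by (cases "real k \<le> sqrt x") (auto simp: D_def)
    qed
    then have "card {n. n \<notin> gap_orders m \<and> 1 \<le> real n \<and> real n \<le> x} \<le> card ({1..nat \<lfloor>sqrt x\<rfloor>} \<union> D)"
      by (intro card_mono) (use finD in auto)
    also have "\<dots> \<le> nat \<lfloor>sqrt x\<rfloor> + card D" using card_Un_le[of "{1..nat \<lfloor>sqrt x\<rfloor>}" D] by simp
    finally have "real (card {n. n \<notin> gap_orders m \<and> 1 \<le> real n \<and> real n \<le> x}) \<le> real (nat \<lfloor>sqrt x\<rfloor> + card D)"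
      by (rule of_nat_mono)
    moreover have "real (nat \<lfloor>sqrt x\<rfloor>) \<le> sqrt x" using elim by (intro of_nat_floor) auto
    ultimately show ?case using cD by simp
  qed
qed

lemma natural_density_gap_orders:
  assumes "m \<ge> 2"
  shows "natural_density_one (gap_orders m)"
  unfolding natural_density_one_def
proof (rule tendsto_sandwich)
  let ?G = "\<lambda>x::real. {k \<in> gap_orders m. 1 \<le> real k \<and> real k \<le> x}"
  let ?B = "\<lambda>x::real. {k. k \<notin> gap_orders m \<and> 1 \<le> real k \<and> real k \<le> x}"
  have split: "real (card (?G x)) + real (card (?B x)) = real (nat \<lfloor>x\<rfloor>)" for x :: real
  proof -
    have "1 \<le> real k \<and> real k \<le> x \<longleftrightarrow> k \<in> {1..nat \<lfloor>x\<rfloor>}" for k :: nat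
    proof
      assume "k \<in> {1..nat \<lfloor>x\<rfloor>}"
      then have "1 \<le> k" "int k \<le> \<lfloor>x\<rfloor>" by auto
      then show "1 \<le> real k \<and> real k \<le> x" by (simp add: le_floor_iff)
    qed (use le_nat_floor[of k x] in auto)
    then have eq: "?G x \<union> ?B x = {1..nat \<lfloor>x\<rfloor>}" by blast
    have "card (?G x \<union> ?B x) = card (?G x) + card (?B x)"
    proof (rule card_Un_disjoint)
      show "finite (?G x)" "finite (?B x)"
        by (rule finite_subset[of _ "{..nat \<lfloor>x\<rfloor>}"]; auto simp: le_nat_floor)+
    qed auto
    then have "card (?G x) + card (?B x) = card {1..nat \<lfloor>x\<rfloor>}" unfolding eq by (rule sym)
    then have "real (card (?G x) + card (?B x)) = real (card {1..nat \<lfloor>x\<rfloor>})" by (rule arg_cong)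
    then show ?thesis unfolding of_nat_add by simp
  qed
  show "\<forall>\<^sub>F x in at_top. (x - 1 - (sqrt x + (2 * real m * x / ln x + 5) * 67)) / x \<le> real (card (?G x)) / x"
    using card_not_gap_orders_le[OF assms] eventually_gt_at_top[of 1]
  proof eventually_elim
    case (elim x)
    have "x - 1 \<le> real (nat \<lfloor>x\<rfloor>)" using elim by linarith
    then have "x - 1 - (sqrt x + (2 * real m * x / ln x + 5) * 67) \<le> real (card (?G x))"
      using elim(1) split[of x] by linarith
    then show ?case using elim by (intro divide_right_mono) auto
  qed
  show "\<forall>\<^sub>F x in at_top. real (card (?G x)) / x \<le> 1"
    using eventually_gt_at_top[of 1]
  proof eventually_elim
    case (elim x)
    have "real (nat \<lfloor>x\<rfloor>) \<le> x" using elim by (intro of_nat_floor) auto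
    then have "real (card (?G x)) \<le> x" using split[of x] by linarith
    then show ?case using elim by simp
  qed
  show "((\<lambda>x::real. (x - 1 - (sqrt x + (2 * real m * x / ln x + 5) * 67)) / x) \<longlongrightarrow> 1) at_top"
    by real_asymp
qed auto

section \<open>Truncated inclusion-exclusion\<close>

lemma sum_pairs_insert_max:
  fixes f :: "nat \<Rightarrow> nat \<Rightarrow> real"
  assumes "finite I" "\<forall>a\<in>I. a < b"
  shows "(\<Sum>i\<in>insert b I. \<Sum>k\<in>{k\<in>insert b I. k < i}. f k i)
    = (\<Sum>i\<in>I. \<Sum>k\<in>{k\<in>I. k < i}. f k i) + (\<Sum>k\<in>I. f k b)"
proof -
  have "{k \<in> insert b I. k < b} = I" using assms by auto
  moreover have "{k \<in> insert b I. k < i} = {k \<in> I. k < i}" if "i \<in> I" for i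
    using assms that by force
  moreover have "b \<notin> I" using assms by auto
  ultimately show ?thesis using assms by (simp add: add.commute)
qed

text \<open>
  The Bonferroni inequalities, for weights in the unit interval instead of indicators. The upper bound
  is applied to indicators, the last lower bound to probabilities of order \<open>1 / r\<close>, for which the cubic error
  term is negligible.
\<close>

lemma prod_one_minus_bounds:
  fixes x :: "nat \<Rightarrow> real"
  assumes "finite I" "\<And>i. i \<in> I \<Longrightarrow> 0 \<le> x i \<and> x i \<le> 1"
  defines "e1 \<equiv> \<Sum>i\<in>I. x i" and "e2 \<equiv> \<Sum>i\<in>I. \<Sum>k\<in>{k\<in>I. k < i}. x k * x i"
  shows "1 - e1 \<le> (\<Prod>i\<in>I. 1 - x i)" "(\<Prod>i\<in>I. 1 - x i) \<le> 1 - e1 + e2"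
    "1 - e1 + e2 - e1 ^ 3 \<le> (\<Prod>i\<in>I. 1 - x i)"
proof -
  let ?P = "\<lambda>I. \<Prod>i\<in>I. 1 - x i" and ?e = "\<lambda>I. \<Sum>i\<in>I. x i"
    and ?f = "\<lambda>I. \<Sum>i\<in>I. \<Sum>k\<in>{k\<in>I. k < i}. x k * x i"
  have "1 - ?e I \<le> ?P I \<and> ?P I \<le> 1 - ?e I + ?f I \<and> 1 - ?e I + ?f I - ?e I ^ 3 \<le> ?P I
     \<and> 0 \<le> ?f I \<and> ?f I \<le> ?e I ^ 2 \<and> 0 \<le> ?e I"
    using assms(1,2)
  proof (induction I rule: finite_linorder_max_induct)
    case (insert b I)
    define P E F t where "P = ?P I" and "E = ?e I" and "F = ?f I" and "t = x b"
    have t: "0 \<le> t" "t \<le> 1" using insert.prems[of b] by (auto simp: t_def)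
    have IH: "1 - E \<le> P" "P \<le> 1 - E + F" "1 - E + F - E ^ 3 \<le> P" "0 \<le> F" "F \<le> E ^ 2" "0 \<le> E"
      using insert.IH insert.prems unfolding P_def E_def F_def by blast+
    have nb: "b \<notin> I" using insert.hyps by auto
    have P': "?P (insert b I) = (1 - t) * P" and E': "?e (insert b I) = E + t"
      using insert.hyps nb by (auto simp: P_def E_def t_def)
    have F': "?f (insert b I) = F + t * E"
      unfolding sum_pairs_insert_max[OF insert.hyps(1,2)]
      by (simp add: F_def E_def t_def sum_distrib_left mult.commute)
    have a: "t * (1 - E) \<le> t * P" "t * P \<le> t * (1 - E + F)"
      using IH t by (auto intro!: mult_left_mono)
    have b: "(1 - t) * (1 - E) \<le> (1 - t) * P" using IH t by (intro mult_left_mono) auto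
    have nn: "t * E \<ge> 0" "t * F \<ge> 0" "t * F \<le> t * E ^ 2" "t ^ 2 * E \<ge> 0" "t ^ 3 \<ge> 0" "t * E ^ 2 \<ge> 0" "t ^ 2 \<ge> 0"
      using IH t by (auto intro!: mult_left_mono)
    have cube: "(E + t) ^ 3 = E ^ 3 + 3 * (t * E ^ 2) + 3 * (t ^ 2 * E) + t ^ 3"
      by (simp add: power3_eq_cube power2_eq_square algebra_simps)
    have square: "(E + t) ^ 2 = E ^ 2 + 2 * (t * E) + t ^ 2"
      by (simp add: power2_eq_square algebra_simps)
    have dist: "(1 - t) * P = P - t * P" "t * (1 - E) = t - t * E" "t * (1 - E + F) = t - t * E + t * F"
      "(1 - t) * (1 - E) = 1 - E - t + t * E" by (simp_all add: algebra_simps)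
    show ?case unfolding P' E' F' cube square dist(1)
      using a b IH t nn unfolding dist by (intro conjI) linarith+
  qed auto
  then show "1 - e1 \<le> (\<Prod>i\<in>I. 1 - x i)" "(\<Prod>i\<in>I. 1 - x i) \<le> 1 - e1 + e2"
    "1 - e1 + e2 - e1 ^ 3 \<le> (\<Prod>i\<in>I. 1 - x i)" unfolding e1_def e2_def by auto
qed

section \<open>Counting injections\<close>

definition injections :: "nat set \<Rightarrow> 'a set \<Rightarrow> (nat \<Rightarrow> 'a) set" where
  "injections I T = {c \<in> I \<rightarrow>\<^sub>E T. inj_on c I}"

text \<open>
  The falling factorial, with a real argument because removing a point from the domain and a value from the
  range lowers both parameters by one.
\<close>

definition falling :: "nat \<Rightarrow> real \<Rightarrow> real" where
  "falling m x = (\<Prod>t<m. x - real t)"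

lemma falling_Suc: "falling (Suc m) x = x * falling m (x - 1)"
  unfolding falling_def by (subst prod.lessThan_Suc_shift) (simp add: algebra_simps)

lemma finite_injections: "finite I \<Longrightarrow> finite T \<Longrightarrow> finite (injections I T)"
  unfolding injections_def by (intro finite_subset[OF _ finite_PiE[of I "\<lambda>_. T"]]) auto

text \<open>
  Choosing the value at one point first; this recursion yields all the counts of injections below.
\<close>

lemma sum_injections_insert:
  fixes G :: "(nat \<Rightarrow> 'a) \<Rightarrow> real"
  assumes "finite I" "finite T" "i \<notin> I"
  shows "(\<Sum>c\<in>injections (insert i I) T. G c) = (\<Sum>a\<in>T. \<Sum>c\<in>injections I (T - {a}). G (c(i := a)))"
proof -
  have eq: "injections (insert i I) T = (\<lambda>(a, c). c(i := a)) ` (SIGMA a:T. injections I (T - {a}))"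
  proof (intro equalityI subsetI)
    fix c assume c: "c \<in> injections (insert i I) T"
    have "c(i := undefined) \<in> injections I (T - {c i})"
      using c assms(3) by (auto simp: injections_def PiE_iff extensional_def inj_on_def)
    moreover have "c i \<in> T" using c by (auto simp: injections_def)
    moreover have "c = (c(i := undefined))(i := c i)" by simp
    ultimately show "c \<in> (\<lambda>(a, c). c(i := a)) ` (SIGMA a:T. injections I (T - {a}))"
      by (intro image_eqI[of _ _ "(c i, c(i := undefined))"]) auto
  next
    fix c assume "c \<in> (\<lambda>(a, c). c(i := a)) ` (SIGMA a:T. injections I (T - {a}))"
    then obtain a d where ad: "a \<in> T" "d \<in> injections I (T - {a})" "c = d(i := a)" by auto
    have "d(i := a) \<in> insert i I \<rightarrow>\<^sub>E T"
      using ad(1,2) by (auto simp: injections_def PiE_iff extensional_def)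
    moreover have "inj_on (d(i := a)) (insert i I)"
    proof -
      have n: "a \<notin> d ` I" and d: "inj_on d I" using ad(2) by (auto simp: injections_def PiE_iff)
      have 1: "inj_on (d(i := a)) I" by (rule inj_on_fun_updI[OF d n])
      have "(d(i := a)) ` (I - {i}) \<subseteq> d ` I" by auto
      then have "(d(i := a)) i \<notin> (d(i := a)) ` (I - {i})" using n by auto
      with 1 show ?thesis unfolding inj_on_insert by blast
    qed
    ultimately show "c \<in> injections (insert i I) T" by (simp add: injections_def ad(3))
  qed
  have inj: "inj_on (\<lambda>(a, c). c(i := a)) (SIGMA a:T. injections I (T - {a}))"
    by (rule inj_on_subset[OF inj_combinator[OF assms(3), of "\<lambda>_. T"]]) (auto simp: injections_def PiE_iff extensional_def)
  show ?thesis unfolding eq sum.reindex[OF inj]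
    using assms by (subst sum.Sigma) (auto simp: finite_injections intro!: sum.cong)
qed

lemma card_injections:
  assumes "finite I" "finite T"
  shows "real (card (injections I T)) = falling (card I) (card T)"
  using assms
proof (induction I arbitrary: T)
  case empty
  then show ?case by (simp add: injections_def falling_def)
next
  case (insert i I)
  have "real (card (injections (insert i I) T)) = (\<Sum>c\<in>injections (insert i I) T. 1)" by simp
  also have "\<dots> = (\<Sum>a\<in>T. real (card (injections I (T - {a}))))"
    using insert by (subst sum_injections_insert) auto
  also have "\<dots> = (\<Sum>a\<in>T. falling (card I) (real (card T) - 1))"
  proof (intro sum.cong refl)
    fix a assume a: "a \<in> T"
    then have "card T > 0" using insert by (auto simp: card_gt_0_iff)
    then show "real (card (injections I (T - {a}))) = falling (card I) (real (card T) - 1)"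
      using insert a by (simp add: of_nat_diff)
  qed
  finally show ?case using insert by (simp add: falling_Suc)
qed

lemma sum_injections_hit:
  assumes "finite I" "finite T" "i \<in> I" "S \<subseteq> T" "T \<noteq> {}"
  shows "(\<Sum>c\<in>injections I T. of_bool (c i \<in> S)) = falling (card I) (card T) * (real (card S) / card T)"
proof -
  have I: "I = insert i (I - {i})" using assms by auto
  have cT: "card T > 0" using assms by (auto simp: card_gt_0_iff)
  have "(\<Sum>c\<in>injections I T. of_bool (c i \<in> S)) = (\<Sum>a\<in>T. \<Sum>c\<in>injections (I - {i}) (T - {a}). of_bool (a \<in> S) :: real)"
    by (subst I, subst sum_injections_insert) (use assms in auto)
  also have "\<dots> = (\<Sum>a\<in>T. of_bool (a \<in> S) * falling (card I - 1) (real (card T) - 1))"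
    using assms cT by (intro sum.cong refl) (simp add: card_injections of_nat_diff)
  also have "\<dots> = real (card S) * falling (card I - 1) (real (card T) - 1)"
    using assms by (subst sum_distrib_right[symmetric]) (simp add: Int_absorb2 Int_commute)
  also have "falling (card I) (card T) = card T * falling (card I - 1) (real (card T) - 1)"
    using falling_Suc[of "card I - 1" "card T"] assms by (cases "card I") auto
  then have "real (card S) * falling (card I - 1) (real (card T) - 1) = falling (card I) (card T) * (real (card S) / card T)"
    using cT by simp
  finally show ?thesis .
qed

lemma sum_injections_hit2:
  assumes "finite I" "finite T" "i \<in> I" "k \<in> I" "k \<noteq> i" "S \<subseteq> T" "S' \<subseteq> T" "card T \<ge> 2"
  shows "(\<Sum>c\<in>injections I T. of_bool (c k \<in> S' \<and> c i \<in> S)) =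
    falling (card I) (card T) * ((real (card S) * card S' - card (S \<inter> S')) / (card T * (real (card T) - 1)))"
proof -
  have I: "I = insert i (I - {i})" using assms by auto
  let ?I = "I - {i}"
  have fS: "finite S" "finite S'" using assms finite_subset by blast+
  have T0: "card T > 0" using assms by linarith
  obtain q where q: "card I = Suc (Suc q)"
  proof -
    have "card {i, k} \<le> card I" using assms by (intro card_mono) auto
    then have "2 \<le> card I" using assms by simp
    then show ?thesis using that[of "card I - 2"] by simp
  qed
  have "(\<Sum>c\<in>injections I T. of_bool (c k \<in> S' \<and> c i \<in> S))
      = (\<Sum>a\<in>T. \<Sum>c\<in>injections ?I (T - {a}). of_bool (c k \<in> S' \<and> a \<in> S) :: real)"
    by (subst I, subst sum_injections_insert) (use assms in auto)
  also have "\<dots> = (\<Sum>a\<in>T. of_bool (a \<in> S) * (\<Sum>c\<in>injections ?I (T - {a}). of_bool (c k \<in> S' - {a})))"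
    unfolding sum_distrib_left
    by (intro sum.cong refl) (use assms in \<open>auto simp: injections_def\<close>)
  also have "\<dots> = (\<Sum>a\<in>T. of_bool (a \<in> S) * (falling (Suc q) (real (card T) - 1) * ((real (card S') - of_bool (a \<in> S')) / (real (card T) - 1))))"
  proof (intro sum.cong refl)
    fix a assume a: "a \<in> T"
    have "T - {a} \<noteq> {}" using assms a by (auto dest: subset_singletonD)
    moreover have "real (card (S' - {a})) = real (card S') - of_bool (a \<in> S')"
    proof (cases "a \<in> S'")
      case True
      then have "card S' > 0" using fS by (auto simp: card_gt_0_iff)
      then show ?thesis using True fS by (simp add: of_nat_diff)
    qed auto
    ultimately show "of_bool (a \<in> S) * (\<Sum>c\<in>injections ?I (T - {a}). of_bool (c k \<in> S' - {a})) =
      of_bool (a \<in> S) * (falling (Suc q) (real (card T) - 1) * ((real (card S') - of_bool (a \<in> S')) / (real (card T) - 1)))"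
      using assms a q by (subst sum_injections_hit) (auto simp: of_nat_diff)
  qed
  also have "\<dots> = falling (Suc q) (real (card T) - 1) / (real (card T) - 1) * (\<Sum>a\<in>T. of_bool (a \<in> S) * (real (card S') - of_bool (a \<in> S')))"
    unfolding sum_distrib_left by (intro sum.cong refl) simp
  also have "(\<Sum>a\<in>T. of_bool (a \<in> S) * (real (card S') - of_bool (a \<in> S'))) = (\<Sum>a\<in>S. real (card S') - of_bool (a \<in> S'))"
    by (intro sum.mono_neutral_cong_right) (use assms in auto)
  also have "\<dots> = real (card S) * card S' - card (S \<inter> S')"
    using fS by (simp add: sum_subtractf Int_def)
  finally show ?thesis unfolding q falling_Suc[of "Suc q"] using T0 assms(8) by simp
qed

section \<open>Avoiding used colours\<close>

text \<open>
  For an edge \<open>e\<close> the map \<open>v\<close> will send \<open>i\<close> to the place of the \<open>i\<close>-th cell of \<open>e\<close> in the second stacking. Its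
  fibres are the sets of cells that are stacked together twice, and the rank numbers the cells of one fibre by
  \<open>0, 1, 2, \<dots>\<close>; this lets products over fibres be written as products over \<open>i\<close>.
\<close>

definition rank_in :: "nat set \<Rightarrow> (nat \<Rightarrow> 'v) \<Rightarrow> nat \<Rightarrow> nat" where
  "rank_in I v i = card {k \<in> I. k < i \<and> v k = v i}"

lemma prod_rank_in:
  fixes h :: "'v \<Rightarrow> nat \<Rightarrow> real"
  assumes "finite I" "finite V" "v ` I \<subseteq> V"
  shows "(\<Prod>i\<in>I. h (v i) (rank_in I v i)) = (\<Prod>x\<in>V. \<Prod>a<card {i\<in>I. v i = x}. h x a)"
  using assms(1,3)
proof (induction I rule: finite_linorder_max_induct)
  case (insert b I)
  have nb: "b \<notin> I" using insert by auto
  have r1: "rank_in (insert b I) v i = rank_in I v i" if "i \<in> I" for i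
    unfolding rank_in_def using insert.hyps(2) that by (intro arg_cong[of _ _ card]) auto
  have r2: "rank_in (insert b I) v b = card {i\<in>I. v i = v b}"
    unfolding rank_in_def using insert.hyps(2) by (intro arg_cong[of _ _ card]) auto
  have c: "card {i \<in> insert b I. v i = x} = card {i\<in>I. v i = x} + of_bool (x = v b)" for x
  proof (cases "x = v b")
    case True
    then have "{i \<in> insert b I. v i = x} = insert b {i\<in>I. v i = x}" by auto
    then show ?thesis using True nb insert.hyps(1) by simp
  next
    case False
    then have "{i \<in> insert b I. v i = x} = {i\<in>I. v i = x}" by auto
    then show ?thesis using False by simp
  qed
  have vb: "v b \<in> V" using insert.prems by auto
  have "(\<Prod>x\<in>V. \<Prod>a<card {i\<in>insert b I. v i = x}. h x a)
      = (\<Prod>x\<in>V. (\<Prod>a<card {i\<in>I. v i = x}. h x a) * (if x = v b then h x (card {i\<in>I. v i = v b}) else 1))"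
    unfolding c by (intro prod.cong refl) auto
  also have "\<dots> = (\<Prod>x\<in>V. \<Prod>a<card {i\<in>I. v i = x}. h x a) * h (v b) (card {i\<in>I. v i = v b})"
    using vb assms(2) by (simp add: prod.distrib)
  also have "\<dots> = (\<Prod>i\<in>insert b I. h (v i) (rank_in (insert b I) v i))"
    using insert nb r1 r2 by (simp add: mult.commute)
  finally show ?case ..
qed auto

text \<open>
  If the forbidden sets were independent uniform random sets, a random injection would avoid all of them with
  probability exactly the product on the right, because a fibre of size \<open>b\<close> avoids a set of size \<open>d\<close> with
  probability \<open>\<Prod>a<b. 1 - d / (r - a)\<close>. For arbitrary sets the second Bonferroni inequality applies: an
  overlap of the forbidden sets only lowers the probability that two cells are both bad, and everything else agrees
  with the random case up to terms of order \<open>1 / r\<^sup>3\<close>. Such an error is harmless even when it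
  is incurred once per edge, since the number of edges is \<open>o (r\<^sup>3)\<close>; an error of order \<open>1 / r\<^sup>2\<close> would not be.
\<close>

lemma card_avoiding_injections_le:
  fixes S :: "'v \<Rightarrow> 'a set" and v :: "nat \<Rightarrow> 'v"
  assumes I: "finite I" "m = card I" and T: "finite T" "r = card T"
    and S: "\<And>i. i \<in> I \<Longrightarrow> S (v i) \<subseteq> T" "\<And>i. i \<in> I \<Longrightarrow> card (S (v i)) \<le> m"
    and r: "r \<ge> 4 * m ^ 2" "r \<ge> 2"
  shows "real (card {c \<in> injections I T. \<forall>i\<in>I. c i \<notin> S (v i)})
    \<le> falling m r * (1 + 24 * real m ^ 6 / real r ^ 3)
        * (\<Prod>i\<in>I. 1 - real (card (S (v i))) / (real r - real (rank_in I v i)))"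
proof (cases "I = {}")
  case True
  then show ?thesis using I by (simp add: injections_def falling_def)
next
  case False
  then have m1: "m \<ge> 1" using I by (simp add: Suc_le_eq card_gt_0_iff)
  define d where "d i = real (card (S (v i)))" for i
  define a where "a i = real (rank_in I v i)" for i
  define x where "x i = d i / (real r - a i)" for i
  define R where "R = real r"
  define M where "M = real m"
  have T0: "T \<noteq> {}" using r T by auto
  have M1: "M \<ge> 1" using m1 by (simp add: M_def)
  have "real (4 * m ^ 2) \<le> R" unfolding R_def using r(1) by (rule of_nat_mono)
  then have RM2: "R \<ge> 4 * M ^ 2" by (simp add: M_def)
  have "M ^ 2 \<ge> M" using M1 by (simp add: power2_eq_square)
  then have RM: "R \<ge> 4 * M" using RM2 by linarith
  have R2: "R \<ge> 2" using r(2) by (simp add: R_def)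
  have d: "0 \<le> d i" "d i \<le> M" if "i \<in> I" for i
    using S(2)[OF that] by (auto simp: d_def M_def)
  have a: "0 \<le> a i" "a i \<le> M" if "i \<in> I" for i
  proof -
    have "rank_in I v i \<le> card I" unfolding rank_in_def using I by (intro card_mono) auto
    then show "0 \<le> a i" "a i \<le> M" using I by (auto simp: a_def M_def)
  qed
  have Ra: "R - a i \<ge> R / 2" if "i \<in> I" for i using a[OF that] RM R2 by linarith
  have x: "0 \<le> x i" "x i \<le> 2 * M / R" "x i \<le> d i / R + d i * a i / R ^ 2 + 2 * M ^ 3 / R ^ 3" "d i / R \<le> x i"
    if i: "i \<in> I" for i
  proof -
    have p: "R - a i > 0" "R > 0" using Ra[OF i] R2 by linarith+
    show "0 \<le> x i" using d[OF i] p by (simp add: x_def R_def)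
    have "x i \<le> M / (R / 2)" unfolding x_def R_def[symmetric]
      using d[OF i] Ra[OF i] R2 by (intro frac_le) auto
    then show "x i \<le> 2 * M / R" by (simp add: mult.commute)
    show "d i / R \<le> x i" unfolding x_def R_def[symmetric]
      using d[OF i] a[OF i] p by (intro divide_left_mono) auto
    have "x i = d i / R + d i * a i / R ^ 2 + d i * a i ^ 2 / (R ^ 2 * (R - a i))"
      using p unfolding x_def R_def[symmetric] by (simp add: field_simps power2_eq_square)
    also have "d i * a i ^ 2 / (R ^ 2 * (R - a i)) \<le> M * M ^ 2 / (R ^ 2 * (R / 2))"
      using d[OF i] a[OF i] Ra[OF i] R2 by (intro frac_le mult_mono power_mono) auto
    finally show "x i \<le> d i / R + d i * a i / R ^ 2 + 2 * M ^ 3 / R ^ 3"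
      by (simp add: power3_eq_cube power2_eq_square mult_ac)
  qed
  have half: "2 * M / R \<le> 1 / (2 * M)"
    using RM2 M1 R2 by (simp add: field_simps power2_eq_square)
  also have "1 / (2 * M) \<le> 1" using M1 by simp
  finally have le1: "2 * M / R \<le> 1" .
  have x1: "0 \<le> x i \<and> x i \<le> 1" if "i \<in> I" for i using x[OF that] le1 by linarith
  let ?P = "\<Prod>i\<in>I. 1 - x i" and ?pairs = "\<lambda>f::nat\<Rightarrow>nat\<Rightarrow>real. \<Sum>i\<in>I. \<Sum>k\<in>{k\<in>I. k < i}. f k i"
  define e1 where "e1 = (\<Sum>i\<in>I. x i)"
  have e1: "0 \<le> e1" "e1 \<le> 2 * M ^ 2 / R" "e1 \<le> 1 / 2"
  proof -
    show "0 \<le> e1" unfolding e1_def using x by (intro sum_nonneg) auto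
    have "e1 \<le> of_nat (card I) * (2 * M / R)" unfolding e1_def using x by (intro sum_bounded_above) auto
    then have e: "e1 \<le> M * (2 * M / R)" using I by (simp add: M_def)
    then show "e1 \<le> 2 * M ^ 2 / R" by (simp add: power2_eq_square mult_ac)
    have "M * (2 * M / R) \<le> M * (1 / (2 * M))" using half M1 by (intro mult_left_mono) auto
    then show "e1 \<le> 1 / 2" using e M1 by simp
  qed
  have card_pairs: "?pairs (\<lambda>_ _. C) \<le> M ^ 2 * C" if "C \<ge> 0" for C
  proof -
    have "?pairs (\<lambda>_ _. C) \<le> (\<Sum>i\<in>I. M * C)"
    proof (intro sum_mono)
      fix i assume "i \<in> I"
      have "card {k\<in>I. k < i} \<le> card I" using I by (intro card_mono) auto
      then show "(\<Sum>k\<in>{k\<in>I. k < i}. C) \<le> M * C" using I that by (simp add: M_def mult_right_mono)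
    qed
    then show ?thesis using I by (simp add: M_def power2_eq_square)
  qed
  \<comment> \<open>both expansions are compared with the same polynomial in \<open>1/r\<close> of degree two\<close>
  define Q where "Q = 1 - (\<Sum>i\<in>I. d i / R) - (\<Sum>i\<in>I. d i * a i / R ^ 2) + ?pairs (\<lambda>k i. d k * d i / R ^ 2)"
  have lower: "Q - 10 * M ^ 6 / R ^ 3 \<le> ?P"
  proof -
    have "e1 \<le> (\<Sum>i\<in>I. d i / R + d i * a i / R ^ 2 + 2 * M ^ 3 / R ^ 3)"
      unfolding e1_def using x by (intro sum_mono) auto
    then have 1: "e1 \<le> (\<Sum>i\<in>I. d i / R) + (\<Sum>i\<in>I. d i * a i / R ^ 2) + M * (2 * M ^ 3 / R ^ 3)"
      using I by (simp add: sum.distrib M_def)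
    have 2: "?pairs (\<lambda>k i. d k * d i / R ^ 2) \<le> ?pairs (\<lambda>k i. x k * x i)"
    proof (intro sum_mono)
      fix i k assume "i \<in> I" "k \<in> {k\<in>I. k < i}"
      then have "(d k / R) * (d i / R) \<le> x k * x i"
        using x d R2 by (intro mult_mono) auto
      then show "d k * d i / R ^ 2 \<le> x k * x i" by (simp add: power2_eq_square)
    qed
    have 3: "e1 ^ 3 \<le> (2 * M ^ 2 / R) ^ 3" using e1 by (intro power_mono) auto
    have 4: "(2 * M ^ 2 / R) ^ 3 = 8 * M ^ 6 / R ^ 3"
      by (simp add: power_divide power_mult_distrib flip: power_mult)
    have "M * (2 * M ^ 3 / R ^ 3) = 2 * M ^ 4 / R ^ 3" by (simp add: power_numeral_reduce)
    also have "\<dots> \<le> 2 * M ^ 6 / R ^ 3"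
      using M1 R2 by (intro divide_right_mono mult_left_mono power_increasing) auto
    finally have 5: "M * (2 * M ^ 3 / R ^ 3) \<le> 2 * M ^ 6 / R ^ 3" .
    have "1 - e1 + ?pairs (\<lambda>k i. x k * x i) - e1 ^ 3 \<le> ?P"
      unfolding e1_def using prod_one_minus_bounds(3)[OF I(1), of x] x1 by blast
    then show ?thesis unfolding Q_def using 1 2 3 4 5 by (simp add: add_divide_distrib[symmetric])
  qed
  have half_P: "?P \<ge> 1 / 2"
    using prod_one_minus_bounds(1)[OF I(1), of x] x1 e1(3) unfolding e1_def by fastforce
  let ?J = "falling m r"
  have J: "?J \<ge> 0" unfolding falling_def
    by (intro prod_nonneg) (use RM in \<open>auto simp: R_def M_def\<close>)
  \<comment> \<open>the overlap \<open>card (S (v i) \<inter> S (v k))\<close> enters with a negative sign and is dropped, except for \<open>v i = v k\<close>, where it equals \<open>d i\<close>\<close>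
  have upper: "real (card {c \<in> injections I T. \<forall>i\<in>I. c i \<notin> S (v i)}) \<le> ?J * (Q + 2 * M ^ 6 / R ^ 3)"
  proof -
    let ?b = "\<lambda>c i. of_bool (c i \<in> S (v i)) :: real"
    have "real (card {c \<in> injections I T. \<forall>i\<in>I. c i \<notin> S (v i)}) = (\<Sum>c\<in>injections I T. \<Prod>i\<in>I. 1 - ?b c i)"
    proof -
      have "(\<Prod>i\<in>I. 1 - ?b c i) = of_bool (\<forall>i\<in>I. c i \<notin> S (v i))" for c
        using I by (cases "\<forall>i\<in>I. c i \<notin> S (v i)") auto
      then show ?thesis using finite_injections[OF I(1) T(1)] by (simp add: Int_def)
    qed
    also have "\<dots> \<le> (\<Sum>c\<in>injections I T. 1 - (\<Sum>i\<in>I. ?b c i) + ?pairs (\<lambda>k i. ?b c k * ?b c i))"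
      by (intro sum_mono prod_one_minus_bounds(2) I) auto
    also have "\<dots> = ?J - (\<Sum>i\<in>I. \<Sum>c\<in>injections I T. ?b c i) + ?pairs (\<lambda>k i. \<Sum>c\<in>injections I T. ?b c k * ?b c i)"
    proof -
      have "(\<Sum>c\<in>injections I T. \<Sum>i\<in>I. ?b c i) = (\<Sum>i\<in>I. \<Sum>c\<in>injections I T. ?b c i)"
        by (rule sum.swap)
      moreover have "(\<Sum>c\<in>injections I T. ?pairs (\<lambda>k i. ?b c k * ?b c i))
          = ?pairs (\<lambda>k i. \<Sum>c\<in>injections I T. ?b c k * ?b c i)"
        by (subst sum.swap, intro sum.cong refl, rule sum.swap)
      moreover have "(\<Sum>c\<in>injections I T. 1) = ?J"
        using I T card_injections[of I T] by simp
      ultimately show ?thesis by (simp only: sum.distrib sum_subtractf)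
    qed
    also have "(\<Sum>i\<in>I. \<Sum>c\<in>injections I T. ?b c i) = ?J * (\<Sum>i\<in>I. d i / R)"
      unfolding sum_distrib_left using I T T0 S by (intro sum.cong refl) (simp add: sum_injections_hit d_def R_def)
    also have "?pairs (\<lambda>k i. \<Sum>c\<in>injections I T. ?b c k * ?b c i)
      \<le> ?pairs (\<lambda>k i. ?J * (d k * d i / R ^ 2 - of_bool (v k = v i) * d i / R ^ 2 + 2 * M ^ 2 / R ^ 3))"
    proof (intro sum_mono)
      fix i k assume i: "i \<in> I" and k: "k \<in> {k\<in>I. k < i}"
      let ?q = "d i * d k - real (card (S (v i) \<inter> S (v k)))"
      have eq: "(\<Sum>c\<in>injections I T. ?b c k * ?b c i) = ?J * (?q / (R * (R - 1)))"
        using sum_injections_hit2[OF I(1) T(1) i, of k "S (v i)" "S (v k)"] k S i I T r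
        by (simp add: d_def R_def of_bool_conj)
      let ?p = "d k * d i - of_bool (v k = v i) * d i"
      have qp: "?q \<le> ?p" by (auto simp: d_def)
      have p0: "?p \<ge> 0"
      proof (cases "v k = v i")
        case True
        have "d i \<le> d i * d i"
          by (cases "card (S (v i))") (auto simp: d_def)
        then show ?thesis using True by (simp add: d_def)
      qed (use d k i in auto)
      have pM: "?p \<le> M ^ 2" 
      proof -
        have "d k * d i \<le> M * M" using d k i M1 by (intro mult_mono) auto
        then show ?thesis using d[OF i] by (auto simp: power2_eq_square of_bool_def)
      qed
      have r3: "1 / (R * (R - 1)) \<le> 1 / R ^ 2 + 2 / R ^ 3"
        using R2 by (simp add: field_simps power2_eq_square power3_eq_cube)
      have "?q / (R * (R - 1)) \<le> ?p * (1 / (R * (R - 1)))"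
        using qp R2 by (simp add: divide_right_mono)
      also have "\<dots> \<le> ?p * (1 / R ^ 2 + 2 / R ^ 3)" by (rule mult_left_mono[OF r3 p0])
      also have "\<dots> = ?p / R ^ 2 + 2 * ?p / R ^ 3"
        unfolding distrib_left times_divide_eq_right by (simp only: mult_1_right mult.commute)
      also have "\<dots> \<le> ?p / R ^ 2 + 2 * M ^ 2 / R ^ 3"
        using pM R2 by (intro add_left_mono divide_right_mono mult_left_mono) auto
      finally have "?q / (R * (R - 1)) \<le> d k * d i / R ^ 2 - of_bool (v k = v i) * d i / R ^ 2 + 2 * M ^ 2 / R ^ 3"
        by (simp add: diff_divide_distrib)
      then show "(\<Sum>c\<in>injections I T. ?b c k * ?b c i) \<le>
          ?J * (d k * d i / R ^ 2 - of_bool (v k = v i) * d i / R ^ 2 + 2 * M ^ 2 / R ^ 3)"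
        unfolding eq using J by (rule mult_left_mono)
    qed
    also have "\<dots> = ?J * (?pairs (\<lambda>k i. d k * d i / R ^ 2) - ?pairs (\<lambda>k i. of_bool (v k = v i) * d i / R ^ 2) + ?pairs (\<lambda>_ _. 2 * M ^ 2 / R ^ 3))"
      by (simp only: sum_distrib_left[symmetric] sum.distrib sum_subtractf)
    also have "?pairs (\<lambda>k i. of_bool (v k = v i) * d i / R ^ 2) = (\<Sum>i\<in>I. d i * a i / R ^ 2)"
    proof (intro sum.cong refl)
      fix i assume "i \<in> I"
      have "(\<Sum>k\<in>{k\<in>I. k < i}. of_bool (v k = v i) * d i / R ^ 2) = (\<Sum>k\<in>{k\<in>I. k < i}. of_bool (v k = v i)) * (d i / R ^ 2)"
        unfolding sum_distrib_right by (intro sum.cong refl) simp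
      also have "(\<Sum>k\<in>{k\<in>I. k < i}. of_bool (v k = v i)) = a i"
        using I by (simp add: a_def rank_in_def Int_def conj_ac)
      finally show "(\<Sum>k\<in>{k\<in>I. k < i}. of_bool (v k = v i) * d i / R ^ 2) = d i * a i / R ^ 2" by simp
    qed
    finally have "real (card {c \<in> injections I T. \<forall>i\<in>I. c i \<notin> S (v i)}) \<le>
      ?J * (Q + ?pairs (\<lambda>_ _. 2 * M ^ 2 / R ^ 3))"
      unfolding Q_def by (simp add: algebra_simps)
    also have "\<dots> \<le> ?J * (Q + 2 * M ^ 6 / R ^ 3)"
    proof (intro mult_left_mono add_left_mono J)
      have "?pairs (\<lambda>_ _. 2 * M ^ 2 / R ^ 3) \<le> M ^ 2 * (2 * M ^ 2 / R ^ 3)"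
        using R2 by (intro card_pairs) auto
      also have "\<dots> = 2 * M ^ 4 / R ^ 3" by (simp add: power_numeral_reduce)
      also have "\<dots> \<le> 2 * M ^ 6 / R ^ 3"
        using M1 R2 by (intro divide_right_mono mult_left_mono power_increasing) auto
      finally show "?pairs (\<lambda>_ _. 2 * M ^ 2 / R ^ 3) \<le> 2 * M ^ 6 / R ^ 3" .
    qed
    finally show ?thesis .
  qed
  have "Q + 2 * M ^ 6 / R ^ 3 \<le> ?P + 12 * M ^ 6 / R ^ 3"
    using lower by (simp add: field_simps)
  also have "12 * M ^ 6 / R ^ 3 \<le> (24 * M ^ 6 / R ^ 3) * ?P"
    using mult_left_mono[OF half_P, of "24 * M ^ 6 / R ^ 3"] R2 M1 by simp
  finally have "Q + 2 * M ^ 6 / R ^ 3 \<le> (1 + 24 * M ^ 6 / R ^ 3) * ?P" by (simp add: algebra_simps)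
  from mult_left_mono[OF this J] upper
  show ?thesis by (simp add: x_def d_def a_def M_def R_def mult.assoc)
qed

section \<open>Exponential bounds\<close>

text \<open>
  This bound on \<open>ln (1 - x)\<close> and the next one differ only by a term of third order. The quadratic term must be exact: it produces
  the summand \<open>(2 m - 1) / 6\<close> of the threshold.
\<close>

lemma one_minus_le_exp:
  fixes x :: real
  assumes "0 \<le> x" "x \<le> 1"
  shows "1 - x \<le> exp (- x - x ^ 2 / 2)"
proof (cases "x = 1")
  case False
  define g where "g = (\<lambda>x::real. - x - x ^ 2 / 2 - ln (1 - x))"
  have "g 0 \<le> g x"
  proof (rule DERIV_nonneg_imp_nondecreasing[OF assms(1)])
    fix y assume y: "0 \<le> y" "y \<le> x"
    then have y1: "y < 1" using assms False by simp
    have "(g has_real_derivative (- 1 - y + 1 / (1 - y))) (at y)"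
      unfolding g_def using y1 by (auto intro!: derivative_eq_intros simp: field_simps)
    moreover have "- 1 - y + 1 / (1 - y) = y ^ 2 / (1 - y)"
      using y1 by (simp add: field_simps power2_eq_square)
    ultimately show "\<exists>z. (g has_real_derivative z) (at y) \<and> z \<ge> 0" using y1 by auto
  qed
  then have "ln (1 - x) \<le> - x - x ^ 2 / 2" by (simp add: g_def)
  then have "exp (ln (1 - x)) \<le> exp (- x - x ^ 2 / 2)" by simp
  then show ?thesis using assms False by simp
qed simp

lemma inverse_one_minus_le_exp:
  fixes x :: real
  assumes "0 \<le> x" "x \<le> 1 / 2"
  shows "1 / (1 - x) \<le> exp (x + x ^ 2 / 2 + x ^ 3)"
proof -
  define g where "g = (\<lambda>x::real. x + x ^ 2 / 2 + x ^ 3 + ln (1 - x))"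
  have "g 0 \<le> g x"
  proof (rule DERIV_nonneg_imp_nondecreasing[OF assms(1)])
    fix y assume y: "0 \<le> y" "y \<le> x"
    then have y1: "y \<le> 1 / 2" using assms by simp
    have "(g has_real_derivative (1 + y + 3 * y ^ 2 - 1 / (1 - y))) (at y)"
      unfolding g_def using y1 by (auto intro!: derivative_eq_intros simp: field_simps)
    moreover have "1 + y + 3 * y ^ 2 - 1 / (1 - y) = y ^ 2 * (2 - 3 * y) / (1 - y)"
      using y1 by (simp add: field_simps power2_eq_square)
    ultimately show "\<exists>z. (g has_real_derivative z) (at y) \<and> z \<ge> 0" using y1 by auto
  qed
  then have "- ln (1 - x) \<le> x + x ^ 2 / 2 + x ^ 3" by (simp add: g_def)
  then have "exp (- ln (1 - x)) \<le> exp (x + x ^ 2 / 2 + x ^ 3)" by simp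
  then show ?thesis using assms by (simp add: exp_minus field_simps)
qed

lemma sum_lessThan_real: "(\<Sum>a<b. real a) = real b * (real b - 1) / 2"
  by (induction b) (auto simp: field_simps)

lemma sum_squares_lessThan_real: "(\<Sum>a<b. real a ^ 2) = (2 * real b - 1) / 3 * (\<Sum>a<b. real a)"
proof -
  have "(\<Sum>a<b. real a ^ 2) = (2 * real b - 1) / 3 * (real b * (real b - 1) / 2)"
    by (induction b) (auto simp: field_simps power2_eq_square)
  then show ?thesis by (simp only: sum_lessThan_real)
qed

section \<open>Colourings that are rainbow for two stackings\<close>

definition distinct_prob :: "nat \<Rightarrow> nat \<Rightarrow> real" where
  "distinct_prob r b = (\<Prod>t<b. 1 - real t / real r)"

lemma falling_eq_distinct_prob:
  assumes "r > 0"
  shows "falling b (real r) = real r ^ b * distinct_prob r b"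
proof -
  have "falling b (real r) = (\<Prod>t<b. real r * (1 - real t / real r))"
    unfolding falling_def using assms by (intro prod.cong refl) (simp add: field_simps)
  then show ?thesis by (simp add: prod.distrib distinct_prob_def)
qed

text \<open>
  The telescoping identity behind the induction on columns: the factor contributed by a new
  fibre of size \<open>b\<close> at a place where \<open>d\<close> colours are in use turns the weight for \<open>d\<close> into the one for \<open>d + b\<close>.
\<close>

lemma distinct_prob_add:
  "distinct_prob r (d + b) = distinct_prob r d * (\<Prod>a<b. 1 - (real d + real a) / real r)"
  by (induction b) (simp_all add: distinct_prob_def mult.assoc)

text \<open>
  A cell is a pair \<open>(e, i)\<close>, the edge of the \<open>i\<close>-th colouring that lies on \<open>e\<close> in the first stacking; in the second
  stacking it lies on \<open>\<rho> i e\<close>. The cells are thus the edges of an \<open>m\<close>-regular bipartite multigraph with the set \<open>E\<close> on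
  either side, both stackings being rainbow means that the cells are properly edge-coloured, and the fibres
  of \<open>\<lambda>i. \<rho> i e\<close> are the multiple edges at \<open>e\<close>.
\<close>

locale column_rows =
  fixes I :: "nat set" and E :: "'e set" and \<rho> :: "nat \<Rightarrow> 'e \<Rightarrow> 'e" and T :: "'c set"
    and m r :: nat
  assumes I: "finite I" "m = card I" "m \<ge> 1"
    and T: "finite T" "r = card T"
    and E: "finite E"
    and \<rho>: "\<And>i. i \<in> I \<Longrightarrow> bij_betw (\<rho> i) E E"
    and r: "r \<ge> 4 * m ^ 2" "r \<ge> 2"
begin

text \<open>
  Proper colourings of the cells in the columns \<open>X\<close>; within a column, properness is injectivity.
\<close>

definition partial_colourings :: "'e set \<Rightarrow> ('e \<Rightarrow> nat \<Rightarrow> 'c) set" where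
  "partial_colourings X = {g \<in> X \<rightarrow>\<^sub>E injections I T.
     \<forall>e\<in>X. \<forall>e'\<in>X. \<forall>i\<in>I. \<forall>k\<in>I. e \<noteq> e' \<and> \<rho> i e = \<rho> k e' \<longrightarrow> g e i \<noteq> g e' k}"

definition fibre :: "'e set \<Rightarrow> 'e \<Rightarrow> ('e \<times> nat) set" where
  "fibre X v = {(e, k) \<in> X \<times> I. \<rho> k e = v}"

definition used :: "('e \<Rightarrow> nat \<Rightarrow> 'c) \<Rightarrow> 'e set \<Rightarrow> 'e \<Rightarrow> 'c set" where
  "used g X v = (\<lambda>(e, k). g e k) ` fibre X v"

lemma finite_fibre: "finite X \<Longrightarrow> finite (fibre X v)"
  unfolding fibre_def using I by (intro finite_subset[OF _ finite_cartesian_product[of X I]]) auto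

lemma finite_partial_colourings: "finite X \<Longrightarrow> finite (partial_colourings X)"
  unfolding partial_colourings_def
  by (rule finite_subset[OF _ finite_PiE[of X "\<lambda>_. injections I T"]])
    (use finite_injections[OF I(1) T(1)] in auto)

lemma partial_colouringsD:
  assumes "g \<in> partial_colourings X" "e \<in> X" "e' \<in> X" "i \<in> I" "k \<in> I" "e \<noteq> e'" "\<rho> i e = \<rho> k e'"
  shows "g e i \<noteq> g e' k"
proof -
  have "\<forall>e\<in>X. \<forall>e'\<in>X. \<forall>i\<in>I. \<forall>k\<in>I. e \<noteq> e' \<and> \<rho> i e = \<rho> k e' \<longrightarrow> g e i \<noteq> g e' k"
    using assms(1) unfolding partial_colourings_def mem_Collect_eq by (rule conjunct2)
  then show ?thesis using assms(2-7) by blast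
qed

lemma partial_colouringsD2:
  assumes "g \<in> partial_colourings X" "e \<in> X"
  shows "g e \<in> injections I T"
proof -
  have "g \<in> X \<rightarrow>\<^sub>E injections I T"
    using assms(1) unfolding partial_colourings_def mem_Collect_eq by (rule conjunct1)
  then show ?thesis using assms(2) by (rule PiE_mem)
qed

lemma card_used:
  assumes "g \<in> partial_colourings X"
  shows "card (used g X v) = card (fibre X v)"
  unfolding used_def
proof (rule card_image, rule inj_onI, clarify)
  fix e k e' k'
  assume a: "(e, k) \<in> fibre X v" "(e', k') \<in> fibre X v" "g e k = g e' k'"
  have ee: "e = e'"
  proof (rule ccontr)
    assume "e \<noteq> e'"
    moreover have "e \<in> X" "e' \<in> X" "k \<in> I" "k' \<in> I" "\<rho> k e = \<rho> k' e'"
      using a by (auto simp: fibre_def)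
    ultimately have "g e k \<noteq> g e' k'" by (intro partial_colouringsD[OF assms])
    then show False using a(3) by simp
  qed
  have "g e \<in> injections I T" using a by (intro partial_colouringsD2[OF assms]) (auto simp: fibre_def)
  then have "k = k'" using a unfolding ee by (auto simp: fibre_def injections_def inj_on_def)
  with ee show "e = e' \<and> k = k'" by simp
qed

lemma card_fibre_le:
  assumes "X \<subseteq> E"
  shows "card (fibre X v) \<le> m"
proof -
  have "inj_on snd (fibre X v)"
  proof (rule inj_onI)
    fix p q assume pq: "p \<in> fibre X v" "q \<in> fibre X v" "snd p = snd q"
    then have "\<rho> (snd p) (fst p) = \<rho> (snd p) (fst q)" "snd p \<in> I" "fst p \<in> E" "fst q \<in> E"
      using assms by (auto simp: fibre_def)
    then have "fst p = fst q" using \<rho>[of "snd p"] by (auto simp: bij_betw_def inj_on_def)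
    then show "p = q" using pq(3) by (rule prod_eqI)
  qed
  then have "card (fibre X v) \<le> card I"
    using I by (intro card_inj_on_le[of snd]) (auto simp: fibre_def)
  then show ?thesis using I by simp
qed

lemma card_fibre_full:
  assumes "v \<in> E"
  shows "card (fibre E v) = m"
proof -
  have "bij_betw (\<lambda>k. (inv_into E (\<rho> k) v, k)) I (fibre E v)"
    unfolding bij_betw_def
  proof
    show "(\<lambda>k. (inv_into E (\<rho> k) v, k)) ` I = fibre E v"
    proof (intro equalityI subsetI)
      fix p assume "p \<in> (\<lambda>k. (inv_into E (\<rho> k) v, k)) ` I"
      then show "p \<in> fibre E v" using \<rho> assms
        by (auto simp: fibre_def bij_betw_def inv_into_into f_inv_into_f)
    next
      fix p assume "p \<in> fibre E v"
      then show "p \<in> (\<lambda>k. (inv_into E (\<rho> k) v, k)) ` I" using \<rho>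
        by (cases p) (auto simp: fibre_def bij_betw_def image_iff)
    qed
  qed (auto simp: inj_on_def)
  from bij_betw_same_card[OF this] show ?thesis using I by simp
qed

lemma card_fibre_insert:
  assumes "finite X" "e \<notin> X"
  shows "card (fibre (insert e X) v) = card (fibre X v) + card {i\<in>I. \<rho> i e = v}"
proof -
  have "fibre (insert e X) v = fibre X v \<union> Pair e ` {i\<in>I. \<rho> i e = v}"
    by (auto simp: fibre_def)
  moreover have "fibre X v \<inter> Pair e ` {i\<in>I. \<rho> i e = v} = {}"
    using assms by (auto simp: fibre_def)
  ultimately show ?thesis
    using assms I finite_fibre[OF assms(1)] by (simp add: card_Un_disjoint card_image inj_on_def)
qed

lemma card_partial_colourings_insert_le:
  assumes "finite X" "e \<notin> X"
  shows "card (partial_colourings (insert e X)) \<le>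
    (\<Sum>g\<in>partial_colourings X. card {c \<in> injections I T. \<forall>i\<in>I. c i \<notin> used g X (\<rho> i e)})"
proof -
  let ?S = "SIGMA g:partial_colourings X. {c \<in> injections I T. \<forall>i\<in>I. c i \<notin> used g X (\<rho> i e)}"
  have fin: "finite ?S"
    using finite_partial_colourings[OF assms(1)] finite_injections[OF I(1) T(1)] by auto
  have "partial_colourings (insert e X) \<subseteq> (\<lambda>(g, c). g(e := c)) ` ?S"
  proof
    fix g assume g: "g \<in> partial_colourings (insert e X)"
    let ?g = "g(e := undefined)"
    have gX: "g x \<in> injections I T" if "x \<in> insert e X" for x
      using g that by (rule partial_colouringsD2)
    have "g \<in> extensional (insert e X)" using g by (auto simp: partial_colourings_def PiE_def)
    then have "?g \<in> X \<rightarrow>\<^sub>E injections I T"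
      using gX assms(2) by (auto simp: PiE_iff extensional_def)
    moreover have "\<forall>e1\<in>X. \<forall>e2\<in>X. \<forall>i\<in>I. \<forall>k\<in>I. e1 \<noteq> e2 \<and> \<rho> i e1 = \<rho> k e2 \<longrightarrow> ?g e1 i \<noteq> ?g e2 k"
    proof (intro ballI impI)
      fix e1 e2 i k
      assume "e1 \<in> X" "e2 \<in> X" "i \<in> I" "k \<in> I" "e1 \<noteq> e2 \<and> \<rho> i e1 = \<rho> k e2"
      then have "g e1 i \<noteq> g e2 k" by (intro partial_colouringsD[OF g]) auto
      moreover have "e1 \<noteq> e" "e2 \<noteq> e" using assms(2) \<open>e1 \<in> X\<close> \<open>e2 \<in> X\<close> by auto
      ultimately show "?g e1 i \<noteq> ?g e2 k" by simp
    qed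
    ultimately have "?g \<in> partial_colourings X" unfolding partial_colourings_def by blast
    moreover have "g e \<in> injections I T" by (rule gX) simp
    moreover have "\<forall>i\<in>I. g e i \<notin> used ?g X (\<rho> i e)"
    proof (intro ballI notI)
      fix i assume i: "i \<in> I" "g e i \<in> used ?g X (\<rho> i e)"
      then obtain e' k where k: "e' \<in> X" "k \<in> I" "\<rho> k e' = \<rho> i e" "g e i = ?g e' k"
        by (auto simp: used_def fibre_def)
      have "e' \<noteq> e" using k(1) assms(2) by auto
      then have "g e i = g e' k" using k by simp
      moreover have "g e i \<noteq> g e' k"
        using i(1) k(1-3) \<open>e' \<noteq> e\<close> by (intro partial_colouringsD[OF g]) auto
      ultimately show False by simp
    qed
    ultimately show "g \<in> (\<lambda>(g, c). g(e := c)) ` ?S"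
      by (intro image_eqI[of _ _ "(?g, g e)"]) auto
  qed
  then have "card (partial_colourings (insert e X)) \<le> card ?S"
    using fin by (meson card_image_le card_mono finite_imageI le_trans)
  also have "\<dots> = (\<Sum>g\<in>partial_colourings X. card {c \<in> injections I T. \<forall>i\<in>I. c i \<notin> used g X (\<rho> i e)})"
    using finite_partial_colourings[OF assms(1)] finite_injections[OF I(1) T(1)] by (subst card_SigmaI) auto
  finally show ?thesis .
qed

abbreviation rk :: "'e \<Rightarrow> nat \<Rightarrow> nat" where
  "rk e i \<equiv> rank_in I (\<lambda>i. \<rho> i e) i"

lemma rk_less: "i \<in> I \<Longrightarrow> rk e i < m"
  unfolding rank_in_def I(2) using I(1) by (intro psubset_card_mono) auto

lemma r_bounds: "real r \<ge> 4 * real m ^ 2" "real r \<ge> 4 * real m" "real r \<ge> 2"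
proof -
  have "real (4 * m ^ 2) \<le> real r" using r(1) by (rule of_nat_mono)
  then show 1: "real r \<ge> 4 * real m ^ 2" by simp
  have "real m ^ 2 \<ge> real m" using I(3) by (simp add: power2_eq_square)
  then show "real r \<ge> 4 * real m" using 1 by linarith
  show "real r \<ge> 2" using r(2) by simp
qed

text \<open>
  The columns are coloured one at a time. A place that meets the coloured columns \<open>d\<close> times has exactly \<open>d\<close>
  used colours, so the number of ways to colour the next column is bounded in terms of the \<open>d\<close>'s alone, and the bounds
  telescope.
\<close>

lemma card_partial_colourings_le:
  assumes "X \<subseteq> E"
  shows "real (card (partial_colourings X)) \<le>
    (falling m r * (1 + 24 * real m ^ 6 / real r ^ 3)) ^ card X
      * (\<Prod>v\<in>E. distinct_prob r (card (fibre X v)))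
      * (\<Prod>e\<in>X. \<Prod>i\<in>I. 1 / (1 - real (rk e i) / real r))"
proof -
  have "finite X" using assms E finite_subset by blast
  then show ?thesis using assms
  proof (induction X)
    case empty
    have "partial_colourings {} = {\<lambda>_. undefined}" by (auto simp: partial_colourings_def)
    then show ?case by (simp add: fibre_def distinct_prob_def)
  next
    case (insert e X)
    let ?JK = "falling m r * (1 + 24 * real m ^ 6 / real r ^ 3)"
    let ?d = "\<lambda>v. card (fibre X v)"
    have J: "falling m r \<ge> 0" unfolding falling_def
      by (intro prod_nonneg) (use r_bounds in auto)
    have rk0: "1 - real (rk e i) / real r > 0" if "i \<in> I" for i e
      using rk_less[OF that, of e] r_bounds by (simp add: field_simps)
    have step: "real (card {c \<in> injections I T. \<forall>i\<in>I. c i \<notin> used g X (\<rho> i e)})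
       \<le> ?JK * (\<Prod>i\<in>I. 1 - real (?d (\<rho> i e)) / (real r - real (rk e i)))"
      if g: "g \<in> partial_colourings X" for g
    proof -
      have "used g X v \<subseteq> T" for v
        using partial_colouringsD2[OF g] by (fastforce simp: used_def fibre_def injections_def)
      moreover have "card (used g X v) \<le> m" for v
        using card_used[OF g] card_fibre_le insert by simp
      ultimately show ?thesis
        using card_avoiding_injections_le[OF I(1,2) T, of "used g X" "\<lambda>i. \<rho> i e"] r card_used[OF g] by simp
    qed
    have "real (card (partial_colourings (insert e X)))
      \<le> real (\<Sum>g\<in>partial_colourings X. card {c \<in> injections I T. \<forall>i\<in>I. c i \<notin> used g X (\<rho> i e)})"
      using card_partial_colourings_insert_le[OF insert.hyps] by (rule of_nat_mono)
    also have "\<dots> \<le> (\<Sum>g\<in>partial_colourings X. ?JK * (\<Prod>i\<in>I. 1 - real (?d (\<rho> i e)) / (real r - real (rk e i))))"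
      unfolding of_nat_sum by (intro sum_mono step)
    also have "\<dots> = real (card (partial_colourings X)) * (?JK * (\<Prod>i\<in>I. 1 - real (?d (\<rho> i e)) / (real r - real (rk e i))))"
      by simp
    also have "(\<Prod>i\<in>I. 1 - real (?d (\<rho> i e)) / (real r - real (rk e i)))
       = (\<Prod>i\<in>I. (1 - (real (?d (\<rho> i e)) + real (rk e i)) / real r) * (1 / (1 - real (rk e i) / real r)))"
    proof (intro prod.cong refl)
      fix i assume "i \<in> I"
      then have "real r - real (rk e i) > 0" "real r > 0" using rk_less[of i e] r_bounds by linarith+
      then show "1 - real (?d (\<rho> i e)) / (real r - real (rk e i)) =
        (1 - (real (?d (\<rho> i e)) + real (rk e i)) / real r) * (1 / (1 - real (rk e i) / real r))"
        by (simp add: field_simps)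
    qed
    also have "\<dots> = (\<Prod>i\<in>I. 1 - (real (?d (\<rho> i e)) + real (rk e i)) / real r) * (\<Prod>i\<in>I. 1 / (1 - real (rk e i) / real r))"
      by (rule prod.distrib)
    also have "(\<Prod>i\<in>I. 1 - (real (?d (\<rho> i e)) + real (rk e i)) / real r)
       = (\<Prod>v\<in>E. \<Prod>a<card {i\<in>I. \<rho> i e = v}. 1 - (real (?d v) + real a) / real r)"
      using \<rho> insert.prems
      by (intro prod_rank_in[of I E "\<lambda>i. \<rho> i e" "\<lambda>v a. 1 - (real (?d v) + real a) / real r"] I E)
        (auto simp: bij_betw_def)
    finally have A: "real (card (partial_colourings (insert e X))) \<le> real (card (partial_colourings X)) *
      (?JK * ((\<Prod>v\<in>E. \<Prod>a<card {i\<in>I. \<rho> i e = v}. 1 - (real (?d v) + real a) / real r) * (\<Prod>i\<in>I. 1 / (1 - real (rk e i) / real r))))" .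
    have nonneg: "0 \<le> ?JK * ((\<Prod>v\<in>E. \<Prod>a<card {i\<in>I. \<rho> i e = v}. 1 - (real (?d v) + real a) / real r) * (\<Prod>i\<in>I. 1 / (1 - real (rk e i) / real r)))"
    proof (intro mult_nonneg_nonneg J prod_nonneg ballI)
      fix v a assume "a \<in> {..<card {i\<in>I. \<rho> i e = v}}"
      moreover have "card {i\<in>I. \<rho> i e = v} \<le> card I" using I by (intro card_mono) auto
      ultimately have "a < m" using I by auto
      moreover have "?d v \<le> m" using card_fibre_le insert by simp
      ultimately show "0 \<le> 1 - (real (?d v) + real a) / real r" using r_bounds by (simp add: field_simps)
    qed (use rk0 in \<open>auto intro: less_imp_le\<close>)
    have IH: "real (card (partial_colourings X)) \<le>
    ?JK ^ card X * (\<Prod>v\<in>E. distinct_prob r (?d v)) * (\<Prod>e\<in>X. \<Prod>i\<in>I. 1 / (1 - real (rk e i) / real r))"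
      using insert by simp
    have B: "(\<Prod>v\<in>E. distinct_prob r (card (fibre (insert e X) v))) =
       (\<Prod>v\<in>E. distinct_prob r (?d v)) * (\<Prod>v\<in>E. \<Prod>a<card {i\<in>I. \<rho> i e = v}. 1 - (real (?d v) + real a) / real r)"
      unfolding card_fibre_insert[OF insert.hyps] distinct_prob_add by (rule prod.distrib)
    show ?case using A mult_right_mono[OF IH nonneg] insert.hyps unfolding B
      by (simp add: mult_ac)
  qed
qed

text \<open>
  On a fibre of size \<open>b\<close> the left-hand side is the exponential of \<open>b (b - 1) / 2 * (1 / r + (2 b - 1) / (6 r\<^sup>2))\<close>
  up to an error of order \<open>1 / r\<^sup>3\<close>. Since \<open>b\<close> is at most \<open>m\<close>, every pair of cells stacked together twice costs at most
  the factor that it costs when the two stackings coincide. Replacing \<open>b\<close> by \<open>m\<close> decouples the pairs from each other.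
\<close>

lemma prod_inverse_rank_le:
  assumes "e \<in> E"
  shows "(\<Prod>i\<in>I. 1 / (1 - real (rk e i) / real r))
    \<le> exp ((1 / real r + (2 * real m - 1) / (6 * real r ^ 2)) * (\<Sum>i\<in>I. real (rk e i)) + real m ^ 4 / real r ^ 3)"
proof -
  let ?\<beta> = "1 / real r + (2 * real m - 1) / (6 * real r ^ 2)"
  let ?b = "\<lambda>v. card {i\<in>I. \<rho> i e = v}"
  have sub: "(\<lambda>i. \<rho> i e) ` I \<subseteq> E" using \<rho> assms by (auto simp: bij_betw_def)
  have bm: "?b v \<le> m" for v unfolding I(2) using I by (intro card_mono) auto
  have "(\<Prod>i\<in>I. 1 / (1 - real (rk e i) / real r)) = (\<Prod>v\<in>E. \<Prod>a<?b v. 1 / (1 - real a / real r))"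
    by (rule prod_rank_in[OF I(1) E sub, of "\<lambda>_ a. 1 / (1 - real a / real r)"])
  also have "\<dots> \<le> (\<Prod>v\<in>E. \<Prod>a<?b v. exp (?\<beta> * real a + real m ^ 3 / real r ^ 3))"
  proof (rule prod_mono, rule conjI)
    fix v
    have a: "0 \<le> real a / real r" "real a / real r \<le> 1 / 2" "real a \<le> real m" if "a < ?b v" for a
      using that bm[of v] r_bounds by (auto simp: field_simps)
    show "0 \<le> (\<Prod>a<?b v. 1 / (1 - real a / real r))"
    proof (intro prod_nonneg ballI)
      fix k assume "k \<in> {..<?b v}"
      then have "k < ?b v" by simp
      then have "0 \<le> 1 - real k / real r" using a(2)[of k] by (intro diff_ge_0_iff_ge[THEN iffD2]) linarith
      then show "0 \<le> 1 / (1 - real k / real r)" by (simp only: zero_le_divide_1_iff)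
    qed
    have "(\<Prod>a<?b v. 1 / (1 - real a / real r))
        \<le> (\<Prod>a<?b v. exp (real a / real r + (real a / real r) ^ 2 / 2 + (real a / real r) ^ 3))"
    proof (intro prod_mono conjI)
      fix k assume k: "k \<in> {..<?b v}"
      then show "1 / (1 - real k / real r) \<le> exp (real k / real r + (real k / real r) ^ 2 / 2 + (real k / real r) ^ 3)"
        by (intro inverse_one_minus_le_exp a) auto
      have "k < ?b v" using k by simp
      then have "0 \<le> 1 - real k / real r" using a(2)[of k] by (intro diff_ge_0_iff_ge[THEN iffD2]) linarith
      then show "0 \<le> 1 / (1 - real k / real r)" by (simp only: zero_le_divide_1_iff)
    qed
    also have "\<dots> \<le> (\<Prod>a<?b v. exp (real a / real r + (real a / real r) ^ 2 / 2 + real m ^ 3 / real r ^ 3))"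
    proof (intro prod_mono conjI)
      fix k assume "k \<in> {..<?b v}"
      then have "(real k / real r) ^ 3 \<le> real m ^ 3 / real r ^ 3"
        unfolding power_divide using a(3)[of k] by (intro divide_right_mono power_mono) auto
      then show "exp (real k / real r + (real k / real r) ^ 2 / 2 + (real k / real r) ^ 3) \<le>
          exp (real k / real r + (real k / real r) ^ 2 / 2 + real m ^ 3 / real r ^ 3)" by simp
    qed auto
    also have "\<dots> = exp (\<Sum>a<?b v. real a / real r + (real a / real r) ^ 2 / 2 + real m ^ 3 / real r ^ 3)"
      by (simp add: exp_sum)
    also have "\<dots> \<le> exp (\<Sum>a<?b v. ?\<beta> * real a + real m ^ 3 / real r ^ 3)"
    proof -
      have "(\<Sum>a<?b v. real a / real r + (real a / real r) ^ 2 / 2)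
          = (\<Sum>a<?b v. real a) / real r + (\<Sum>a<?b v. real a ^ 2) / (2 * real r ^ 2)"
        by (simp add: sum.distrib sum_divide_distrib power_divide mult.commute)
      also have "\<dots> = (1 / real r + (2 * real (?b v) - 1) / (6 * real r ^ 2)) * (\<Sum>a<?b v. real a)"
        unfolding sum_squares_lessThan_real by (simp add: algebra_simps add_divide_distrib diff_divide_distrib)
      also have "\<dots> \<le> ?\<beta> * (\<Sum>a<?b v. real a)"
        using bm[of v] by (intro mult_right_mono add_left_mono divide_right_mono sum_nonneg) auto
      finally show ?thesis by (simp add: sum.distrib sum_distrib_left)
    qed
    finally show "(\<Prod>a<?b v. 1 / (1 - real a / real r)) \<le> (\<Prod>a<?b v. exp (?\<beta> * real a + real m ^ 3 / real r ^ 3))"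
      by (simp add: exp_sum)
  qed
  also have "\<dots> = (\<Prod>i\<in>I. exp (?\<beta> * real (rk e i) + real m ^ 3 / real r ^ 3))"
    by (rule prod_rank_in[OF I(1) E sub, of "\<lambda>_ a. exp (?\<beta> * real a + real m ^ 3 / real r ^ 3)", symmetric])
  also have "\<dots> = exp (?\<beta> * (\<Sum>i\<in>I. real (rk e i)) + real m * (real m ^ 3 / real r ^ 3))"
    using I by (simp add: exp_sum[symmetric] sum.distrib sum_distrib_left)
  finally show ?thesis by (simp add: power_numeral_reduce)
qed

lemma card_full_colourings_le:
  "real (card (partial_colourings E)) \<le> (falling m r ^ 2 / real r ^ m) ^ card E
    * exp (25 * real m ^ 6 * real (card E) / real r ^ 3)
    * exp ((1 / real r + (2 * real m - 1) / (6 * real r ^ 2)) *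
        (\<Sum>i\<in>I. \<Sum>k\<in>{k\<in>I. k < i}. real (card {e\<in>E. \<rho> k e = \<rho> i e})))"
proof -
  let ?\<beta> = "1 / real r + (2 * real m - 1) / (6 * real r ^ 2)" and ?J = "falling m r"
  let ?K = "1 + 24 * real m ^ 6 / real r ^ 3"
  have J: "?J \<ge> 0" unfolding falling_def by (intro prod_nonneg) (use r_bounds in auto)
  have D: "distinct_prob r m = ?J / real r ^ m"
    using falling_eq_distinct_prob[of r m] r(2) by simp
  have M1: "real m \<ge> 1" using I(3) by simp
  have rank: "(\<Sum>e\<in>E. \<Sum>i\<in>I. real (rk e i)) = (\<Sum>i\<in>I. \<Sum>k\<in>{k\<in>I. k < i}. real (card {e\<in>E. \<rho> k e = \<rho> i e}))"
  proof -
    have "real (rk e i) = (\<Sum>k\<in>{k\<in>I. k < i}. of_bool (\<rho> k e = \<rho> i e))" for e i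
      unfolding rank_in_def using I by (simp add: Int_def conj_ac)
    then have "(\<Sum>e\<in>E. \<Sum>i\<in>I. real (rk e i)) = (\<Sum>i\<in>I. \<Sum>e\<in>E. \<Sum>k\<in>{k\<in>I. k < i}. of_bool (\<rho> k e = \<rho> i e))"
      by (simp only: sum.swap[of _ I E])
    also have "\<dots> = (\<Sum>i\<in>I. \<Sum>k\<in>{k\<in>I. k < i}. \<Sum>e\<in>E. of_bool (\<rho> k e = \<rho> i e))"
      by (intro sum.cong refl sum.swap)
    finally show ?thesis using E by (simp add: Int_def)
  qed
  have "real (card (partial_colourings E)) \<le> (?J * ?K) ^ card E * (\<Prod>v\<in>E. distinct_prob r (card (fibre E v)))
      * (\<Prod>e\<in>E. \<Prod>i\<in>I. 1 / (1 - real (rk e i) / real r))"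
    by (rule card_partial_colourings_le) simp
  also have "(\<Prod>v\<in>E. distinct_prob r (card (fibre E v))) = (?J / real r ^ m) ^ card E"
    using card_fibre_full by (simp add: D)
  also have "(?J * ?K) ^ card E * (?J / real r ^ m) ^ card E * (\<Prod>e\<in>E. \<Prod>i\<in>I. 1 / (1 - real (rk e i) / real r))
    \<le> (?J * ?K) ^ card E * (?J / real r ^ m) ^ card E * (\<Prod>e\<in>E. exp (?\<beta> * (\<Sum>i\<in>I. real (rk e i)) + real m ^ 4 / real r ^ 3))"
  proof (intro mult_left_mono prod_mono conjI prod_inverse_rank_le)
    fix e assume "e \<in> E"
    show "0 \<le> (\<Prod>i\<in>I. 1 / (1 - real (rk e i) / real r))"
      using rk_less[of _ e] r_bounds by (intro prod_nonneg) (fastforce simp: field_simps)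
  qed (use J in auto)
  also have "(\<Prod>e\<in>E. exp (?\<beta> * (\<Sum>i\<in>I. real (rk e i)) + real m ^ 4 / real r ^ 3))
     = exp (real (card E) * (real m ^ 4 / real r ^ 3)) * exp (?\<beta> * (\<Sum>e\<in>E. \<Sum>i\<in>I. real (rk e i)))"
    using E by (simp add: exp_sum[symmetric] sum.distrib sum_distrib_left exp_add[symmetric] add.commute)
  also have "(?J * ?K) ^ card E * (?J / real r ^ m) ^ card E * (exp (real (card E) * (real m ^ 4 / real r ^ 3)) * exp (?\<beta> * (\<Sum>e\<in>E. \<Sum>i\<in>I. real (rk e i))))
    = (?J ^ 2 / real r ^ m) ^ card E * (?K ^ card E * exp (real (card E) * (real m ^ 4 / real r ^ 3))) * exp (?\<beta> * (\<Sum>e\<in>E. \<Sum>i\<in>I. real (rk e i)))"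
    by (simp add: power_mult_distrib power_divide power2_eq_square)
  also have "\<dots> \<le> (?J ^ 2 / real r ^ m) ^ card E * exp (25 * real m ^ 6 * real (card E) / real r ^ 3) * exp (?\<beta> * (\<Sum>e\<in>E. \<Sum>i\<in>I. real (rk e i)))"
  proof (intro mult_left_mono mult_right_mono)
    have "?K ^ card E \<le> exp (24 * real m ^ 6 / real r ^ 3) ^ card E"
      by (intro power_mono exp_ge_add_one_self) auto
    also have "\<dots> = exp (real (card E) * (24 * real m ^ 6 / real r ^ 3))"
      by (rule exp_of_nat_mult[symmetric])
    finally have 1: "?K ^ card E \<le> exp (real (card E) * (24 * real m ^ 6 / real r ^ 3))" .
    have 2: "exp (real (card E) * (real m ^ 4 / real r ^ 3)) \<le> exp (real (card E) * (real m ^ 6 / real r ^ 3))"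
      using M1 by (auto intro!: mult_left_mono divide_right_mono power_increasing)
    have "?K ^ card E * exp (real (card E) * (real m ^ 4 / real r ^ 3)) \<le>
       exp (real (card E) * (24 * real m ^ 6 / real r ^ 3)) * exp (real (card E) * (real m ^ 6 / real r ^ 3))"
      using 1 2 by (intro mult_mono) auto
    also have "\<dots> = exp (25 * real m ^ 6 * real (card E) / real r ^ 3)"
      by (simp add: exp_add[symmetric] field_simps)
    finally show "?K ^ card E * exp (real (card E) * (real m ^ 4 / real r ^ 3)) \<le> exp (25 * real m ^ 6 * real (card E) / real r ^ 3)" .
  qed auto
  finally show ?thesis unfolding rank .
qed

end

section \<open>Edges fixed by a random permutation\<close>

definition pairs_of :: "'a set \<Rightarrow> 'a set set" where
  "pairs_of U = {e. e \<subseteq> U \<and> card e = 2}"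

definition two_cycles :: "('a \<Rightarrow> 'a) \<Rightarrow> 'a set set" where
  "two_cycles \<pi> = {{x, y} | x y. x \<noteq> y \<and> \<pi> x = y \<and> \<pi> y = x}"

lemma two_cyclesE:
  assumes "e \<in> two_cycles \<pi>"
  obtains x y where "e = {x, y}" "x \<noteq> y" "\<pi> x = y" "\<pi> y = x"
  using assms unfolding two_cycles_def by blast

lemma two_cyclesI: "x \<noteq> y \<Longrightarrow> \<pi> x = y \<Longrightarrow> \<pi> y = x \<Longrightarrow> {x, y} \<in> two_cycles \<pi>"
  unfolding two_cycles_def by blast

lemma two_cycles_subset:
  assumes "\<pi> permutes U"
  shows "two_cycles \<pi> \<subseteq> pairs_of U"
proof
  fix e assume "e \<in> two_cycles \<pi>"
  then obtain x y where xy: "e = {x, y}" "x \<noteq> y" "\<pi> x = y" "\<pi> y = x" by (rule two_cyclesE)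
  then have "x \<in> U" "y \<in> U" using permutes_not_in[OF assms, of x] permutes_not_in[OF assms, of y] by auto
  then show "e \<in> pairs_of U" using xy by (auto simp: pairs_of_def)
qed

lemma finite_pairs_of: "finite U \<Longrightarrow> finite (pairs_of U)"
  unfolding pairs_of_def by (rule finite_subset[of _ "Pow U"]) auto

lemma card_pairs_of: "finite U \<Longrightarrow> card (pairs_of U) = card U choose 2"
  unfolding pairs_of_def by (rule n_subsets)

text \<open>
  Composing with a transposition splits off a 2-cycle; this is the bijection behind the factorial moments of the
  number of 2-cycles.
\<close>

lemma remove_two_cycle:
  assumes \<pi>: "\<pi> permutes U" and xy: "x \<noteq> y" "\<pi> x = y" "\<pi> y = x"
  defines "\<pi>' \<equiv> \<pi> \<circ> Transposition.transpose x y"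
  shows "\<pi>' permutes (U - {x, y})" "two_cycles \<pi> = insert {x, y} (two_cycles \<pi>')" "{x, y} \<notin> two_cycles \<pi>'"
proof -
  have p: "\<pi>' x = x" "\<pi>' y = y" "\<And>z. z \<noteq> x \<Longrightarrow> z \<noteq> y \<Longrightarrow> \<pi>' z = \<pi> z"
    using xy by (simp_all add: \<pi>'_def transpose_def)
  have "x \<in> U" using permutes_not_in[OF \<pi>, of x] xy by auto
  moreover have "y \<in> U" using permutes_not_in[OF \<pi>, of y] xy by auto
  ultimately have xyU: "x \<in> U" "y \<in> U" by auto
  have "\<pi>' permutes U"
    unfolding \<pi>'_def by (rule permutes_compose[OF permutes_swap_id[OF xyU] \<pi>])
  then show "\<pi>' permutes (U - {x, y})"
    by (rule permutes_superset) (auto simp: p(1,2))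
  show "{x, y} \<notin> two_cycles \<pi>'"
  proof
    assume "{x, y} \<in> two_cycles \<pi>'"
    then obtain a b where ab: "{x, y} = {a, b}" "a \<noteq> b" "\<pi>' a = b" "\<pi>' b = a"
      by (rule two_cyclesE)
    then have "a = x \<or> a = y" by blast
    then have "\<pi>' a = a" using p(1,2) by (elim disjE) simp_all
    then show False using ab(2,3) by simp
  qed
  show "two_cycles \<pi> = insert {x, y} (two_cycles \<pi>')"
  proof (intro equalityI subsetI)
    fix e assume "e \<in> two_cycles \<pi>"
    then obtain a b where ab: "e = {a, b}" "a \<noteq> b" "\<pi> a = b" "\<pi> b = a" by (rule two_cyclesE)
    show "e \<in> insert {x, y} (two_cycles \<pi>')"
    proof (cases "a \<in> {x, y} \<or> b \<in> {x, y}")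
      case True
      then have "a = x \<or> a = y \<or> b = x \<or> b = y" by blast
      then have "e = {x, y}" using ab xy by (elim disjE) (simp_all add: insert_commute)
      then show ?thesis by simp
    next
      case False
      then have "\<pi>' a = b" "\<pi>' b = a" using ab(3,4) p(3)[of a] p(3)[of b] by auto
      then show ?thesis using ab(1,2) by (simp add: two_cyclesI)
    qed
  next
    fix e assume e: "e \<in> insert {x, y} (two_cycles \<pi>')"
    show "e \<in> two_cycles \<pi>"
    proof (cases "e = {x, y}")
      case True
      then show ?thesis using two_cyclesI[of x y \<pi>] xy by simp
    next
      case False
      then have "e \<in> two_cycles \<pi>'" using e by simp
      then obtain a b where ab: "e = {a, b}" "a \<noteq> b" "\<pi>' a = b" "\<pi>' b = a"
        by (rule two_cyclesE)
      then have "a \<noteq> x" "a \<noteq> y" "b \<noteq> x" "b \<noteq> y" using p(1,2) by metis+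
      then have "\<pi> a = b" "\<pi> b = a" using ab(3,4) p(3)[of a] p(3)[of b] by auto
      then show ?thesis using ab(1,2) by (simp add: two_cyclesI)
    qed
  qed
qed

text \<open>
  The \<open>s\<close>-th factorial moment of the number of 2-cycles is that of a Poisson variable with mean
  \<open>1 / 2\<close>, up to truncation. Absorption, \<open>(s + 1) (t choose (s + 1)) = t ((t - 1) choose s)\<close>, picks one 2-cycle out of \<open>t\<close>,
  and its removal leaves a permutation of the other points.
\<close>

lemma sum_binomial_two_cycles_le:
  assumes "finite U"
  shows "(\<Sum>\<pi>\<in>{\<pi>. \<pi> permutes U}. real (card (two_cycles \<pi>) choose s)) \<le> fact (card U) / (2 ^ s * fact s)"
  using assms
proof (induction s arbitrary: U)
  case 0
  then show ?case by (simp add: card_permutations)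
next
  case (Suc s)
  let ?t = "\<lambda>\<pi>. card (two_cycles \<pi>)" and ?S = "{\<pi>. \<pi> permutes U}"
  have finS: "finite ?S" using Suc.prems by (rule finite_permutations)
  have "real (Suc s) * (\<Sum>\<pi>\<in>?S. real (?t \<pi> choose Suc s)) = (\<Sum>\<pi>\<in>?S. \<Sum>e\<in>two_cycles \<pi>. real ((?t \<pi> - 1) choose s))"
    unfolding sum_distrib_left
  proof (intro sum.cong refl)
    fix \<pi>
    have "real (Suc s * (?t \<pi> choose Suc s)) = real (?t \<pi> * ((?t \<pi> - 1) choose s))"
      by (simp only: binomial_absorption)
    then show "real (Suc s) * real (?t \<pi> choose Suc s) = (\<Sum>e\<in>two_cycles \<pi>. real ((?t \<pi> - 1) choose s))"
      by (simp only: of_nat_mult sum_constant)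
  qed
  also have "\<dots> = (\<Sum>\<pi>\<in>?S. \<Sum>e\<in>{e \<in> pairs_of U. e \<in> two_cycles \<pi>}. real ((?t \<pi> - 1) choose s))"
    using two_cycles_subset[of _ U] by (intro sum.cong refl) blast
  also have "\<dots> = (\<Sum>e\<in>pairs_of U. \<Sum>\<pi>\<in>{\<pi> \<in> ?S. e \<in> two_cycles \<pi>}. real ((?t \<pi> - 1) choose s))"
    by (rule sum.swap_restrict[OF finS finite_pairs_of[OF Suc.prems]])
  also have "\<dots> \<le> (\<Sum>e\<in>pairs_of U. fact (card U - 2) / (2 ^ s * fact s))"
  proof (intro sum_mono)
    fix e assume "e \<in> pairs_of U"
    then have e: "e \<subseteq> U" "card e = 2" by (auto simp: pairs_of_def)
    then obtain x y where xy: "e = {x, y}" "x \<noteq> y" by (auto simp: card_2_iff)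
    let ?h = "\<lambda>\<pi>. \<pi> \<circ> Transposition.transpose x y"
    have swap: "\<pi> x = y \<and> \<pi> y = x" if "e \<in> two_cycles \<pi>" for \<pi>
    proof -
      obtain a b where ab: "e = {a, b}" "\<pi> a = b" "\<pi> b = a" using \<open>e \<in> two_cycles \<pi>\<close> by (rule two_cyclesE)
      then have "x = a \<and> y = b \<or> x = b \<and> y = a" using xy by (simp add: doubleton_eq_iff)
      then show ?thesis using ab by (elim disjE) simp_all
    qed
    have "(\<Sum>\<pi>\<in>{\<pi> \<in> ?S. e \<in> two_cycles \<pi>}. real ((?t \<pi> - 1) choose s))
        = (\<Sum>\<pi>\<in>{\<pi> \<in> ?S. e \<in> two_cycles \<pi>}. real (?t (?h \<pi>) choose s))"
    proof (intro sum.cong refl)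
      fix \<pi> assume \<pi>: "\<pi> \<in> {\<pi> \<in> ?S. e \<in> two_cycles \<pi>}"
      then have P: "\<pi> permutes U" "\<pi> x = y" "\<pi> y = x" using swap by auto
      note R = remove_two_cycle[OF P(1) xy(2) P(2,3)]
      have "finite (two_cycles (?h \<pi>))"
        by (rule finite_subset[OF two_cycles_subset[OF R(1)] finite_pairs_of]) (use Suc.prems in auto)
      then have "?t \<pi> = Suc (?t (?h \<pi>))" using R(2,3) by simp
      then show "real ((?t \<pi> - 1) choose s) = real (?t (?h \<pi>) choose s)" by simp
    qed
    also have "\<dots> = (\<Sum>\<pi>\<in>?h ` {\<pi> \<in> ?S. e \<in> two_cycles \<pi>}. real (?t \<pi> choose s))"
    proof (subst sum.reindex)
      show "inj_on ?h {\<pi> \<in> ?S. e \<in> two_cycles \<pi>}"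
      proof (rule inj_onI)
        fix p q assume "?h p = ?h q"
        then have "?h p \<circ> Transposition.transpose x y = ?h q \<circ> Transposition.transpose x y" by simp
        then show "p = q" by (simp add: comp_assoc)
      qed
    qed simp
    also have "\<dots> \<le> (\<Sum>\<pi>\<in>{\<pi>. \<pi> permutes (U - {x, y})}. real (?t \<pi> choose s))"
    proof (rule sum_mono2)
      show "finite {\<pi>. \<pi> permutes (U - {x, y})}" using Suc.prems by (intro finite_permutations) auto
      show "?h ` {\<pi> \<in> ?S. e \<in> two_cycles \<pi>} \<subseteq> {\<pi>. \<pi> permutes (U - {x, y})}"
        using remove_two_cycle(1)[OF _ xy(2)] swap by blast
    qed simp
    also have "\<dots> \<le> fact (card (U - {x, y})) / (2 ^ s * fact s)"
      using Suc.prems by (intro Suc.IH) auto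
    also have "card (U - {x, y}) = card U - 2"
      using e xy Suc.prems by (subst card_Diff_subset) auto
    finally show "(\<Sum>\<pi>\<in>{\<pi> \<in> ?S. e \<in> two_cycles \<pi>}. real ((?t \<pi> - 1) choose s)) \<le> fact (card U - 2) / (2 ^ s * fact s)" .
  qed
  also have "\<dots> = real (card U choose 2) * fact (card U - 2) / (2 ^ s * fact s)"
    using Suc.prems by (simp add: card_pairs_of)
  also have "real (card U choose 2) * fact (card U - 2) \<le> fact (card U) / 2"
  proof (cases "card U \<ge> 2")
    case True
    then have "real (fact 2 * fact (card U - 2) * (card U choose 2)) = real (fact (card U))"
      by (simp only: binomial_fact_lemma)
    then show ?thesis by (simp add: numeral_2_eq_2 field_simps)
  qed (auto simp: binomial_eq_0 not_le)
  finally have "real (Suc s) * (\<Sum>\<pi>\<in>?S. real (?t \<pi> choose Suc s)) \<le> fact (card U) / 2 / (2 ^ s * fact s)"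
    by (simp add: divide_right_mono)
  then have "(\<Sum>\<pi>\<in>?S. real (?t \<pi> choose Suc s)) \<le> fact (card U) / 2 / (2 ^ s * fact s) / real (Suc s)"
    by - (rule mult_imp_le_div_pos, simp, simp only: mult.commute)
  also have "fact (card U) / 2 / (2 ^ s * fact s) / real (Suc s) = (fact (card U) / (2 ^ Suc s * fact (Suc s)) :: real)"
    by simp
  finally show ?case .
qed

lemma sum_power_two_cycles_le:
  assumes "finite U" "\<theta> \<ge> (1::real)"
  shows "(\<Sum>\<pi>\<in>{\<pi>. \<pi> permutes U}. \<theta> ^ card (two_cycles \<pi>)) \<le> fact (card U) * exp ((\<theta> - 1) / 2)"
proof -
  let ?t = "\<lambda>\<pi>. card (two_cycles \<pi>)" and ?S = "{\<pi>. \<pi> permutes U}"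
  let ?B = "card (pairs_of U)"
  have tB: "?t \<pi> \<le> ?B" if "\<pi> \<in> ?S" for \<pi>
    using that two_cycles_subset finite_pairs_of[OF assms(1)] by (intro card_mono) auto
  have "(\<Sum>\<pi>\<in>?S. \<theta> ^ ?t \<pi>) = (\<Sum>\<pi>\<in>?S. \<Sum>s\<le>?B. real (?t \<pi> choose s) * (\<theta> - 1) ^ s)"
  proof (intro sum.cong refl)
    fix \<pi> assume "\<pi> \<in> ?S"
    have "\<theta> ^ ?t \<pi> = ((\<theta> - 1) + 1) ^ ?t \<pi>" by simp
    also have "\<dots> = (\<Sum>s\<le>?t \<pi>. real (?t \<pi> choose s) * (\<theta> - 1) ^ s)"
      by (subst binomial_ring) simp
    also have "\<dots> = (\<Sum>s\<le>?B. real (?t \<pi> choose s) * (\<theta> - 1) ^ s)"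
      using tB[OF \<open>\<pi> \<in> ?S\<close>] by (intro sum.mono_neutral_left) (auto simp: binomial_eq_0)
    finally show "\<theta> ^ ?t \<pi> = (\<Sum>s\<le>?B. real (?t \<pi> choose s) * (\<theta> - 1) ^ s)" .
  qed
  also have "\<dots> = (\<Sum>s\<le>?B. (\<Sum>\<pi>\<in>?S. real (?t \<pi> choose s)) * (\<theta> - 1) ^ s)"
    unfolding sum_distrib_right by (rule sum.swap)
  also have "\<dots> \<le> (\<Sum>s\<le>?B. fact (card U) / (2 ^ s * fact s) * (\<theta> - 1) ^ s)"
    using assms by (intro sum_mono mult_right_mono sum_binomial_two_cycles_le) auto
  also have "\<dots> = fact (card U) * (\<Sum>s\<le>?B. ((\<theta> - 1) / 2) ^ s /\<^sub>R fact s)"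
    unfolding sum_distrib_left by (intro sum.cong refl) (simp add: power_divide field_simps)
  also have "(\<Sum>s\<le>?B. ((\<theta> - 1) / 2) ^ s /\<^sub>R fact s) \<le> exp ((\<theta> - 1) / 2)"
    unfolding exp_def using assms by (intro sum_le_suminf summable_exp_generic) auto
  finally show ?thesis by simp
qed

lemma sum_card_Pow:
  fixes h :: "nat \<Rightarrow> real"
  assumes "finite V"
  shows "(\<Sum>F\<in>Pow V. h (card F)) = (\<Sum>f\<le>card V. real (card V choose f) * h f)"
proof -
  have "(\<Sum>F\<in>Pow V. h (card F)) = (\<Sum>f\<in>{..card V}. \<Sum>F\<in>{F\<in>Pow V. card F = f}. h (card F))"
    using assms by (intro sum.group[symmetric]) (auto intro: card_mono)
  also have "\<dots> = (\<Sum>f\<le>card V. real (card V choose f) * h f)"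
    using assms by (intro sum.cong refl) (simp add: n_subsets)
  finally show ?thesis .
qed

lemma fixed_pairs_subset:
  assumes "\<pi> permutes V"
  shows "{e \<in> pairs_of V. \<pi> ` e = e} \<subseteq> pairs_of {x \<in> V. \<pi> x = x} \<union> two_cycles \<pi>"
proof
  fix e assume "e \<in> {e \<in> pairs_of V. \<pi> ` e = e}"
  then have e: "e \<subseteq> V" "card e = 2" "\<pi> ` e = e" by (auto simp: pairs_of_def)
  then obtain x y where xy: "e = {x, y}" "x \<noteq> y" by (auto simp: card_2_iff)
  then consider "\<pi> x = x" "\<pi> y = y" | "\<pi> x = y" "\<pi> y = x"
    using e(3) by (auto simp: doubleton_eq_iff)
  then show "e \<in> pairs_of {x \<in> V. \<pi> x = x} \<union> two_cycles \<pi>"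
  proof cases
    case 1
    then show ?thesis using e xy by (auto simp: pairs_of_def)
  next
    case 2
    then show ?thesis using two_cyclesI[of x y \<pi>] xy by simp
  qed
qed

text \<open>
  A permutation with \<open>f\<close> fixed points fixes \<open>f choose 2\<close> edges pointwise, and a random permutation has exactly \<open>f\<close>
  fixed points with probability at most \<open>1 / f!\<close>. The excess collects what these edges contribute to the mean of \<open>\<theta>\<close> to the number of
  fixed edges, beyond the value one of the unweighted sum.
\<close>

definition fixed_excess :: "nat \<Rightarrow> real \<Rightarrow> real" where
  "fixed_excess n \<theta> = (\<Sum>f\<le>n. (\<theta> ^ (f choose 2) - 1) / fact f)"

text \<open>
  An edge is fixed when both ends are fixed or when it is a 2-cycle. The permutations are grouped by their set
  of fixed points, and outside that set only the 2-cycles matter.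
\<close>

lemma sum_power_fixed_pairs_le:
  assumes V: "finite V" "n = card V" and \<theta>: "\<theta> \<ge> (1::real)"
  shows "(\<Sum>\<pi>\<in>{\<pi>. \<pi> permutes V}. \<theta> ^ card {e \<in> pairs_of V. \<pi> ` e = e})
    \<le> fact n * (exp ((\<theta> - 1) / 2) * (1 + fixed_excess n \<theta>))"
proof -
  let ?t = "\<lambda>\<pi>. card (two_cycles \<pi>)" and ?S = "{\<pi>. \<pi> permutes V}"
  let ?F = "\<lambda>\<pi>. {x \<in> V. \<pi> x = x}" and ?g = "\<lambda>f. \<theta> ^ (f choose 2) - 1"
  let ?T = "exp ((\<theta> - 1) / 2)"
  have g: "?g f \<ge> 0" for f using \<theta> by simp
  have finS: "finite ?S" using V by (intro finite_permutations)
  have "(\<Sum>\<pi>\<in>?S. \<theta> ^ card {e \<in> pairs_of V. \<pi> ` e = e})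
      \<le> (\<Sum>\<pi>\<in>?S. \<theta> ^ ?t \<pi> + ?g (card (?F \<pi>)) * \<theta> ^ ?t \<pi>)"
  proof (intro sum_mono)
    fix \<pi> assume \<pi>: "\<pi> \<in> ?S"
    have fin: "finite (pairs_of (?F \<pi>) \<union> two_cycles \<pi>)"
      using two_cycles_subset[of \<pi> V] \<pi> V by (auto intro!: finite_pairs_of intro: finite_subset)
    have "card {e \<in> pairs_of V. \<pi> ` e = e} \<le> card (pairs_of (?F \<pi>) \<union> two_cycles \<pi>)"
      using fixed_pairs_subset[of \<pi> V] \<pi> fin by (intro card_mono) auto
    also have "\<dots> \<le> card (pairs_of (?F \<pi>)) + ?t \<pi>" by (rule card_Un_le)
    also have "card (pairs_of (?F \<pi>)) = (card (?F \<pi>) choose 2)" using V by (intro card_pairs_of) auto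
    finally have "\<theta> ^ card {e \<in> pairs_of V. \<pi> ` e = e} \<le> \<theta> ^ ((card (?F \<pi>) choose 2) + ?t \<pi>)"
      using \<theta> by (intro power_increasing)
    then show "\<theta> ^ card {e \<in> pairs_of V. \<pi> ` e = e} \<le> \<theta> ^ ?t \<pi> + ?g (card (?F \<pi>)) * \<theta> ^ ?t \<pi>"
      by (simp add: power_add algebra_simps)
  qed
  also have "\<dots> = (\<Sum>\<pi>\<in>?S. \<theta> ^ ?t \<pi>) + (\<Sum>\<pi>\<in>?S. ?g (card (?F \<pi>)) * \<theta> ^ ?t \<pi>)"
    by (rule sum.distrib)
  also have "(\<Sum>\<pi>\<in>?S. ?g (card (?F \<pi>)) * \<theta> ^ ?t \<pi>)
      = (\<Sum>F\<in>Pow V. \<Sum>\<pi>\<in>{\<pi>\<in>?S. ?F \<pi> = F}. ?g (card (?F \<pi>)) * \<theta> ^ ?t \<pi>)"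
    using finS V by (intro sum.group[symmetric]) auto
  also have "\<dots> \<le> (\<Sum>F\<in>Pow V. ?g (card F) * (fact (n - card F) * ?T))"
  proof (intro sum_mono)
    fix F assume F: "F \<in> Pow V"
    have "(\<Sum>\<pi>\<in>{\<pi>\<in>?S. ?F \<pi> = F}. ?g (card (?F \<pi>)) * \<theta> ^ ?t \<pi>) = ?g (card F) * (\<Sum>\<pi>\<in>{\<pi>\<in>?S. ?F \<pi> = F}. \<theta> ^ ?t \<pi>)"
      unfolding sum_distrib_left by (intro sum.cong) auto
    also have "(\<Sum>\<pi>\<in>{\<pi>\<in>?S. ?F \<pi> = F}. \<theta> ^ ?t \<pi>) \<le> (\<Sum>\<pi>\<in>{\<pi>. \<pi> permutes (V - F)}. \<theta> ^ ?t \<pi>)"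
    proof (rule sum_mono2)
      show "finite {\<pi>. \<pi> permutes (V - F)}" using V by (intro finite_permutations) auto
      show "{\<pi>\<in>?S. ?F \<pi> = F} \<subseteq> {\<pi>. \<pi> permutes (V - F)}"
        by (auto intro: permutes_superset)
    qed (use \<theta> in auto)
    also have "\<dots> \<le> fact (card (V - F)) * ?T"
      using V \<theta> by (intro sum_power_two_cycles_le) auto
    also have "card (V - F) = n - card F"
      using V F by (subst card_Diff_subset) (auto intro: finite_subset)
    finally show "(\<Sum>\<pi>\<in>{\<pi>\<in>?S. ?F \<pi> = F}. ?g (card (?F \<pi>)) * \<theta> ^ ?t \<pi>) \<le> ?g (card F) * (fact (n - card F) * ?T)"
      using g by (simp add: mult_left_mono)
  qed
  also have "\<dots> = (\<Sum>f\<le>n. real (n choose f) * (?g f * (fact (n - f) * ?T)))"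
    unfolding V(2) by (rule sum_card_Pow[OF V(1), of "\<lambda>f. ?g f * (fact (card V - f) * ?T)"])
  also have "\<dots> = (\<Sum>f\<le>n. fact n * ?T * (?g f / fact f))"
  proof (intro sum.cong refl)
    fix f assume "f \<in> {..n}"
    then have b: "real (n choose f) = fact n / (fact f * fact (n - f))" by (intro binomial_fact) simp
    have alg: "N / (F * G) * (g * (G * t)) = N * t * (g / F)" if "F \<noteq> 0" "G \<noteq> 0" for N F G g t :: real
      using that by simp
    show "real (n choose f) * (?g f * (fact (n - f) * ?T)) = fact n * ?T * (?g f / fact f)"
      unfolding b by (rule alg) (rule fact_nonzero)+
  qed
  also have "\<dots> = fact n * ?T * fixed_excess n \<theta>" by (simp only: sum_distrib_left fixed_excess_def)
  also have "(\<Sum>\<pi>\<in>?S. \<theta> ^ ?t \<pi>) \<le> fact n * ?T"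
    unfolding V(2) using V \<theta> by (intro sum_power_two_cycles_le)
  finally show ?thesis by (simp add: algebra_simps)
qed

lemma summable_small_fixed:
  "summable (\<lambda>f. real f ^ 2 * exp (real f * ln (2 * real f) / 2) / fact f)"
proof (rule summable_comparison_test_ev)
  show "summable (\<lambda>f. inverse (real f ^ 2))" by (rule inverse_power_summable) simp
  have e1: "\<forall>\<^sub>F f in sequentially. real f ^ 4 * exp (- real f) \<le> 1"
    by real_asymp
  have e2: "\<forall>\<^sub>F f in sequentially. ln (real f) \<ge> ln 2 + 4"
    by real_asymp
  have "\<forall>\<^sub>F f in sequentially. real f ^ 4 * exp (real f * (ln 2 / 2 + 1 - ln (real f) / 2)) \<le> 1"
    using e1 e2
  proof eventually_elim
    case (elim f)
    have "real f * (ln 2 / 2 + 1 - ln (real f) / 2) \<le> real f * (- 1)"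
      using elim(2) by (intro mult_left_mono) auto
    then have "real f ^ 4 * exp (real f * (ln 2 / 2 + 1 - ln (real f) / 2)) \<le> real f ^ 4 * exp (- real f)"
      by (intro mult_left_mono) auto
    with elim(1) show ?case by linarith
  qed
  then have "\<forall>\<^sub>F f in sequentially. real f ^ 2 * exp (real f * ln (2 * real f) / 2) / exp (real f * ln (real f) - real f) \<le> inverse (real f ^ 2)"
    using eventually_gt_at_top[of 0]
  proof eventually_elim
    case (elim f)
    have "real f * ln (2 * real f) / 2 - (real f * ln (real f) - real f) = real f * (ln 2 / 2 + 1 - ln (real f) / 2)"
      using elim by (simp add: ln_mult algebra_simps)
    then have "real f ^ 2 * exp (real f * ln (2 * real f) / 2) / exp (real f * ln (real f) - real f)
        = real f ^ 2 * exp (real f * (ln 2 / 2 + 1 - ln (real f) / 2))"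
      by (simp only: times_divide_eq_right[symmetric] exp_diff[symmetric])
    also have "\<dots> = real f ^ 4 * exp (real f * (ln 2 / 2 + 1 - ln (real f) / 2)) / real f ^ 2"
      using elim by (simp add: power2_eq_square power4_eq_xxxx)
    also have "\<dots> \<le> 1 / real f ^ 2" by (rule divide_right_mono[OF elim(1)]) simp
    finally show ?case by (simp only: inverse_eq_divide)
  qed
  then show "\<forall>\<^sub>F f in sequentially. norm (real f ^ 2 * exp (real f * ln (2 * real f) / 2) / fact f) \<le> inverse (real f ^ 2)"
  proof eventually_elim
    case (elim f)
    have "exp (real f * ln (real f) - real f) \<le> exp (ln (fact f))"
      using ln_fact_ge[of f] by (simp only: exp_le_cancel_iff)
    then have "real f ^ 2 * exp (real f * ln (2 * real f) / 2) / fact f \<le>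
       real f ^ 2 * exp (real f * ln (2 * real f) / 2) / exp (real f * ln (real f) - real f)"
      by (intro divide_left_mono) auto
    with elim show ?case by simp
  qed
qed

text \<open>
  Three regimes. For \<open>f \<le> n / 2\<close> the weight \<open>exp (\<mu> * (f choose 2))\<close> is at most \<open>(2 f) powr (f / 2)\<close>, much smaller
  than \<open>f!\<close>, and the difference to one supplies a factor \<open>\<mu>\<close>. For \<open>f = n - d\<close> with \<open>0 < d < n / 2\<close>, missing \<open>d\<close> fixed points
  multiplies the number of permutations by at most \<open>n ^ d\<close> but removes roughly \<open>3 d n / 4\<close> or more fixed edges, worth about \<open>n powr (- 3 / 2)\<close>
  per point, so the terms decay geometrically with a ratio of order \<open>1 / sqrt n\<close>. The identity, \<open>f = n\<close>, contributes \<open>exp (- \<kappa>)\<close>, where \<open>\<kappa>\<close> is the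
  margin by which the first moment exceeds its critical value.
\<close>

lemma fixed_excess_term_le:
  fixes \<mu> \<kappa> :: real
  assumes n: "n \<ge> 4" and \<mu>: "\<mu> \<ge> 0" "real (n choose 2) * \<mu> \<le> ln (fact n) - \<kappa>" and \<kappa>: "\<kappa> \<ge> 0" and f: "f \<le> n"
  defines "q \<equiv> exp (3 / 2 - ln (real n) / 2)"
  shows "(exp \<mu> ^ (f choose 2) - 1) / fact f \<le>
     \<mu> * (real f ^ 2 * exp (real f * ln (2 * real f) / 2) / fact f) + (if f < n then q * q ^ (n - Suc f) else exp (- \<kappa>))"
proof -
  define L where "L = ln (fact n :: real)"
  define y where "y = \<mu> * real (f choose 2)"
  have e: "exp \<mu> ^ (f choose 2) = exp y" by (simp add: y_def exp_of_nat2_mult)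
  have n0: "real n \<ge> 4" using n by simp
  have N: "real (n choose 2) > 0" unfolding real_choose_two using n0 by simp
  have L: "\<mu> \<le> L / real (n choose 2)" using \<mu>(2) \<kappa> N by (simp add: L_def field_simps)
  have L0: "L \<ge> 0" by (simp add: L_def)
  have Lu: "L \<le> real n * ln (real n)" and Ll: "real n * ln (real n) - real n \<le> L"
    unfolding L_def by (rule ln_fact_le ln_fact_ge)+
  have q0: "q > 0" by (simp add: q_def)
  have fn: "real f \<le> real n" using f by simp
  consider (small) "2 * f \<le> n" "f \<ge> 2" | (tiny) "f < 2" | (full) "f = n" | (large) "n < 2 * f" "f < n"
    using f by linarith
  then show ?thesis
  proof cases
    case tiny
    then have *: "f choose 2 = 0" by (simp add: binomial_eq_0)
    show ?thesis unfolding * using q0 \<mu>(1) by simp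
  next
    case full
    have "exp y / fact n \<le> exp (- \<kappa>)"
    proof -
      have "exp y \<le> exp (L - \<kappa>)" using \<mu>(2) full by (simp add: y_def L_def mult.commute)
      also have "\<dots> = exp (- \<kappa>) * fact n" by (simp add: L_def exp_diff exp_minus field_simps)
      finally show ?thesis by (simp add: field_simps)
    qed
    moreover have "(exp y - 1) / fact n \<le> exp y / fact n" by (intro divide_right_mono) auto
    moreover have "0 \<le> \<mu> * (real f ^ 2 * exp (real f * ln (2 * real f) / 2) / fact f)" using \<mu>(1) by simp
    ultimately show ?thesis unfolding e using full by simp
  next
    case small
    have f2: "real f \<ge> 2" "2 * real f \<le> real n" using small by linarith+
    have y0: "y \<ge> 0" using \<mu>(1) by (simp add: y_def)
    have yf: "y \<le> \<mu> * real f ^ 2"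
      unfolding y_def real_choose_two using \<mu>(1) f2 by (intro mult_left_mono) (auto simp: power2_eq_square field_simps)
    have "exp y - 1 \<le> y * exp y"
      using mult_right_mono[OF exp_ge_add_one_self[of "-y"], of "exp y"] by (simp add: exp_minus algebra_simps)
    also have "\<dots> \<le> \<mu> * real f ^ 2 * exp (real f * ln (2 * real f) / 2)"
    proof (rule mult_mono)
      have "y \<le> L / real (n choose 2) * real (f choose 2)"
        unfolding y_def using L by (rule mult_right_mono) simp
      also have "\<dots> \<le> (real n * ln (real n)) / real (n choose 2) * real (f choose 2)"
        using Lu by (intro mult_right_mono divide_right_mono) auto
      also have "\<dots> = ln (real n) * real f * ((real f - 1) / (real n - 1))"
        unfolding real_choose_two using n0 by (simp add: field_simps)
      also have "\<dots> \<le> ln (real n) * real f * (real f / real n)"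
        using n0 f2 by (intro mult_left_mono) (auto simp: field_simps)
      also have "\<dots> = real f ^ 2 * (ln (real n) / real n)" by (simp add: power2_eq_square)
      \<comment> \<open>\<open>ln x / x\<close> decreases from \<open>exp 1\<close> on, and \<open>4 \<le> 2 f \<le> n\<close>\<close>
      also have "\<dots> \<le> real f ^ 2 * (ln (2 * real f) / (2 * real f))"
      proof (intro mult_left_mono ln_x_over_x_mono)
        show "exp 1 \<le> 2 * real f" using exp_le f2 by linarith
      qed (use f2 in auto)
      also have "\<dots> = real f * ln (2 * real f) / 2" using f2 by (simp add: power2_eq_square)
      finally show "exp y \<le> exp (real f * ln (2 * real f) / 2)" by simp
    qed (use yf \<mu>(1) in auto)
    finally have "(exp y - 1) / fact f \<le> \<mu> * real f ^ 2 * exp (real f * ln (2 * real f) / 2) / fact f"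
      by (intro divide_right_mono) auto
    moreover have "0 \<le> (if f < n then q * q ^ (n - Suc f) else exp (- \<kappa>))" using q0 by simp
    ultimately show ?thesis unfolding e mult.assoc times_divide_eq_right by linarith
  next
    case large
    define d where "d = n - f"
    have d: "real d = real n - real f" "real d \<ge> 1" "2 * real d \<le> real n" using large by (auto simp: d_def)
    have lf: "L - real d * ln (real n) \<le> ln (fact f)"
    proof -
      have "fact n \<le> fact f * n ^ d"
      proof -
        have "fact n div fact f \<le> n ^ d"
          using fact_div_fact_le_pow[of d n] large by (simp add: d_def)
        moreover have "fact n = fact f * (fact n div fact f :: nat)"
          using large by (simp add: fact_dvd)
        ultimately show ?thesis by (metis mult_le_mono2)
      qed
      then have "real (fact n) \<le> real (fact f * n ^ d)" by (rule of_nat_mono)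
      then have "ln (fact n :: real) \<le> ln (fact f * real n ^ d)" by (intro ln_mono) auto
      then show ?thesis using n0 by (simp add: L_def ln_mult ln_realpow)
    qed
    have "y \<le> L / real (n choose 2) * real (f choose 2)"
      unfolding y_def using L by (rule mult_right_mono) simp
    also have "\<dots> = L * ((real f / real n) * ((real f - 1) / (real n - 1)))"
      unfolding real_choose_two using n0 by (simp add: field_simps)
    also have "\<dots> \<le> L * ((real f / real n) * (real f / real n))"
      using L0 n0 fn by (intro mult_left_mono) (auto simp: field_simps)
    also have "(real f / real n) * (real f / real n) = 1 - 2 * real d / real n + (real d / real n) * (real d / real n)"
      using n0 unfolding d(1) by (simp add: field_simps)
    also have "L * \<dots> \<le> L * (1 - 3 / 2 * (real d / real n))"
    proof (intro mult_left_mono L0)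
      have "(real d / real n) * (real d / real n) \<le> (real d / real n) * (1 / 2)"
        using d n0 by (intro mult_left_mono) (auto simp: field_simps)
      then show "1 - 2 * real d / real n + (real d / real n) * (real d / real n) \<le> 1 - 3 / 2 * (real d / real n)"
        by simp
    qed
    finally have y1: "y \<le> L - 3 / 2 * (L * (real d / real n))" by (simp add: algebra_simps)
    have "(real n * ln (real n) - real n) * (real d / real n) \<le> L * (real d / real n)"
      using Ll by (intro mult_right_mono) auto
    moreover have "(real n * ln (real n) - real n) * (real d / real n) = real d * ln (real n) - real d"
      using n0 by (simp add: field_simps)
    ultimately have "real d * ln (real n) - real d \<le> L * (real d / real n)" by simp
    then have "y - ln (fact f) \<le> real d * (3 / 2 - ln (real n) / 2)"
      using y1 lf by (simp add: algebra_simps)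
    then have "exp (y - ln (fact f)) \<le> exp (real d * (3 / 2 - ln (real n) / 2))" by simp
    also have "\<dots> = q ^ d" unfolding q_def by (rule exp_of_nat_mult)
    also have "\<dots> = q * q ^ (n - Suc f)" using large by (simp add: d_def Suc_diff_Suc flip: power_Suc)
    finally have "exp y / fact f \<le> q * q ^ (n - Suc f)" by (simp add: exp_diff)
    moreover have "(exp y - 1) / fact f \<le> exp y / fact f" by (intro divide_right_mono) auto
    moreover have "0 \<le> \<mu> * (real f ^ 2 * exp (real f * ln (2 * real f) / 2) / fact f)" using \<mu>(1) by simp
    ultimately show ?thesis unfolding e using large by simp
  qed
qed

lemma fixed_excess_tendsto:
  fixes \<mu> \<kappa> :: "nat \<Rightarrow> real"
  assumes \<mu>: "\<forall>\<^sub>F n in sequentially. 0 \<le> \<mu> n \<and> real (n choose 2) * \<mu> n \<le> ln (fact n) - \<kappa> n"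
    and \<kappa>: "filterlim \<kappa> at_top sequentially"
  shows "(\<lambda>n. fixed_excess n (exp (\<mu> n))) \<longlonglongrightarrow> 0" "\<mu> \<longlonglongrightarrow> 0"
proof -
  have k0: "\<forall>\<^sub>F n in sequentially. \<kappa> n \<ge> 0" using \<kappa> by (simp add: filterlim_at_top)
  have k: "(\<lambda>n. exp (- \<kappa> n)) \<longlonglongrightarrow> 0"
    by (rule filterlim_compose[OF exp_at_bot]) (use \<kappa> in \<open>simp add: filterlim_uminus_at_bot\<close>)
  show l0: "\<mu> \<longlonglongrightarrow> 0"
  proof (rule tendsto_sandwich)
    show "\<forall>\<^sub>F n in sequentially. 0 \<le> \<mu> n" using \<mu> by eventually_elim auto
    show "\<forall>\<^sub>F n in sequentially. \<mu> n \<le> real n * ln (real n) / (real n * (real n - 1) / 2)"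
      using \<mu> k0 eventually_ge_at_top[of 2]
    proof eventually_elim
      case (elim n)
      have "real n * (real n - 1) / 2 * \<mu> n \<le> real n * ln (real n)"
        using elim ln_fact_le[of n] unfolding real_choose_two by linarith
      moreover have "real n * (real n - 1) / 2 > 0" using elim by simp
      ultimately show ?case by (subst pos_le_divide_eq) (simp_all only: mult.commute)
    qed
    show "(\<lambda>n. real n * ln (real n) / (real n * (real n - 1) / 2)) \<longlonglongrightarrow> 0" by real_asymp
  qed auto
  let ?w = "\<lambda>f. real f ^ 2 * exp (real f * ln (2 * real f) / 2) / fact f"
  let ?q = "\<lambda>n. exp (3 / 2 - ln (real n) / 2)"
  show "(\<lambda>n. fixed_excess n (exp (\<mu> n))) \<longlonglongrightarrow> 0"
  proof (rule tendsto_sandwich)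
    show "\<forall>\<^sub>F n in sequentially. 0 \<le> fixed_excess n (exp (\<mu> n))"
      using \<mu> unfolding fixed_excess_def by eventually_elim (auto intro!: sum_nonneg)
    have q1: "\<forall>\<^sub>F n in sequentially. ?q n < 1" by real_asymp
    show "\<forall>\<^sub>F n in sequentially. fixed_excess n (exp (\<mu> n)) \<le> \<mu> n * suminf ?w + (?q n / (1 - ?q n) + exp (- \<kappa> n))"
      using \<mu> k0 q1 eventually_ge_at_top[of 4]
    proof eventually_elim
      case (elim n)
      let ?Q = "?q n"
      have "fixed_excess n (exp (\<mu> n)) \<le> (\<Sum>f\<le>n. \<mu> n * ?w f + (if f < n then ?Q * ?Q ^ (n - Suc f) else exp (- \<kappa> n)))"
        unfolding fixed_excess_def using elim by (intro sum_mono fixed_excess_term_le) auto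
      also have "\<dots> = \<mu> n * (\<Sum>f\<le>n. ?w f) + (\<Sum>f\<le>n. if f < n then ?Q * ?Q ^ (n - Suc f) else exp (- \<kappa> n))"
        by (simp add: sum.distrib sum_distrib_left)
      also have "(\<Sum>f\<le>n. if f < n then ?Q * ?Q ^ (n - Suc f) else exp (- \<kappa> n)) = ?Q * (\<Sum>f<n. ?Q ^ (n - Suc f)) + exp (- \<kappa> n)"
        by (simp add: lessThan_Suc_atMost[symmetric] sum_distrib_left)
      also have "(\<Sum>f<n. ?Q ^ (n - Suc f)) = (\<Sum>f<n. ?Q ^ f)" by (rule sum.nat_diff_reindex)
      also have "(\<Sum>f<n. ?Q ^ f) \<le> 1 / (1 - ?Q)"
      proof -
        have "(\<Sum>f<n. ?Q ^ f) \<le> (\<Sum>f. ?Q ^ f)"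
          using elim by (intro sum_le_suminf summable_geometric) auto
        then show ?thesis using elim by (subst (asm) suminf_geometric) auto
      qed
      also have "(\<Sum>f\<le>n. ?w f) \<le> suminf ?w"
        by (intro sum_le_suminf summable_small_fixed) auto
      finally show ?case using elim by (simp add: mult_left_mono)
    qed
    have "(\<lambda>n. ?q n / (1 - ?q n)) \<longlonglongrightarrow> 0" by real_asymp
    then have "(\<lambda>n. \<mu> n * suminf ?w + (?q n / (1 - ?q n) + exp (- \<kappa> n))) \<longlonglongrightarrow> 0 * suminf ?w + (0 + 0)"
      by (intro tendsto_add tendsto_mult l0 k tendsto_const)
    then show "(\<lambda>n. \<mu> n * suminf ?w + (?q n / (1 - ?q n) + exp (- \<kappa> n))) \<longlonglongrightarrow> 0" by simp
  qed auto
qed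

section \<open>The two moments\<close>

lemma edges_eq_pairs_of: "edges n = pairs_of {1..n}"
  by (simp add: edges_def pairs_of_def)

lemma finite_edges: "finite (edges n)"
  by (simp add: edges_eq_pairs_of finite_pairs_of)

lemma card_edges: "card (edges n) = n choose 2"
  by (simp add: edges_eq_pairs_of card_pairs_of)

abbreviation perms :: "nat \<Rightarrow> (nat \<Rightarrow> nat) set" where
  "perms n \<equiv> {\<pi>. \<pi> permutes {1..n}}"

abbreviation tuples :: "nat \<Rightarrow> nat \<Rightarrow> (nat \<Rightarrow> nat \<Rightarrow> nat) set" where
  "tuples m n \<equiv> {1..m} \<rightarrow>\<^sub>E perms n"

lemma finite_perms: "finite (perms n)" by (rule finite_permutations) simp

lemma card_perms: "card (perms n) = fact n" by (rule card_permutations) auto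

lemma finite_tuples: "finite (tuples m n)" by (intro finite_PiE finite_perms) auto

lemma card_tuples: "card (tuples m n) = fact n ^ m"
  by (subst card_PiE) (simp_all add: card_permutations)

lemma edges_image: "\<pi> permutes {1..n} \<Longrightarrow> e \<in> edges n \<Longrightarrow> \<pi> ` e \<in> edges n"
  unfolding edges_def
  using permutes_image[of \<pi> "{1..n}"] by (auto simp: card_image permutes_inj_on)

lemma inv_image_image: "\<pi> permutes S \<Longrightarrow> inv \<pi> ` \<pi> ` e = e"
  by (simp add: image_image permutes_inverses)

lemma image_inv_image: "\<pi> permutes S \<Longrightarrow> \<pi> ` inv \<pi> ` e = e"
  by (simp add: image_image permutes_inverses)

lemma bij_betw_image_edges: "\<pi> permutes {1..n} \<Longrightarrow> bij_betw ((`) \<pi>) (edges n) (edges n)"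
  by (rule bij_betw_byWitness[where f' = "(`) (inv \<pi>)"])
    (use edges_image[of \<pi> n] edges_image[OF permutes_inv[of \<pi> "{1..n}"]] in
      \<open>auto simp: inv_image_image image_inv_image\<close>)

definition colourings :: "nat \<Rightarrow> nat \<Rightarrow> nat \<Rightarrow> (nat \<Rightarrow> nat set \<Rightarrow> nat) set" where
  "colourings m n r = {1..m} \<rightarrow>\<^sub>E edges n \<rightarrow>\<^sub>E palette r"

lemma finite_colourings: "finite (colourings m n r)"
  unfolding colourings_def palette_def by (intro finite_PiE finite_edges) auto

lemma card_colourings: "card (colourings m n r) = (r ^ m) ^ (n choose 2)"
  unfolding colourings_def palette_def
  by (simp add: card_PiE finite_edges card_edges power_mult[symmetric] mult.commute)

lemma PiE_dflt_undefined: "PiE_dflt A undefined B = Pi\<^sub>E A B"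
  by (auto simp: PiE_dflt_def PiE_def extensional_def)

lemma stacking_prob_eq:
  assumes "r > 0"
  shows "stacking_prob m n r =
    real (card {f \<in> colourings m n r. \<exists>\<sigma>. rainbow_stacking m n f \<sigma>}) / real ((r ^ m) ^ (n choose 2))"
proof -
  have pal: "palette r \<noteq> {}" "finite (palette r)" using assms by (auto simp: palette_def)
  have rc: "random_colouring n r = pmf_of_set (edges n \<rightarrow>\<^sub>E palette r)"
    unfolding random_colouring_def using pal finite_edges
    by (subst Pi_pmf_of_set) (auto simp: PiE_dflt_undefined)
  have ne: "(edges n \<rightarrow>\<^sub>E palette r) \<noteq> {}" "finite (edges n \<rightarrow>\<^sub>E palette r)"
    using pal finite_edges by (auto simp: PiE_eq_empty_iff intro!: finite_PiE)
  have "Pi_pmf {1..m} undefined (\<lambda>_. random_colouring n r) = pmf_of_set (colourings m n r)"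
    unfolding rc colourings_def using ne by (subst Pi_pmf_of_set) (auto simp: PiE_dflt_undefined)
  moreover have "colourings m n r \<noteq> {}" unfolding colourings_def using ne by (auto simp: PiE_eq_empty_iff)
  ultimately show ?thesis
    unfolding stacking_prob_def by (simp add: measure_pmf_of_set finite_colourings card_colourings Int_def)
qed

lemma colourings_mem:
  assumes "f \<in> colourings m n r" "i \<in> {1..m}"
  shows "f i \<in> edges n \<rightarrow>\<^sub>E palette r"
  using assms unfolding colourings_def by (rule PiE_mem)

lemma tuples_mem:
  assumes "\<sigma> \<in> tuples m n" "i \<in> {1..m}"
  shows "\<sigma> i permutes {1..n}"
  using PiE_mem[OF assms] by (rule CollectD)

lemma rainbow_stacking_tuples: "rainbow_stacking m n f \<sigma> \<Longrightarrow> \<sigma> \<in> tuples m n"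
  unfolding rainbow_stacking_def by (rule conjunct1)

lemma rainbow_stackingD:
  assumes "rainbow_stacking m n f \<sigma>" "e \<in> edges n"
  shows "inj_on (\<lambda>i. f i (inv (\<sigma> i) ` e)) {1..m}"
proof -
  have "\<forall>e\<in>edges n. inj_on (\<lambda>i. f i (inv (\<sigma> i) ` e)) {1..m}"
    using assms(1) unfolding rainbow_stacking_def by (rule conjunct2)
  then show ?thesis using assms(2) by (rule bspec)
qed

text \<open>
  Reindexes a tuple of colourings by the position of the cells in the stacking \<open>\<sigma>\<close>, so that this stacking
  becomes the identity and being rainbow becomes injectivity of every column.
\<close>

definition to_columns :: "nat \<Rightarrow> nat \<Rightarrow> (nat \<Rightarrow> nat \<Rightarrow> nat) \<Rightarrow> (nat \<Rightarrow> nat set \<Rightarrow> nat) \<Rightarrow> nat set \<Rightarrow> nat \<Rightarrow> nat" where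
  "to_columns m n \<sigma> f = (\<lambda>e\<in>edges n. \<lambda>i\<in>{1..m}. f i (inv (\<sigma> i) ` e))"

lemma to_columns_edge:
  "e \<in> edges n \<Longrightarrow> to_columns m n \<sigma> f e = (\<lambda>i\<in>{1..m}. f i (inv (\<sigma> i) ` e))"
  unfolding to_columns_def by (rule restrict_apply')

lemma to_columns_at:
  assumes "\<sigma> \<in> tuples m n" "i \<in> {1..m}" "d \<in> edges n"
  shows "to_columns m n \<sigma> f (\<sigma> i ` d) i = f i d"
proof -
  note \<sigma> = tuples_mem[OF assms(1,2)]
  show ?thesis
    unfolding to_columns_edge[OF edges_image[OF \<sigma> assms(3)]] restrict_apply'[OF assms(2)] inv_image_image[OF \<sigma>] ..
qed

lemma inj_on_to_columns:
  assumes "\<sigma> \<in> tuples m n"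
  shows "inj_on (to_columns m n \<sigma>) (colourings m n r)"
proof (rule inj_onI)
  fix f g assume fg: "f \<in> colourings m n r" "g \<in> colourings m n r" "to_columns m n \<sigma> f = to_columns m n \<sigma> g"
  have "f i = g i" if i: "i \<in> {1..m}" for i
  proof -
    show ?thesis
    proof (rule PiE_ext[OF colourings_mem[OF fg(1) i] colourings_mem[OF fg(2) i]])
      fix d assume "d \<in> edges n"
      from to_columns_at[OF assms i this, of f] to_columns_at[OF assms i this, of g]
      show "f i d = g i d" unfolding fg(3) by simp
    qed
  qed
  then show "f = g" by (rule PiE_ext[OF fg(1,2)[unfolded colourings_def]])
qed

lemma to_columns_image:
  assumes \<sigma>: "\<sigma> \<in> tuples m n"
  shows "to_columns m n \<sigma> ` {f \<in> colourings m n r. rainbow_stacking m n f \<sigma>}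
    = edges n \<rightarrow>\<^sub>E injections {1..m} (palette r)"
proof (intro equalityI subsetI)
  fix g assume "g \<in> to_columns m n \<sigma> ` {f \<in> colourings m n r. rainbow_stacking m n f \<sigma>}"
  then obtain f where f: "g = to_columns m n \<sigma> f" "f \<in> colourings m n r" "rainbow_stacking m n f \<sigma>" by auto
  show "g \<in> edges n \<rightarrow>\<^sub>E injections {1..m} (palette r)"
    unfolding f(1)
  proof (rule PiE_I)
    fix e assume e: "e \<in> edges n"
    have "inv (\<sigma> i) ` e \<in> edges n" if "i \<in> {1..m}" for i
      by (rule edges_image[OF permutes_inv[OF tuples_mem[OF \<sigma> that]] e])
    then have "f i (inv (\<sigma> i) ` e) \<in> palette r" if "i \<in> {1..m}" for i
      using PiE_mem[OF colourings_mem[OF f(2) that]] that by blast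
    moreover note rainbow_stackingD[OF f(3) e]
    ultimately show "to_columns m n \<sigma> f e \<in> injections {1..m} (palette r)"
      unfolding to_columns_edge[OF e] injections_def by (simp only: mem_Collect_eq restrict_PiE_iff inj_on_restrict_eq) blast
  qed (simp add: to_columns_def)
next
  fix g assume g: "g \<in> edges n \<rightarrow>\<^sub>E injections {1..m} (palette r)"
  define f where "f = (\<lambda>i\<in>{1..m}. \<lambda>e\<in>edges n. g (\<sigma> i ` e) i)"
  have \<sigma>i: "\<sigma> i permutes {1..n}" if "i \<in> {1..m}" for i by (rule tuples_mem[OF \<sigma> that])
  have gi: "g e \<in> {1..m} \<rightarrow>\<^sub>E palette r" "inj_on (g e) {1..m}" if "e \<in> edges n" for e
    using PiE_mem[OF g that] by (auto simp: injections_def)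
  have fO: "f \<in> colourings m n r"
    unfolding colourings_def f_def
  proof (intro restrict_PiE_iff[THEN iffD2] ballI)
    fix i e assume i: "i \<in> {1..m}" and e: "e \<in> edges n"
    show "g (\<sigma> i ` e) i \<in> palette r"
      by (rule PiE_mem[OF gi(1)[OF edges_image[OF \<sigma>i[OF i] e]] i])
  qed
  have at: "f i (inv (\<sigma> i) ` e) = g e i" if "i \<in> {1..m}" "e \<in> edges n" for i e
    using that edges_image[OF permutes_inv[OF \<sigma>i[OF that(1)]] that(2)] image_inv_image[OF \<sigma>i[OF that(1)]]
    by (simp add: f_def)
  have "rainbow_stacking m n f \<sigma>"
    unfolding rainbow_stacking_def
  proof (intro conjI ballI \<sigma>)
    fix e assume "e \<in> edges n"
    then show "inj_on (\<lambda>i. f i (inv (\<sigma> i) ` e)) {1..m}"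
      using gi(2) at by (subst inj_on_cong[where g = "g e"]) auto
  qed
  moreover have "to_columns m n \<sigma> f = g"
  proof (rule ext)
    fix e
    show "to_columns m n \<sigma> f e = g e"
    proof (cases "e \<in> edges n")
      case True
      have "to_columns m n \<sigma> f e = restrict (g e) {1..m}"
        unfolding to_columns_edge[OF True] by (intro restrict_ext at True)
      also have "\<dots> = g e" by (rule PiE_restrict[OF gi(1)[OF True]])
      finally show ?thesis .
    next
      case False
      then show ?thesis using PiE_arb[OF g] by (simp add: to_columns_def)
    qed
  qed
  ultimately show "g \<in> to_columns m n \<sigma> ` {f \<in> colourings m n r. rainbow_stacking m n f \<sigma>}"
    using fO by (intro image_eqI[of _ _ f]) simp_all
qed

lemma card_rainbow:
  assumes "\<sigma> \<in> tuples m n"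
  shows "real (card {f \<in> colourings m n r. rainbow_stacking m n f \<sigma>}) = falling m r ^ (n choose 2)"
proof -
  have "card {f \<in> colourings m n r. rainbow_stacking m n f \<sigma>} = card (edges n \<rightarrow>\<^sub>E injections {1..m} (palette r))"
    unfolding to_columns_image[OF assms, symmetric]
    by (rule card_image[symmetric], rule inj_on_subset[OF inj_on_to_columns[OF assms, of r]]) auto
  also have "real \<dots> = falling m r ^ (n choose 2)"
    by (simp add: card_PiE finite_edges card_edges card_injections palette_def)
  finally show ?thesis .
qed

lemma sum_rainbow:
  "(\<Sum>f\<in>colourings m n r. real (card {\<sigma> \<in> tuples m n. rainbow_stacking m n f \<sigma>}))
    = fact n ^ m * falling m r ^ (n choose 2)"
proof -
  have "(\<Sum>f\<in>colourings m n r. real (card {\<sigma> \<in> tuples m n. rainbow_stacking m n f \<sigma>}))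
     = (\<Sum>f\<in>colourings m n r. \<Sum>\<sigma>\<in>tuples m n. of_bool (rainbow_stacking m n f \<sigma>))"
    using finite_tuples by (intro sum.cong refl) (simp add: Int_def)
  also have "\<dots> = (\<Sum>\<sigma>\<in>tuples m n. \<Sum>f\<in>colourings m n r. of_bool (rainbow_stacking m n f \<sigma>))"
    by (rule sum.swap)
  also have "\<dots> = (\<Sum>\<sigma>\<in>tuples m n. falling m r ^ (n choose 2))"
    by (intro sum.cong refl) (simp add: finite_colourings Int_def flip: card_rainbow)
  finally show ?thesis by (simp only: sum_constant card_tuples of_nat_power of_nat_fact)
qed

text \<open>
  Relabelling the vertices of all the stacked graphs at once preserves rainbow stackings. They therefore come in
  classes of size \<open>n!\<close>, which gains one factor \<open>n!\<close> over the plain union bound.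
\<close>

lemma rainbow_stacking_shift:
  assumes "rainbow_stacking m n f \<sigma>" "\<pi> \<in> perms n"
  shows "rainbow_stacking m n f (\<lambda>i\<in>{1..m}. \<pi> \<circ> \<sigma> i)"
  unfolding rainbow_stacking_def
proof (intro conjI ballI)
  have \<sigma>: "\<sigma> i permutes {1..n}" if "i \<in> {1..m}" for i
    by (rule tuples_mem[OF rainbow_stacking_tuples[OF assms(1)] that])
  have \<pi>: "\<pi> permutes {1..n}" using assms(2) by (rule CollectD)
  show "(\<lambda>i\<in>{1..m}. \<pi> \<circ> \<sigma> i) \<in> tuples m n"
    by (intro restrict_PiE_iff[THEN iffD2] ballI CollectI permutes_compose[OF \<sigma> \<pi>])
  fix e assume e: "e \<in> edges n"
  have e': "inv \<pi> ` e \<in> edges n" by (rule edges_image[OF permutes_inv[OF \<pi>] e])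
  have eq: "inv (\<pi> \<circ> \<sigma> i) ` e = inv (\<sigma> i) ` (inv \<pi> ` e)" if "i \<in> {1..m}" for i
    unfolding o_inv_distrib[OF permutes_bij[OF \<pi>] permutes_bij[OF \<sigma>[OF that]]] by (rule image_comp[symmetric])
  show "inj_on (\<lambda>i. f i (inv ((\<lambda>i\<in>{1..m}. \<pi> \<circ> \<sigma> i) i) ` e)) {1..m}"
    by (rule inj_on_cong[THEN iffD1, OF _ rainbow_stackingD[OF assms(1) e']]) (simp add: eq)
qed

lemma card_rainbow_stackings_ge:
  assumes "rainbow_stacking m n f \<sigma>" "m \<ge> 1"
  shows "card {\<sigma> \<in> tuples m n. rainbow_stacking m n f \<sigma>} \<ge> fact n"
proof -
  let ?h = "\<lambda>\<pi>. \<lambda>i\<in>{1..m}. \<pi> \<circ> \<sigma> i"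
  have \<sigma>1: "\<sigma> 1 permutes {1..n}"
    by (rule tuples_mem[OF rainbow_stacking_tuples[OF assms(1)]]) (use assms(2) in simp)
  have "inj_on ?h (perms n)"
  proof (rule inj_onI)
    fix p q assume "?h p = ?h q"
    then have "?h p 1 = ?h q 1" by simp
    then have "p \<circ> \<sigma> 1 = q \<circ> \<sigma> 1" using assms(2) by simp
    then have "p \<circ> \<sigma> 1 \<circ> inv (\<sigma> 1) = q \<circ> \<sigma> 1 \<circ> inv (\<sigma> 1)" by simp
    then show "p = q" using permutes_inv_o[OF \<sigma>1] by (simp add: comp_assoc)
  qed
  moreover have "?h ` perms n \<subseteq> {\<sigma> \<in> tuples m n. rainbow_stacking m n f \<sigma>}"
  proof
    fix x assume "x \<in> ?h ` perms n"
    then have "rainbow_stacking m n f x" using rainbow_stacking_shift[OF assms(1)] by blast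
    then show "x \<in> {\<sigma> \<in> tuples m n. rainbow_stacking m n f \<sigma>}"
      using rainbow_stacking_tuples by blast
  qed
  ultimately have "card (perms n) \<le> card {\<sigma> \<in> tuples m n. rainbow_stacking m n f \<sigma>}"
    by (rule card_inj_on_le) (use finite_tuples in auto)
  then show ?thesis unfolding card_perms .
qed

lemma stacking_prob_le:
  assumes "r > 0" "m \<ge> 1"
  shows "stacking_prob m n r \<le> fact n ^ (m - 1) * distinct_prob r m ^ (n choose 2)"
proof -
  let ?G = "{f \<in> colourings m n r. \<exists>\<sigma>. rainbow_stacking m n f \<sigma>}"
  let ?X = "\<lambda>f. real (card {\<sigma> \<in> tuples m n. rainbow_stacking m n f \<sigma>})"
  have "fact n * real (card ?G) = (\<Sum>f\<in>?G. fact n)" by simp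
  also have "\<dots> \<le> (\<Sum>f\<in>?G. ?X f)"
  proof (intro sum_mono)
    fix f assume "f \<in> ?G"
    then obtain \<sigma> where "rainbow_stacking m n f \<sigma>" by auto
    from card_rainbow_stackings_ge[OF this assms(2)]
    have "real (fact n) \<le> ?X f" by (rule of_nat_mono)
    then show "fact n \<le> ?X f" by simp
  qed
  also have "\<dots> \<le> (\<Sum>f\<in>colourings m n r. ?X f)"
    using finite_colourings by (intro sum_mono2) auto
  also have "\<dots> = fact n ^ m * falling m r ^ (n choose 2)" by (rule sum_rainbow)
  finally have "real (card ?G) \<le> fact n ^ (m - 1) * falling m r ^ (n choose 2)"
    using assms(2) by (cases m) (simp_all add: mult.assoc)
  then have "stacking_prob m n r \<le> fact n ^ (m - 1) * falling m r ^ (n choose 2) / real ((r ^ m) ^ (n choose 2))"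
    unfolding stacking_prob_eq[OF assms(1)] by (intro divide_right_mono) auto
  then show ?thesis
    unfolding falling_eq_distinct_prob[OF assms(1)] using assms(1) by (simp add: power_mult_distrib)
qed

definition agreements :: "nat \<Rightarrow> (nat \<Rightarrow> nat) \<Rightarrow> (nat \<Rightarrow> nat) \<Rightarrow> nat" where
  "agreements n p q = card {e \<in> edges n. p ` e = q ` e}"

text \<open>
  The first two terms, in powers of the reciprocal of the number of colours \<open>x\<close>, of the logarithmic cost of a pair of cells
  on the same edge: \<open>m\<close> random colours are distinct with probability about
  \<open>exp (- (m choose 2) * pair_exponent m x)\<close>.
\<close>

definition pair_exponent :: "nat \<Rightarrow> real \<Rightarrow> real" where
  "pair_exponent m x = 1 / x + (2 * real m - 1) / (6 * x ^ 2)"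

lemma card_two_rainbow_le:
  assumes \<sigma>: "\<sigma> \<in> tuples m n" and \<tau>: "\<tau> \<in> tuples m n" and r: "r \<ge> 4 * m ^ 2" "r \<ge> 2" and m: "m \<ge> 1"
  shows "real (card {f \<in> colourings m n r. rainbow_stacking m n f \<sigma> \<and> rainbow_stacking m n f \<tau>})
   \<le> (falling m r ^ 2 / real r ^ m) ^ (n choose 2)
    * exp (25 * real m ^ 6 * real (n choose 2) / real r ^ 3)
    * exp (pair_exponent m r *
        (\<Sum>i\<in>{1..m}. \<Sum>k\<in>{k\<in>{1..m}. k < i}. real (agreements n (\<tau> k \<circ> inv (\<sigma> k)) (\<tau> i \<circ> inv (\<sigma> i)))))"
proof -
  define \<rho> where "\<rho> = (\<lambda>i. (`) (\<tau> i \<circ> inv (\<sigma> i)))"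
  have pp: "\<sigma> i permutes {1..n}" "\<tau> i permutes {1..n}" if "i \<in> {1..m}" for i
    by (rule tuples_mem[OF \<sigma> that] tuples_mem[OF \<tau> that])+
  interpret column_rows "{1..m}" "edges n" \<rho> "palette r" m r
  proof
    show "bij_betw (\<rho> i) (edges n) (edges n)" if "i \<in> {1..m}" for i
      unfolding \<rho>_def by (intro bij_betw_image_edges permutes_compose permutes_inv pp that)
  qed (use finite_edges r m in \<open>auto simp: palette_def\<close>)
  let ?B = "{f \<in> colourings m n r. rainbow_stacking m n f \<sigma> \<and> rainbow_stacking m n f \<tau>}"
  have "card ?B \<le> card (partial_colourings (edges n))"
  proof (rule card_inj_on_le)
    show "inj_on (to_columns m n \<sigma>) ?B"
      by (rule inj_on_subset[OF inj_on_to_columns[OF \<sigma>, of r]]) auto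
    show "finite (partial_colourings (edges n))" by (rule finite_partial_colourings[OF finite_edges])
    show "to_columns m n \<sigma> ` ?B \<subseteq> partial_colourings (edges n)"
    proof
      fix g assume "g \<in> to_columns m n \<sigma> ` ?B"
      then obtain f where f: "g = to_columns m n \<sigma> f" "f \<in> colourings m n r"
        "rainbow_stacking m n f \<sigma>" "rainbow_stacking m n f \<tau>" by auto
      have gP: "g \<in> edges n \<rightarrow>\<^sub>E injections {1..m} (palette r)"
        unfolding to_columns_image[OF \<sigma>, symmetric] using f by blast
      have at: "g e i = f i (inv (\<tau> i) ` \<rho> i e)" if "e \<in> edges n" "i \<in> {1..m}" for e i
        unfolding f(1) to_columns_edge[OF that(1)] restrict_apply'[OF that(2)] \<rho>_def image_comp[symmetric]
          inv_image_image[OF pp(2)[OF that(2)]] ..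
      have dist: "g e i \<noteq> g e' k"
        if h: "e \<in> edges n" "e' \<in> edges n" "i \<in> {1..m}" "k \<in> {1..m}" "e \<noteq> e'" "\<rho> i e = \<rho> k e'" for e e' i k
      proof -
        have d: "\<rho> i e \<in> edges n" using \<rho>[OF h(3)] h(1) by (auto simp: bij_betw_def)
        have "i \<noteq> k"
        proof
          assume "i = k"
          then show False using h \<rho>[OF h(3)] by (auto simp: bij_betw_def inj_on_def)
        qed
        moreover have "inj_on (\<lambda>j. f j (inv (\<tau> j) ` (\<rho> i e))) {1..m}"
          by (rule rainbow_stackingD[OF f(4) d])
        ultimately have "f i (inv (\<tau> i) ` \<rho> i e) \<noteq> f k (inv (\<tau> k) ` \<rho> i e)"
          using h(3,4) by (auto dest: inj_onD)
        then show ?thesis using at[OF h(1,3)] at[OF h(2,4)] h(6) by simp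
      qed
      show "g \<in> partial_colourings (edges n)"
        unfolding partial_colourings_def
        by (intro CollectI conjI ballI impI gP) (elim conjE, rule dist)
    qed
  qed
  then have "real (card ?B) \<le> real (card (partial_colourings (edges n)))" by (rule of_nat_mono)
  also note card_full_colourings_le
  finally show ?thesis
    unfolding card_edges pair_exponent_def agreements_def \<rho>_def .
qed

definition fixed_edge_sum :: "nat \<Rightarrow> real \<Rightarrow> real" where
  "fixed_edge_sum n \<theta> = (\<Sum>\<pi>\<in>perms n. \<theta> ^ card {e \<in> edges n. \<pi> ` e = e})"

lemma sum_power_agreements:
  assumes "q \<in> perms n"
  shows "(\<Sum>p\<in>perms n. \<theta> ^ agreements n p q) = fixed_edge_sum n \<theta>"
proof -
  have q: "q permutes {1..n}" using assms by simp
  have "(\<Sum>p\<in>perms n. \<theta> ^ agreements n p q) = (\<Sum>p\<in>perms n. \<theta> ^ agreements n (q \<circ> p) q)"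
    by (rule setum_permutations_compose_left[OF q])
  also have "\<dots> = fixed_edge_sum n \<theta>"
  proof -
    have "(q \<circ> p) ` e = q ` e \<longleftrightarrow> p ` e = e" for p e
      unfolding image_comp[symmetric] by (rule inj_image_eq_iff[OF permutes_inj[OF q]])
    then show ?thesis unfolding agreements_def fixed_edge_sum_def by (simp only:)
  qed
  finally show ?thesis .
qed

text \<open>
  For a star the agreements of different leaves with the centre are independent, so the sum factorises.
\<close>

lemma sum_star:
  fixes I :: "nat set" and \<theta> :: real
  assumes "i \<in> I" "finite I"
  shows "(\<Sum>\<rho>\<in>I \<rightarrow>\<^sub>E perms n. \<Prod>k\<in>I - {i}. \<theta> ^ agreements n (\<rho> k) (\<rho> i))
    = fact n * fixed_edge_sum n \<theta> ^ (card I - 1)"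
proof -
  let ?J = "I - {i}"
  have I: "I = insert i ?J" using assms by auto
  let ?up = "\<lambda>(y, g). g(i := y)" and ?S = "perms n \<times> (?J \<rightarrow>\<^sub>E perms n)"
  have "I \<rightarrow>\<^sub>E perms n = ?up ` ?S"
    using PiE_insert_eq[of i ?J "\<lambda>_. perms n"] unfolding I[symmetric] .
  moreover have "inj_on ?up ?S" by (rule inj_combinator) simp
  ultimately have "(\<Sum>\<rho>\<in>I \<rightarrow>\<^sub>E perms n. \<Prod>k\<in>?J. \<theta> ^ agreements n (\<rho> k) (\<rho> i))
     = (\<Sum>p\<in>?S. ((\<lambda>\<rho>. \<Prod>k\<in>?J. \<theta> ^ agreements n (\<rho> k) (\<rho> i)) \<circ> ?up) p)"
    by (simp only: sum.reindex)
  also have "\<dots> = (\<Sum>(y, g)\<in>?S. \<Prod>k\<in>?J. \<theta> ^ agreements n (g k) y)"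
  proof (rule sum.cong[OF refl])
    fix p :: "(nat \<Rightarrow> nat) \<times> (nat \<Rightarrow> nat \<Rightarrow> nat)"
    obtain y g where p: "p = (y, g)" by (cases p)
    show "((\<lambda>\<rho>. \<Prod>k\<in>?J. \<theta> ^ agreements n (\<rho> k) (\<rho> i)) \<circ> ?up) p = (case p of (y, g) \<Rightarrow> \<Prod>k\<in>?J. \<theta> ^ agreements n (g k) y)"
      unfolding p comp_def prod.case by (rule prod.cong[OF refl]) simp
  qed
  also have "\<dots> = (\<Sum>y\<in>perms n. \<Sum>g\<in>?J \<rightarrow>\<^sub>E perms n. \<Prod>k\<in>?J. \<theta> ^ agreements n (g k) y)"
    by (rule sum.cartesian_product[symmetric])
  also have "\<dots> = (\<Sum>y\<in>perms n. \<Prod>k\<in>?J. \<Sum>p\<in>perms n. \<theta> ^ agreements n p y)"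
    using assms(2) finite_perms by (intro sum.cong refl prod_sum_PiE[symmetric]) simp_all
  also have "\<dots> = (\<Sum>y\<in>perms n. fixed_edge_sum n \<theta> ^ card ?J)"
    by (intro sum.cong refl) (simp only: sum_power_agreements prod_constant)
  also have "\<dots> = fact n * fixed_edge_sum n \<theta> ^ (card I - 1)"
    using assms by (simp only: sum_constant card_perms card_Diff_singleton of_nat_fact)
  finally show ?thesis .
qed

lemma sum_pairs_symmetric:
  fixes a :: "nat \<Rightarrow> nat \<Rightarrow> real"
  assumes "finite I" "\<And>i k. a k i = a i k"
  shows "2 * (\<Sum>i\<in>I. \<Sum>k\<in>{k\<in>I. k < i}. a k i) = (\<Sum>i\<in>I. \<Sum>k\<in>I - {i}. a k i)"
proof -
  have "(\<Sum>k\<in>I - {i}. a k i) = (\<Sum>k\<in>{k\<in>I. k < i}. a k i) + (\<Sum>k\<in>{k\<in>I. i < k}. a k i)" for i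
  proof -
    have split: "I - {i} = {k\<in>I. k < i} \<union> {k\<in>I. i < k}" by auto
    show ?thesis unfolding split by (rule sum.union_disjoint) (use assms(1) in auto)
  qed
  then have "(\<Sum>i\<in>I. \<Sum>k\<in>I - {i}. a k i) = (\<Sum>i\<in>I. \<Sum>k\<in>{k\<in>I. k < i}. a k i) + (\<Sum>i\<in>I. \<Sum>k\<in>{k\<in>I. i < k}. a k i)"
    by (simp only: sum.distrib)
  also have "(\<Sum>i\<in>I. \<Sum>k\<in>{k\<in>I. i < k}. a k i) = (\<Sum>k\<in>I. \<Sum>i\<in>{i\<in>I. i < k}. a k i)"
    by (rule sum.swap_restrict[OF assms(1) assms(1)])
  also have "\<dots> = (\<Sum>i\<in>I. \<Sum>k\<in>{k\<in>I. k < i}. a k i)"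
    by (intro sum.cong refl assms(2))
  finally show ?thesis by simp
qed

text \<open>
  The agreements of all pairs are not independent, but the complete graph on the \<open>m\<close> colourings is half the sum of
  its \<open>m\<close> stars. By convexity of the exponential function (that is, the inequality of arithmetic and geometric means)
  the exponential of the sum over all pairs is at most the average over the stars of the exponential with the coefficient multiplied by \<open>m / 2\<close>.
  Nothing relevant is lost: at \<open>m\<close> identical permutations the inequality is an equality.
\<close>

lemma sum_exp_agreements_le:
  assumes "m \<ge> 1"
  shows "(\<Sum>\<rho>\<in>tuples m n. exp (\<beta> * (\<Sum>i\<in>{1..m}. \<Sum>k\<in>{k\<in>{1..m}. k < i}. real (agreements n (\<rho> k) (\<rho> i)))))
    \<le> fact n * fixed_edge_sum n (exp (real m * \<beta> / 2)) ^ (m - 1)"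
proof -
  let ?I = "{1..m}" and ?\<theta> = "exp (real m * \<beta> / 2)"
  let ?s = "\<lambda>\<rho> i. \<Sum>k\<in>?I - {i}. real (agreements n (\<rho> k) (\<rho> i))"
  have "(\<Sum>\<rho>\<in>tuples m n. exp (\<beta> * (\<Sum>i\<in>?I. \<Sum>k\<in>{k\<in>?I. k < i}. real (agreements n (\<rho> k) (\<rho> i)))))
     \<le> (\<Sum>\<rho>\<in>tuples m n. \<Sum>i\<in>?I. (1 / real m) * exp (real m * \<beta> / 2 * ?s \<rho> i))"
  proof (intro sum_mono)
    fix \<rho>
    have sym: "agreements n p q = agreements n q p" for p q
      unfolding agreements_def by (intro arg_cong[of _ _ card]) auto
    have "2 * (\<Sum>i\<in>?I. \<Sum>k\<in>{k\<in>?I. k < i}. real (agreements n (\<rho> k) (\<rho> i))) = (\<Sum>i\<in>?I. ?s \<rho> i)"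
      by (rule sum_pairs_symmetric) (simp_all add: sym)
    then have "\<beta> * (\<Sum>i\<in>?I. \<Sum>k\<in>{k\<in>?I. k < i}. real (agreements n (\<rho> k) (\<rho> i))) = \<beta> / 2 * (\<Sum>i\<in>?I. ?s \<rho> i)"
      by simp
    also have "\<dots> = (\<Sum>i\<in>?I. (1 / real m) *\<^sub>R (real m * \<beta> / 2 * ?s \<rho> i))"
    proof -
      have split: "\<beta> / 2 * t = (1 / real m) *\<^sub>R (real m * \<beta> / 2 * t)" for t
        using assms by simp
      show ?thesis by (subst sum_distrib_left) (rule sum.cong[OF refl split])
    qed
    also have "exp \<dots> \<le> (\<Sum>i\<in>?I. (1 / real m) * exp (real m * \<beta> / 2 * ?s \<rho> i))"
      by (rule convex_on_sum[OF _ _ exp_convex]) (use assms in auto)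
    finally show "exp (\<beta> * (\<Sum>i\<in>?I. \<Sum>k\<in>{k\<in>?I. k < i}. real (agreements n (\<rho> k) (\<rho> i))))
      \<le> (\<Sum>i\<in>?I. (1 / real m) * exp (real m * \<beta> / 2 * ?s \<rho> i))" .
  qed
  also have "\<dots> = (\<Sum>i\<in>?I. (1 / real m) * (\<Sum>\<rho>\<in>tuples m n. exp (real m * \<beta> / 2 * ?s \<rho> i)))"
    unfolding sum_distrib_left by (rule sum.swap)
  also have "\<dots> = (\<Sum>i\<in>?I. (1 / real m) * (fact n * fixed_edge_sum n ?\<theta> ^ (m - 1)))"
  proof (intro sum.cong refl arg_cong[of _ _ "(*) (1 / real m)"])
    fix i assume i: "i \<in> ?I"
    have star: "exp (real m * \<beta> / 2 * ?s \<rho> i) = (\<Prod>k\<in>?I - {i}. ?\<theta> ^ agreements n (\<rho> k) (\<rho> i))" for \<rho>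
    proof -
      have eq: "real m * \<beta> / 2 * ?s \<rho> i = (\<Sum>k\<in>?I - {i}. real m * \<beta> / 2 * real (agreements n (\<rho> k) (\<rho> i)))"
        by (rule sum_distrib_left)
      have "exp (real m * \<beta> / 2 * ?s \<rho> i) = (\<Prod>k\<in>?I - {i}. exp (real m * \<beta> / 2 * real (agreements n (\<rho> k) (\<rho> i))))"
        unfolding eq by (rule exp_sum) simp
      also have "\<dots> = (\<Prod>k\<in>?I - {i}. ?\<theta> ^ agreements n (\<rho> k) (\<rho> i))"
        by (rule prod.cong[OF refl exp_of_nat2_mult])
      finally show ?thesis .
    qed
    have "(\<Sum>\<rho>\<in>tuples m n. exp (real m * \<beta> / 2 * ?s \<rho> i))
        = (\<Sum>\<rho>\<in>tuples m n. \<Prod>k\<in>?I - {i}. ?\<theta> ^ agreements n (\<rho> k) (\<rho> i))"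
      by (rule sum.cong[OF refl star])
    also have "\<dots> = fact n * fixed_edge_sum n ?\<theta> ^ (card ?I - 1)"
      by (rule sum_star[OF i finite_atLeastAtMost])
    also have "card ?I = m" by simp
    finally show "(\<Sum>\<rho>\<in>tuples m n. exp (real m * \<beta> / 2 * ?s \<rho> i)) = fact n * fixed_edge_sum n ?\<theta> ^ (m - 1)" .
  qed
  also have "\<dots> = fact n * fixed_edge_sum n ?\<theta> ^ (m - 1)" using assms by simp
  finally show ?thesis .
qed

lemma card_filter_of_bool:
  assumes "finite A"
  shows "real (card {x \<in> A. P x}) = (\<Sum>x\<in>A. of_bool (P x))"
  using assms by (simp add: Int_def)

text \<open>
  The bound on the number of colourings for which \<open>\<sigma>\<close> and \<open>\<tau>\<close> are both rainbow depends only on the quotients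
  \<open>\<tau> i \<circ> inv (\<sigma> i)\<close>, which run through all tuples when \<open>\<sigma>\<close> is fixed.
\<close>

lemma sum_rainbow_sq_le:
  assumes r: "r \<ge> 4 * m ^ 2" "r \<ge> 2" and m: "m \<ge> 1"
  shows "(\<Sum>f\<in>colourings m n r. real (card {\<sigma> \<in> tuples m n. rainbow_stacking m n f \<sigma>}) ^ 2)
    \<le> fact n ^ m * ((falling m r ^ 2 / real r ^ m) ^ (n choose 2)
    * exp (25 * real m ^ 6 * real (n choose 2) / real r ^ 3)
    * (fact n * fixed_edge_sum n (exp (real m * pair_exponent m r / 2)) ^ (m - 1)))"
proof -
  let ?R = "rainbow_stacking m n"
  let ?C = "(falling m r ^ 2 / real r ^ m) ^ (n choose 2) * exp (25 * real m ^ 6 * real (n choose 2) / real r ^ 3)"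
  let ?A = "\<lambda>\<rho>. \<Sum>i\<in>{1..m}. \<Sum>k\<in>{k\<in>{1..m}. k < i}. real (agreements n (\<rho> k) (\<rho> i))"
  let ?W = "\<lambda>\<rho>. exp (pair_exponent m r * ?A \<rho>)"
  let ?Z = "fact n * fixed_edge_sum n (exp (real m * pair_exponent m r / 2)) ^ (m - 1)"
  have C: "?C \<ge> 0" by (intro mult_nonneg_nonneg zero_le_power) simp_all
  have "(\<Sum>f\<in>colourings m n r. real (card {\<sigma> \<in> tuples m n. ?R f \<sigma>}) ^ 2)
     = (\<Sum>f\<in>colourings m n r. \<Sum>\<sigma>\<in>tuples m n. \<Sum>\<tau>\<in>tuples m n. of_bool (?R f \<sigma> \<and> ?R f \<tau>))"
    unfolding card_filter_of_bool[OF finite_tuples] power2_eq_square sum_product of_bool_conj ..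
  also have "\<dots> = (\<Sum>\<sigma>\<in>tuples m n. \<Sum>f\<in>colourings m n r. \<Sum>\<tau>\<in>tuples m n. of_bool (?R f \<sigma> \<and> ?R f \<tau>))"
    by (rule sum.swap)
  also have "\<dots> = (\<Sum>\<sigma>\<in>tuples m n. \<Sum>\<tau>\<in>tuples m n. \<Sum>f\<in>colourings m n r. of_bool (?R f \<sigma> \<and> ?R f \<tau>))"
    by (rule sum.cong[OF refl sum.swap])
  also have "\<dots> = (\<Sum>\<sigma>\<in>tuples m n. \<Sum>\<tau>\<in>tuples m n. real (card {f \<in> colourings m n r. ?R f \<sigma> \<and> ?R f \<tau>}))"
    unfolding card_filter_of_bool[OF finite_colourings] ..
  also have "\<dots> \<le> (\<Sum>\<sigma>\<in>tuples m n. ?C * ?Z)"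
  proof (rule sum_mono)
    fix \<sigma> assume \<sigma>: "\<sigma> \<in> tuples m n"
    let ?h = "\<lambda>\<tau>. \<lambda>i\<in>{1..m}. \<tau> i \<circ> inv (\<sigma> i)"
    have \<sigma>p: "\<sigma> i permutes {1..n}" if "i \<in> {1..m}" for i by (rule tuples_mem[OF \<sigma> that])
    have inj: "inj_on ?h (tuples m n)"
    proof (rule inj_onI)
      fix p q assume pq: "p \<in> tuples m n" "q \<in> tuples m n" "?h p = ?h q"
      have "p i = q i" if i: "i \<in> {1..m}" for i
      proof -
        have "p i \<circ> inv (\<sigma> i) = q i \<circ> inv (\<sigma> i)"
          using fun_cong[OF pq(3), of i] unfolding restrict_apply'[OF i] .
        then have "(p i \<circ> inv (\<sigma> i)) \<circ> \<sigma> i = (q i \<circ> inv (\<sigma> i)) \<circ> \<sigma> i"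
          by (rule arg_cong)
        then show ?thesis unfolding comp_assoc permutes_inv_o(2)[OF \<sigma>p[OF i]] comp_id .
      qed
      then show "p = q" by (rule PiE_ext[OF pq(1,2)])
    qed
    have "(\<Sum>\<tau>\<in>tuples m n. real (card {f \<in> colourings m n r. ?R f \<sigma> \<and> ?R f \<tau>})) \<le> (\<Sum>\<tau>\<in>tuples m n. ?C * ?W (?h \<tau>))"
    proof (rule sum_mono)
      fix \<tau> assume \<tau>: "\<tau> \<in> tuples m n"
      have "?A (?h \<tau>) = (\<Sum>i\<in>{1..m}. \<Sum>k\<in>{k\<in>{1..m}. k < i}. real (agreements n (\<tau> k \<circ> inv (\<sigma> k)) (\<tau> i \<circ> inv (\<sigma> i))))"
        by (rule sum.cong[OF refl], rule sum.cong[OF refl]) simp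
      from card_two_rainbow_le[OF \<sigma> \<tau> r m, folded this]
      show "real (card {f \<in> colourings m n r. ?R f \<sigma> \<and> ?R f \<tau>}) \<le> ?C * ?W (?h \<tau>)" .
    qed
    also have "\<dots> = ?C * (\<Sum>\<tau>\<in>tuples m n. ?W (?h \<tau>))" by (rule sum_distrib_left[symmetric])
    also have "\<dots> \<le> ?C * ?Z"
    proof (rule mult_left_mono[OF _ C])
      have "(\<Sum>\<tau>\<in>tuples m n. ?W (?h \<tau>)) = (\<Sum>\<rho>\<in>?h ` tuples m n. ?W \<rho>)"
        by (rule sum.reindex_cong[OF inj refl refl, symmetric])
      also have "\<dots> \<le> (\<Sum>\<rho>\<in>tuples m n. ?W \<rho>)"
      proof (rule sum_mono2[OF finite_tuples])
        show "?h ` tuples m n \<subseteq> tuples m n"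
        proof (intro image_subsetI restrict_PiE_iff[THEN iffD2] ballI CollectI)
          fix \<tau> i assume "\<tau> \<in> tuples m n" "i \<in> {1..m}"
          then show "\<tau> i \<circ> inv (\<sigma> i) permutes {1..n}"
            by (intro permutes_compose[OF permutes_inv[OF \<sigma>p] tuples_mem])
        qed
      qed simp
      also have "\<dots> \<le> ?Z" by (rule sum_exp_agreements_le[OF m])
      finally show "(\<Sum>\<tau>\<in>tuples m n. ?W (?h \<tau>)) \<le> ?Z" .
    qed
    finally show "(\<Sum>\<tau>\<in>tuples m n. real (card {f \<in> colourings m n r. ?R f \<sigma> \<and> ?R f \<tau>})) \<le> ?C * ?Z" .
  qed
  finally show ?thesis by (simp only: sum_constant card_tuples of_nat_power of_nat_fact)
qed

lemma second_moment_algebra: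
  fixes a J R Z K p :: real
  assumes "a \<noteq> 0" "R \<noteq> 0" "m \<ge> 1"
  shows "(a ^ m * ((J ^ 2 / R) ^ N * K * (a * Z ^ (m - 1)))) * (p * R ^ N)
    = (a ^ m * J ^ N) ^ 2 * (p * (K * (Z / a) ^ (m - 1)))"
proof -
  have h1: "(J ^ 2 / R) ^ N * R ^ N = J ^ N * J ^ N"
    using assms(2) by (simp add: power_divide power2_eq_square power_mult_distrib)
  have h2: "a * Z ^ (m - 1) = a ^ m * (Z / a) ^ (m - 1)"
    using assms(1,3) by (cases m) (simp_all add: power_divide)
  have "(a ^ m * ((J ^ 2 / R) ^ N * K * (a * Z ^ (m - 1)))) * (p * R ^ N)
     = a ^ m * ((J ^ 2 / R) ^ N * R ^ N) * K * p * (a * Z ^ (m - 1))"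
    by (simp only: mult_ac)
  also have "\<dots> = (a ^ m * J ^ N) ^ 2 * (p * (K * (Z / a) ^ (m - 1)))"
    unfolding h1 h2 by (simp only: power2_eq_square mult_ac)
  finally show ?thesis .
qed

text \<open>
  Second moment method: by Cauchy and Schwarz, the square of the mean number of rainbow stackings is
  at most its mean square times the probability that one exists.
\<close>

lemma stacking_prob_ge:
  assumes r: "r \<ge> 4 * m ^ 2" "r \<ge> 2" and m: "m \<ge> 1"
  shows "1 \<le> stacking_prob m n r * (exp (25 * real m ^ 6 * real (n choose 2) / real r ^ 3)
    * (fixed_edge_sum n (exp (real m * pair_exponent m r / 2)) / fact n) ^ (m - 1))"
proof -
  let ?N = "n choose 2" and ?J = "falling m r" and ?Z = "fixed_edge_sum n (exp (real m * pair_exponent m r / 2))"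
  let ?K = "exp (25 * real m ^ 6 * real ?N / real r ^ 3)"
  let ?X = "\<lambda>f. real (card {\<sigma> \<in> tuples m n. rainbow_stacking m n f \<sigma>})"
  let ?H = "\<lambda>f. \<exists>\<sigma>. rainbow_stacking m n f \<sigma>"
  let ?M = "(fact n ^ m * ?J ^ ?N) ^ 2"
  have r0: "r > 0" using r by simp
  have "4 * m * 1 \<le> 4 * m * m" using m by (intro mult_le_mono2)
  also have "\<dots> = 4 * m ^ 2" by (simp add: power2_eq_square)
  also note r(1)
  finally have "4 * m \<le> r" by (simp only: mult_1_right)
  then have J: "?J > 0" unfolding falling_def using m by (intro prod_pos) auto
  have supp: "?X f = ?X f * of_bool (?H f)" for f
  proof (cases "?H f")
    case False
    then have "{\<sigma> \<in> tuples m n. rainbow_stacking m n f \<sigma>} = {}" by blast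
    then show ?thesis by (simp only: card.empty of_nat_0 mult_zero_left)
  qed simp
  have "?M = (\<Sum>f\<in>colourings m n r. ?X f * of_bool (?H f)) ^ 2"
    unfolding sum_rainbow[symmetric] by (rule arg_cong[OF sum.cong[OF refl supp]])
  also have "\<dots> \<le> (\<Sum>f\<in>colourings m n r. ?X f ^ 2) * (\<Sum>f\<in>colourings m n r. of_bool (?H f) ^ 2)"
    by (rule Cauchy_Schwarz_ineq_sum)
  also have "(\<Sum>f\<in>colourings m n r. of_bool (?H f) ^ 2) = real (card {f \<in> colourings m n r. ?H f})"
    unfolding card_filter_of_bool[OF finite_colourings] by (rule sum.cong[OF refl]) simp
  also have "(\<Sum>f\<in>colourings m n r. ?X f ^ 2) * real (card {f \<in> colourings m n r. ?H f}) \<le>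
     (fact n ^ m * ((?J ^ 2 / real r ^ m) ^ ?N * ?K * (fact n * ?Z ^ (m - 1)))) * real (card {f \<in> colourings m n r. ?H f})"
    by (rule mult_right_mono[OF sum_rainbow_sq_le[OF r m]]) simp
  also have "real (card {f \<in> colourings m n r. ?H f}) = stacking_prob m n r * (real r ^ m) ^ ?N"
    using r0 unfolding stacking_prob_eq[OF r0] by simp
  also have "(fact n ^ m * ((?J ^ 2 / real r ^ m) ^ ?N * ?K * (fact n * ?Z ^ (m - 1)))) * (stacking_prob m n r * (real r ^ m) ^ ?N)
     = ?M * (stacking_prob m n r * (?K * (?Z / fact n) ^ (m - 1)))"
    by (rule second_moment_algebra) (use r0 m in simp_all)
  finally have "?M * 1 \<le> ?M * (stacking_prob m n r * (?K * (?Z / fact n) ^ (m - 1)))"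
    unfolding mult_1_right .
  moreover have "?M > 0" using J by simp
  ultimately show ?thesis by (simp only: mult_le_cancel_left_pos)
qed

section \<open>The threshold\<close>

lemma distinct_prob_bounds:
  assumes "r > 0"
  shows "0 \<le> distinct_prob r m" "distinct_prob r m \<le> exp (- (pair_exponent m r * (real m * (real m - 1) / 2)))"
proof -
  have "0 \<le> distinct_prob r m \<and> distinct_prob r m \<le> exp (- (pair_exponent m r * (real m * (real m - 1) / 2)))"
  proof (cases "m > r")
    case True
    then have "distinct_prob r m = 0" unfolding distinct_prob_def using assms
      by (intro prod_zero) (auto intro!: bexI[of _ r])
    then show ?thesis by simp
  next
    case False
    have t: "0 \<le> real t / real r" "real t / real r \<le> 1" if "t \<in> {..<m}" for t
      using that False by auto
    have "distinct_prob r m \<le> (\<Prod>t<m. exp (- (real t / real r) - (real t / real r) ^ 2 / 2))"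
      unfolding distinct_prob_def using t by (intro prod_mono conjI one_minus_le_exp) auto
    also have "\<dots> = exp (\<Sum>t<m. - (real t / real r) - (real t / real r) ^ 2 / 2)"
      by (simp add: exp_sum)
    also have "(\<Sum>t<m. - (real t / real r) - (real t / real r) ^ 2 / 2)
      = - ((\<Sum>t<m. real t) / real r + (\<Sum>t<m. real t ^ 2) / (2 * real r ^ 2))"
      by (simp add: sum_subtractf sum_negf sum_divide_distrib power_divide mult.commute)
    also have "\<dots> = - (pair_exponent m r * (\<Sum>t<m. real t))"
      unfolding sum_squares_lessThan_real pair_exponent_def using assms by (simp add: field_simps power2_eq_square)
    also have "\<dots> = - (pair_exponent m r * (real m * (real m - 1) / 2))"
      by (simp only: sum_lessThan_real)
    finally have "distinct_prob r m \<le> exp (- (pair_exponent m r * (real m * (real m - 1) / 2)))" .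
    moreover have "0 \<le> distinct_prob r m"
      unfolding distinct_prob_def using t by (intro prod_nonneg) auto
    ultimately show ?thesis by simp
  qed
  then show "0 \<le> distinct_prob r m" "distinct_prob r m \<le> exp (- (pair_exponent m r * (real m * (real m - 1) / 2)))"
    by auto
qed

lemma pair_exponent_nonneg: "m \<ge> 1 \<Longrightarrow> x > 0 \<Longrightarrow> pair_exponent m x \<ge> 0"
  unfolding pair_exponent_def by simp

lemma pair_exponent_antimono:
  assumes "m \<ge> 1" "0 < x" "x \<le> y"
  shows "pair_exponent m y \<le> pair_exponent m x"
  unfolding pair_exponent_def using assms
  by (intro add_mono divide_left_mono mult_left_mono power_mono) auto

text \<open>
  The number \<open>r0\<close> solves \<open>N * (m / 2) * pair_exponent m x = ln (n!)\<close> up to an error of the order of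
  \<open>1 / x\<close>. This is the exact form, with \<open>s\<close> the distance of \<open>x\<close> from \<open>r0\<close>.
\<close>

lemma expected_exponent:
  fixes m n :: nat and x :: real
  assumes "n \<ge> 2" "x > 0"
  defines "c \<equiv> (2 * real m - 1) / 6" and "s \<equiv> x - r0 m n"
  shows "real (n choose 2) * (real m / 2 * pair_exponent m x)
    = ln (fact n) * (1 - s / x - c * (s + c) / x ^ 2)"
proof -
  define L where "L = ln (fact n :: real)"
  have L: "L > 0" unfolding L_def using assms by (intro ln_fact_pos)
  have "real m * real (n choose 2) / (2 * L) = x - s - c"
    by (simp add: s_def c_def r0_def L_def)
  then have N: "real (n choose 2) * (real m / 2) = L * (x - s - c)" using L by (simp add: field_simps)
  have p: "pair_exponent m x = (x + c) / x ^ 2"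
    using assms(2) by (simp add: pair_exponent_def c_def field_simps power2_eq_square)
  have "real (n choose 2) * (real m / 2 * pair_exponent m x) = L * (x - s - c) * ((x + c) / x ^ 2)"
    unfolding p mult.assoc[symmetric] N ..
  also have "\<dots> = L * (1 - s / x - c * (s + c) / x ^ 2)"
    using assms(2) by (simp add: field_simps power2_eq_square)
  finally show ?thesis by (simp add: L_def)
qed

lemma stacking_prob_le_exp:
  assumes "r > 0" "m \<ge> 1" "n \<ge> 2"
  shows "stacking_prob m n r \<le>
    exp (real (m - 1) * (ln (fact n) - real (n choose 2) * (real m / 2 * pair_exponent m r)))"
proof -
  have "stacking_prob m n r \<le> fact n ^ (m - 1) * distinct_prob r m ^ (n choose 2)"
    by (rule stacking_prob_le[OF assms(1,2)])
  also have "\<dots> \<le> fact n ^ (m - 1) * exp (- (pair_exponent m r * (real m * (real m - 1) / 2))) ^ (n choose 2)"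
    using distinct_prob_bounds[OF assms(1)] by (intro mult_left_mono power_mono) auto
  also have "\<dots> = exp (real (m - 1) * ln (fact n)) * exp (real (n choose 2) * (- (pair_exponent m r * (real m * (real m - 1) / 2))))"
  proof -
    have "(fact n :: real) ^ (m - 1) = exp (real (m - 1) * ln (fact n))"
      by (simp add: exp_of_nat_mult)
    then show ?thesis unfolding exp_of_nat_mult[symmetric] by (simp only:)
  qed
  also have "\<dots> = exp (real (m - 1) * (ln (fact n) - real (n choose 2) * (real m / 2 * pair_exponent m r)))"
    using assms(2) by (simp add: exp_add[symmetric] algebra_simps of_nat_diff)
  finally show ?thesis .
qed

lemma inverse_le_of_one_le_mult:
  fixes p u :: real
  assumes "0 \<le> p" "1 \<le> p * u"
  shows "inverse u \<le> p"
proof -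
  have "0 < p * u" using assms(2) by linarith
  then have "u > 0" using assms(1) by (auto simp: zero_less_mult_iff)
  then show ?thesis using assms(2) by (simp add: field_simps)
qed

lemma stacking_prob_ge_inverse:
  fixes m n r :: nat and x :: real
  assumes m: "m \<ge> 1" and r: "x \<ge> 4 * real m ^ 2" "x \<ge> 2" "real r \<ge> x"
  defines "\<theta> \<equiv> exp (real m / 2 * pair_exponent m x)"
  shows "inverse (exp (25 * real m ^ 6 * real (n choose 2) / x ^ 3)
     * (exp ((\<theta> - 1) / 2) * (1 + fixed_excess n \<theta>)) ^ (m - 1)) \<le> stacking_prob m n r"
proof -
  let ?\<theta>' = "exp (real m * pair_exponent m r / 2)"
  let ?K = "exp (25 * real m ^ 6 * real (n choose 2) / x ^ 3)"
  have "real (4 * m ^ 2) \<le> real r" using r by simp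
  then have r1: "4 * m ^ 2 \<le> r" by (simp only: of_nat_le_iff)
  have r2: "2 \<le> r" using r by linarith
  have p0: "stacking_prob m n r \<ge> 0" by (simp add: stacking_prob_def)
  have "pair_exponent m r \<le> pair_exponent m x" "0 \<le> pair_exponent m r"
    using pair_exponent_antimono[OF m, of x "real r"] pair_exponent_nonneg[OF m, of "real r"] r by auto
  then have th: "?\<theta>' \<le> \<theta>" "?\<theta>' \<ge> 1"
    unfolding \<theta>_def by (simp_all add: mult_left_mono)
  have Z: "fixed_edge_sum n ?\<theta>' / fact n \<le> exp ((\<theta> - 1) / 2) * (1 + fixed_excess n \<theta>)"
  proof -
    have "fixed_edge_sum n ?\<theta>' \<le> fixed_edge_sum n \<theta>"
      unfolding fixed_edge_sum_def using th by (intro sum_mono power_mono) auto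
    also have "\<dots> \<le> fact n * (exp ((\<theta> - 1) / 2) * (1 + fixed_excess n \<theta>))"
      unfolding fixed_edge_sum_def edges_eq_pairs_of
    proof (rule sum_power_fixed_pairs_le)
      show "1 \<le> \<theta>" using th by linarith
    qed simp_all
    finally show ?thesis by (simp add: field_simps)
  qed
  have Z0: "0 \<le> fixed_edge_sum n ?\<theta>' / fact n" unfolding fixed_edge_sum_def by (intro divide_nonneg_nonneg sum_nonneg) auto
  have K: "exp (25 * real m ^ 6 * real (n choose 2) / real r ^ 3) \<le> ?K"
    using r by (auto intro!: divide_left_mono power_mono)
  let ?U = "?K * (exp ((\<theta> - 1) / 2) * (1 + fixed_excess n \<theta>)) ^ (m - 1)"
  have "1 \<le> stacking_prob m n r * (exp (25 * real m ^ 6 * real (n choose 2) / real r ^ 3)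
    * (fixed_edge_sum n ?\<theta>' / fact n) ^ (m - 1))"
    by (rule stacking_prob_ge[OF r1 r2 m])
  also have "\<dots> \<le> stacking_prob m n r * ?U"
    using K Z Z0 p0 by (intro mult_left_mono mult_mono power_mono) auto
  finally have U: "1 \<le> stacking_prob m n r * ?U" .
  show ?thesis by (rule inverse_le_of_one_le_mult[OF p0 U])
qed

lemma eventually_along: "eventually P (along A) \<longleftrightarrow> (\<forall>\<^sub>F n in sequentially. n \<in> A \<longrightarrow> P n)"
  unfolding along_def by (rule eventually_inf_principal)

lemma tendsto_along: "f \<longlonglongrightarrow> l \<Longrightarrow> (f \<longlongrightarrow> l) (along A)"
  unfolding along_def by (rule tendsto_mono[OF inf_le1])

text \<open>
  All quantities are compared with \<open>r0\<close>, of order \<open>n / ln n\<close>. The last limit is the one for which the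
  distance \<open>1 / ln n\<close> was chosen: it is the gain in the logarithm of the expected number of stackings.
\<close>

lemma shifted_threshold_asymptotics:
  fixes m :: nat and s :: "nat \<Rightarrow> real"
  assumes m: "m \<ge> 2" and s: "\<And>n. s n = 1 / ln (real n) \<or> s n = - 1 / ln (real n)"
  defines "x \<equiv> \<lambda>n. r0 m n + s n"
  shows "filterlim x at_top sequentially"
    "(\<lambda>n. real (n choose 2) / x n ^ 3) \<longlonglongrightarrow> 0"
    "(\<lambda>n. ln (fact n) / x n ^ 2) \<longlonglongrightarrow> 0"
    "filterlim (\<lambda>n. ln (fact n) * (1 / ln (real n)) / x n) at_top sequentially"
proof -
  define y where "y = (\<lambda>n. x n * ln (real n) / real n)"
  define q where "q = (\<lambda>n. ln (fact n :: real) / (real n * ln (real n)))"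
  have m0: "real m / 4 > 0" using m by simp
  have q: "q \<longlonglongrightarrow> 1" unfolding q_def by (rule ln_fact_asymp)
  have sy: "(\<lambda>n. s n * ln (real n) / real n) \<longlonglongrightarrow> 0"
  proof (rule Lim_null_comparison)
    show "\<forall>\<^sub>F n in sequentially. norm (s n * ln (real n) / real n) \<le> 1 / real n"
      using eventually_ge_at_top[of 2]
    proof eventually_elim
      case (elim n)
      then have "ln (real n) > 0" by simp
      then show ?case using s[of n] by auto
    qed
  qed real_asymp
  have y: "y \<longlonglongrightarrow> real m / 4"
    using tendsto_add[OF r0_asymp[of m] sy] unfolding y_def x_def by (simp add: algebra_simps add_divide_distrib)
  have ev: "\<forall>\<^sub>F n in sequentially. x n = y n * (real n / ln (real n)) \<and> real n > 1 \<and> y n > 0"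
    using eventually_ge_at_top[of 2] order_tendstoD(1)[OF y m0]
    by eventually_elim (auto simp: y_def)
  show "filterlim x at_top sequentially"
  proof (rule filterlim_mono_eventually[OF _ order.refl order.refl])
    show "filterlim (\<lambda>n. y n * (real n / ln (real n))) at_top sequentially"
      by (rule filterlim_tendsto_pos_mult_at_top[OF y m0]) real_asymp
    show "\<forall>\<^sub>F n in sequentially. y n * (real n / ln (real n)) = x n"
      using ev by eventually_elim simp
  qed
  have "(\<lambda>n. (real n * (real n - 1) / 2) / (real n / ln (real n)) ^ 3 / y n ^ 3) \<longlonglongrightarrow> 0 / (real m / 4) ^ 3"
    using m0 by (intro tendsto_divide tendsto_power y) (real_asymp | simp)+
  then have "(\<lambda>n. (real n * (real n - 1) / 2) / (real n / ln (real n)) ^ 3 / y n ^ 3) \<longlonglongrightarrow> 0" by simp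
  then show "(\<lambda>n. real (n choose 2) / x n ^ 3) \<longlonglongrightarrow> 0"
  proof (rule Lim_transform_eventually)
    show "\<forall>\<^sub>F n in sequentially. (real n * (real n - 1) / 2) / (real n / ln (real n)) ^ 3 / y n ^ 3 = real (n choose 2) / x n ^ 3"
      using ev by eventually_elim (simp only: real_choose_two power_mult_distrib divide_divide_eq_left mult.commute)
  qed
  have "(\<lambda>n. q n * ((real n * ln (real n)) / (real n / ln (real n)) ^ 2) / y n ^ 2) \<longlonglongrightarrow> 1 * 0 / (real m / 4) ^ 2"
    using m0 by (intro tendsto_divide tendsto_mult q tendsto_power y) (real_asymp | simp)+
  then have "(\<lambda>n. q n * ((real n * ln (real n)) / (real n / ln (real n)) ^ 2) / y n ^ 2) \<longlonglongrightarrow> 0" by simp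
  then show "(\<lambda>n. ln (fact n) / x n ^ 2) \<longlonglongrightarrow> 0"
  proof (rule Lim_transform_eventually)
    show "\<forall>\<^sub>F n in sequentially. q n * ((real n * ln (real n)) / (real n / ln (real n)) ^ 2) / y n ^ 2 = ln (fact n) / x n ^ 2"
      using ev
    proof eventually_elim
      case (elim n)
      have "q n * (real n * ln (real n)) = ln (fact n)" using elim by (simp add: q_def)
      moreover have "x n ^ 2 = (real n / ln (real n)) ^ 2 * y n ^ 2" using elim by (metis power_mult_distrib mult.commute)
      ultimately show ?case by (simp only: times_divide_eq_right divide_divide_eq_left)
    qed
  qed
  show "filterlim (\<lambda>n. ln (fact n) * (1 / ln (real n)) / x n) at_top sequentially"
  proof (rule filterlim_mono_eventually[OF _ order.refl order.refl])
    have "(\<lambda>n. q n / y n) \<longlonglongrightarrow> 1 / (real m / 4)"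
      using m0 by (intro tendsto_divide q y) simp
    then show "filterlim (\<lambda>n. q n / y n * ln (real n)) at_top sequentially"
      by (rule filterlim_tendsto_pos_mult_at_top) (use m0 in simp, real_asymp)
    show "\<forall>\<^sub>F n in sequentially. q n / y n * ln (real n) = ln (fact n) * (1 / ln (real n)) / x n"
      using ev
    proof eventually_elim
      case (elim n)
      then have "ln (real n) > 0" "real n > 0" by auto
      then show ?case using elim by (simp add: q_def field_simps)
    qed
  qed
qed

lemma stacking_prob_tendsto_0:
  assumes m: "m \<ge> 2" and r: "\<forall>n\<in>gap_orders m. r n > 0" "\<forall>n\<in>gap_orders m. int (r n) < \<lceil>r0 m n\<rceil>"
  shows "((\<lambda>n. stacking_prob m n (r n)) \<longlongrightarrow> 0) (along (gap_orders m))"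
proof -
  define c where "c = (2 * real m - 1) / 6"
  define s where "s n = - 1 / ln (real n)" for n :: nat
  define x where "x n = r0 m n + s n" for n
  define \<kappa> where "\<kappa> n = ln (fact n :: real) * (1 / ln (real n)) / x n" for n
  have s: "s n = 1 / ln (real n) \<or> s n = - 1 / ln (real n)" for n by (simp add: s_def)
  note asym = shifted_threshold_asymptotics[OF m s, folded x_def, folded \<kappa>_def]
  let ?U = "\<lambda>n. exp (real (m - 1) * (c ^ 2 * (ln (fact n) / x n ^ 2) - \<kappa> n))"
  have "filterlim (\<lambda>n. real (m - 1) * (c ^ 2 * (ln (fact n) / x n ^ 2) - \<kappa> n)) at_bot sequentially"
  proof -
    have c0: "(\<lambda>n. c ^ 2 * (ln (fact n) / x n ^ 2)) \<longlonglongrightarrow> c ^ 2 * 0"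
      using asym(3) by (intro tendsto_mult tendsto_const) auto
    have "filterlim (\<lambda>n. - (c ^ 2 * (ln (fact n) / x n ^ 2)) + \<kappa> n) at_top sequentially"
      by (rule filterlim_tendsto_add_at_top[OF tendsto_minus[OF c0] asym(4)])
    then have "filterlim (\<lambda>n. real (m - 1) * (- (c ^ 2 * (ln (fact n) / x n ^ 2)) + \<kappa> n)) at_top sequentially"
      by (rule filterlim_tendsto_pos_mult_at_top[OF tendsto_const, rotated]) (use m in simp)
    moreover have "real (m - 1) * (c ^ 2 * (ln (fact n) / x n ^ 2) - \<kappa> n)
        = - (real (m - 1) * (- (c ^ 2 * (ln (fact n) / x n ^ 2)) + \<kappa> n))" for n
      by (simp add: right_diff_distrib)
    ultimately show ?thesis by (simp only: filterlim_uminus_at_bot minus_minus)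
  qed
  then have U: "?U \<longlonglongrightarrow> 0" by (rule filterlim_compose[OF exp_at_bot])
  show ?thesis
  proof (rule tendsto_sandwich[OF _ _ tendsto_const tendsto_along[OF U]])
    show "\<forall>\<^sub>F n in along (gap_orders m). 0 \<le> stacking_prob m n (r n)"
      by (simp add: stacking_prob_def)
    have "\<forall>\<^sub>F n in sequentially. x n > 0"
      using asym(1) by (simp add: filterlim_at_top_dense)
    then show "\<forall>\<^sub>F n in along (gap_orders m). stacking_prob m n (r n) \<le> ?U n"
      unfolding eventually_along using eventually_ge_at_top[of 2]
    proof (eventually_elim, intro impI)
      fix n assume x0: "x n > 0" and n2: "n \<ge> 2" and n: "n \<in> gap_orders m"
      let ?d = "1 / ln (real n)"
      have d0: "?d > 0" using n2 by simp
      have L: "ln (fact n :: real) > 0" using n2 by (rule ln_fact_pos)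
      have far: "?d \<le> \<bar>r0 m n - real_of_int (\<lceil>r0 m n\<rceil> - 1)\<bar>"
        using n unfolding gap_orders_def by blast
      have "int (r n) \<le> \<lceil>r0 m n\<rceil> - 1" using r(2) n by auto
      then have "real (r n) \<le> real_of_int (\<lceil>r0 m n\<rceil> - 1)" by linarith
      moreover have "real_of_int (\<lceil>r0 m n\<rceil> - 1) < r0 m n" by linarith
      ultimately have rx: "real (r n) \<le> x n" using far unfolding x_def s_def by linarith
      have rn: "r n > 0" using r(1) n by auto
      have "real (n choose 2) * (real m / 2 * pair_exponent m (x n)) = ln (fact n) * (1 - (- ?d) / x n - c * ((- ?d) + c) / x n ^ 2)"
        using expected_exponent[OF n2 x0, of m] by (simp add: x_def s_def c_def)
      also have "\<dots> = ln (fact n) + \<kappa> n - c ^ 2 * (ln (fact n) / x n ^ 2) + ln (fact n) * (c * ?d / x n ^ 2)"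
        using x0 by (simp add: \<kappa>_def field_simps power2_eq_square)
      also have "\<dots> \<ge> ln (fact n) + \<kappa> n - c ^ 2 * (ln (fact n) / x n ^ 2)"
        using L d0 m by (simp add: c_def)
      finally have lower: "ln (fact n) + \<kappa> n - c ^ 2 * (ln (fact n) / x n ^ 2) \<le> real (n choose 2) * (real m / 2 * pair_exponent m (x n))" .
      have "real (n choose 2) * (real m / 2 * pair_exponent m (x n)) \<le> real (n choose 2) * (real m / 2 * pair_exponent m (r n))"
        using rx rn m by (intro mult_left_mono pair_exponent_antimono) auto
      with lower have "ln (fact n) - real (n choose 2) * (real m / 2 * pair_exponent m (r n)) \<le> c ^ 2 * (ln (fact n) / x n ^ 2) - \<kappa> n"
        by linarith
      then have "exp (real (m - 1) * (ln (fact n) - real (n choose 2) * (real m / 2 * pair_exponent m (r n)))) \<le> ?U n"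
        by (simp add: mult_left_mono)
      moreover have "stacking_prob m n (r n) \<le> exp (real (m - 1) * (ln (fact n) - real (n choose 2) * (real m / 2 * pair_exponent m (r n))))"
        using m by (intro stacking_prob_le_exp rn n2) auto
      ultimately show "stacking_prob m n (r n) \<le> ?U n" by linarith
    qed
  qed
qed

lemma stacking_prob_tendsto_1:
  assumes m: "m \<ge> 2" and r: "\<forall>n\<in>gap_orders m. int (r n) \<ge> \<lceil>r0 m n\<rceil>"
  shows "((\<lambda>n. stacking_prob m n (r n)) \<longlongrightarrow> 1) (along (gap_orders m))"
proof -
  define c where "c = (2 * real m - 1) / 6"
  define s where "s n = 1 / ln (real n)" for n :: nat
  define x where "x n = r0 m n + s n" for n
  define \<kappa> where "\<kappa> n = ln (fact n :: real) * (1 / ln (real n)) / x n" for n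
  have s: "s n = 1 / ln (real n) \<or> s n = - 1 / ln (real n)" for n by (simp add: s_def)
  define \<mu> where "\<mu> = (\<lambda>n. real m / 2 * pair_exponent m (x n))"
  note asym = shifted_threshold_asymptotics[OF m s, folded x_def, folded \<kappa>_def]
  have xbig: "\<forall>\<^sub>F n in sequentially. x n \<ge> C" for C
    using asym(1) by (simp add: filterlim_at_top)
  have \<mu>: "\<forall>\<^sub>F n in sequentially. 0 \<le> \<mu> n \<and> real (n choose 2) * \<mu> n \<le> ln (fact n) - \<kappa> n"
    using xbig[of 1] eventually_ge_at_top[of 2]
  proof eventually_elim
    case (elim n)
    let ?d = "1 / ln (real n)"
    have x0: "x n > 0" using elim by simp
    have d0: "?d > 0" using elim by simp
    have L: "ln (fact n :: real) > 0" using elim by (intro ln_fact_pos)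
    have "real (n choose 2) * \<mu> n = ln (fact n) * (1 - ?d / x n - c * (?d + c) / x n ^ 2)"
      using expected_exponent[OF elim(2) x0, of m] by (simp add: x_def s_def c_def \<mu>_def)
    also have "\<dots> = ln (fact n) - \<kappa> n - ln (fact n) * (c * (?d + c) / x n ^ 2)"
      by (simp add: \<kappa>_def algebra_simps)
    also have "\<dots> \<le> ln (fact n) - \<kappa> n"
      using L d0 m by (simp add: c_def)
    finally show ?case using pair_exponent_nonneg[of m "x n"] x0 m by (simp add: \<mu>_def)
  qed
  note excess = fixed_excess_tendsto[OF \<mu> asym(4)]
  let ?U = "\<lambda>n. inverse (exp (25 * real m ^ 6 * real (n choose 2) / x n ^ 3)
     * (exp ((exp (\<mu> n) - 1) / 2) * (1 + fixed_excess n (exp (\<mu> n)))) ^ (m - 1))"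
  have "?U \<longlonglongrightarrow> inverse (exp (25 * real m ^ 6 * 0) * (exp ((exp 0 - 1) / 2) * (1 + 0)) ^ (m - 1))"
    unfolding times_divide_eq_right[symmetric]
    by (intro tendsto_inverse tendsto_mult tendsto_exp tendsto_power tendsto_add tendsto_diff tendsto_divide
        tendsto_const excess asym(2)) auto
  then have U: "?U \<longlonglongrightarrow> 1" by simp
  show ?thesis
  proof (rule tendsto_sandwich[OF _ _ tendsto_along[OF U] tendsto_const])
    show "\<forall>\<^sub>F n in along (gap_orders m). stacking_prob m n (r n) \<le> 1"
      by (simp add: stacking_prob_def)
    show "\<forall>\<^sub>F n in along (gap_orders m). ?U n \<le> stacking_prob m n (r n)"
      unfolding eventually_along using xbig[of 2] xbig[of "4 * real m ^ 2"]
    proof (eventually_elim, intro impI)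
      fix n assume x2: "x n \<ge> 2" and xm: "x n \<ge> 4 * real m ^ 2" and n: "n \<in> gap_orders m"
      have "1 / ln (real n) \<le> \<bar>r0 m n - real_of_int \<lceil>r0 m n\<rceil>\<bar>"
        using n unfolding gap_orders_def by blast
      moreover have "r0 m n \<le> real_of_int \<lceil>r0 m n\<rceil>" by linarith
      moreover have "real_of_int \<lceil>r0 m n\<rceil> \<le> real (r n)" using r n by fastforce
      ultimately have "x n \<le> real (r n)" unfolding x_def s_def by linarith
      then show "?U n \<le> stacking_prob m n (r n)"
        unfolding \<mu>_def using m x2 xm by (intro stacking_prob_ge_inverse) auto
    qed
  qed
qed

theorem mainTheorem2:
  fixes m :: nat
  assumes "m \<ge> 2"
  shows "\<exists>A :: nat set. A \<subseteq> {2..} \<and> natural_density_one A \<and>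
    (\<forall>r :: nat \<Rightarrow> nat. (\<forall>n\<in>A. r n > 0) \<longrightarrow>
      ((\<forall>n\<in>A. int (r n) < \<lceil>r0 m n\<rceil>) \<longrightarrow>
         ((\<lambda>n. stacking_prob m n (r n)) \<longlongrightarrow> 0) (along A)) \<and>
      ((\<forall>n\<in>A. int (r n) \<ge> \<lceil>r0 m n\<rceil>) \<longrightarrow>
         ((\<lambda>n. stacking_prob m n (r n)) \<longlongrightarrow> 1) (along A)))"
proof (intro exI conjI allI impI)
  show "gap_orders m \<subseteq> {2..}" by (auto simp: gap_orders_def)
  show "natural_density_one (gap_orders m)" by (rule natural_density_gap_orders[OF assms])
qed (use stacking_prob_tendsto_0[OF assms] stacking_prob_tendsto_1[OF assms] in blast)+

end
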